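(* Let $[E,P]\in\mathcal{M}_{1,1}$ be a general pointed complex elliptic curve. Then the number $N_5$ of pencils $\ell\in G^1_5(E)$ (equivalently, degree $5$ covers $f:E\to\mathbb{P}^1$ up to automorphisms of $\mathbb{P}^1$) such that $a_1^\ell(P)\ge5$ and there exist distinct points $P_1,P_2,P_3\in E\setminus\{P\}$ with $a_1^\ell(P_i)\ge3$ for $i=1,2,3$ is equal to $16$.
   Context: For a pencil $\ell$ on $E$ and a point $Q\in E$, $a^\ell(Q)=(a_0^\ell(Q)<a_1^\ell(Q))$ is the vanishing sequence of $\ell$ at $Q$, i.e. the orders of vanishing at $Q$ of sections of $\ell$. Such a pencil corresponds to a degree $5$ cover totally ramified at $P$, triply ramified at $P_1,P_2,P_3$, and with no further ramification points. *)

theory Defs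
  imports "HOL-Complex_Analysis.Complex_Analysis"
begin

text \<open>The elliptic curve E is modelled as the complex torus C / (Z + Z tau), Im tau > 0,
  with marked point P = the class of 0.  Degree d covers E \<rightarrow> P^1 are elliptic
  (doubly periodic, meromorphic) functions of degree d.\<close>

definition lattice_equiv :: "complex \<Rightarrow> complex \<Rightarrow> complex \<Rightarrow> bool" where
  "lattice_equiv \<tau> z w \<longleftrightarrow> (\<exists>m n :: int. z - w = of_int m + of_int n * \<tau>)"

definition elliptic_fun :: "complex \<Rightarrow> (complex \<Rightarrow> complex) \<Rightarrow> bool" where
  "elliptic_fun \<tau> f \<longleftrightarrow> f nicely_meromorphic_on UNIV \<and>
     (\<forall>z. f (z + 1) = f z \<and> f (z + \<tau>) = f z)"

definition fund_par :: "complex \<Rightarrow> complex set" where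
  "fund_par \<tau> = {of_real s + of_real t * \<tau> | s t. 0 \<le> s \<and> s < 1 \<and> 0 \<le> t \<and> t < 1}"

definition ell_degree :: "complex \<Rightarrow> (complex \<Rightarrow> complex) \<Rightarrow> nat" where
  "ell_degree \<tau> f = (\<Sum>z\<in>{z\<in>fund_par \<tau>. is_pole f z}. nat (- zorder f z))"

text \<open>Ramification index of f at z (the local multiplicity of f as a map to P^1).
  For the base-point-free pencil spanned by f this is a_1(z), with a_0(z) = 0.\<close>
definition ram_index :: "(complex \<Rightarrow> complex) \<Rightarrow> complex \<Rightarrow> nat" where
  "ram_index f z = (if is_pole f z then nat (- zorder f z)
                    else nat (zorder (\<lambda>w. f w - f z) z))"

definition moebius_equiv :: "(complex \<Rightarrow> complex) \<Rightarrow> (complex \<Rightarrow> complex) \<Rightarrow> bool" where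
  "moebius_equiv f g \<longleftrightarrow> (\<exists>a b c d :: complex. a * d - b * c \<noteq> 0 \<and>
      (\<forall>z0. \<forall>\<^sub>F w in at z0. g w = (a * f w + b) / (c * f w + d)))"

definition covers5 :: "complex \<Rightarrow> (complex \<Rightarrow> complex) set" where
  "covers5 \<tau> = {f. elliptic_fun \<tau> f \<and> ell_degree \<tau> f = 5 \<and> ram_index f 0 \<ge> 5 \<and>
     (\<exists>p1 p2 p3. \<not> lattice_equiv \<tau> p1 0 \<and> \<not> lattice_equiv \<tau> p2 0 \<and> \<not> lattice_equiv \<tau> p3 0 \<and>
        \<not> lattice_equiv \<tau> p1 p2 \<and> \<not> lattice_equiv \<tau> p1 p3 \<and> \<not> lattice_equiv \<tau> p2 p3 \<and>
        ram_index f p1 \<ge> 3 \<and> ram_index f p2 \<ge> 3 \<and> ram_index f p3 \<ge> 3)}"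

definition N5 :: "complex \<Rightarrow> nat" where
  "N5 \<tau> = card (covers5 \<tau> // {(f, g). f \<in> covers5 \<tau> \<and> g \<in> covers5 \<tau> \<and> moebius_equiv f g})"

text \<open>tau and sigma define isomorphic elliptic curves (same point of M_{1,1}).\<close>
definition SL2Z_equiv :: "complex \<Rightarrow> complex \<Rightarrow> bool" where
  "SL2Z_equiv \<tau> \<sigma> \<longleftrightarrow> (\<exists>a b c d :: int. a * d - b * c = 1 \<and>
      \<tau> = (of_int a * \<sigma> + of_int b) / (of_int c * \<sigma> + of_int d))"

end

theory Submission
  imports Defs "HOL-Computational_Algebra.Fundamental_Theorem_Algebra"
begin

text \<open>A Moebius map puts the pole of order five at the origin; the cover is then determined, up to an affine map,
  by its derivative, which has a pole of order six at \<open>P\<close> and double zeros at \<open>P1, P2, P3\<close>. Hence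
  \<open>P1 + P2 + P3\<close> is a 2-torsion point. If it is \<open>0\<close>, the derivative is the square \<open>(y + a x + b)^2\<close>,
  where \<open>x\<close> and \<open>y\<close> are the Weierstrass function and its derivative. If it is the half period where
  \<open>x = e\<close>, the derivative is \<open>4 k^2 / (x - e)\<close> with \<open>k = (x - e)(x + b) + a y / 2\<close>.
  Such an expression is the derivative of an elliptic function iff its coefficients of \<open>x\<close> and of \<open>1\<close>
  modulo derivatives vanish. These two equations leave a biquadratic equation for \<open>a\<close> in each case, so there are
  \<open>4 + 3 * 4 = 16\<close> solutions unless \<open>a\<close> degenerates or two of the \<open>P\<^sub>i\<close> collide, which happens
  for four values of the \<open>j\<close>-invariant only. Finally, \<open>g2\<close> and \<open>g3\<close> determine the lattice, because
  they determine the Weierstrass function near its pole.\<close>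

section \<open>Period lattices\<close>

text \<open>Abel's theorem is replaced by linear algebra. Three vanishing conditions on the
  four-dimensional space \<open>L(4 P)\<close> leave a \<open>k\<close> that is zero at all
  \<open>P_i\<close>, and \<open>k^2\<close> over the derivative lies in \<open>L(2 P)\<close>, the
  span of 1 and \<open>x\<close>. A constant quotient gives the square. Otherwise the quotient is a
  multiple of some \<open>x - t\<close> whose zeros have even order, since \<open>k^2\<close> and
  the derivative have only zeros of even order, and this puts \<open>t\<close> at a half period.

  Derivatives have codimension two among the functions with poles only at \<open>P\<close>, as the
  first de Rham cohomology of the curve has dimension two; this is why two equations arise for the
  two parameters \<open>a\<close> and \<open>b\<close>.

  Every degeneration is homogeneous, hence of the form \<open>k * g2^3 = c * g3^2\<close>. The
  collisions come from factoring the discriminant of the cubic satisfied by the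
  \<open>x\<close>-coordinates of the triple points: some factors belong to singular curves, the
  others give the exceptional moduli. One lattice chosen for each condition represents all that
  satisfy it, which is injectivity of the \<open>j\<close>-invariant.\<close>

locale period_lattice =
  fixes \<tau> :: complex
  assumes Im_pos: "Im \<tau> > 0"
begin

definition L :: "complex set" where
  "L = {of_int m + of_int n * \<tau> |m n :: int. True}"

lemma lattice_equiv_iff: "lattice_equiv \<tau> z w \<longleftrightarrow> z - w \<in> L"
  by (auto simp: lattice_equiv_def L_def)

lemma L_0 [simp]: "0 \<in> L" unfolding L_def by (force intro: exI[of _ "0::int"])

lemma L_1 [simp]: "1 \<in> L" unfolding L_def by (force intro: exI[of _ "1::int"] exI[of _ "0::int"])

lemma L_tau [simp]: "\<tau> \<in> L" unfolding L_def by (force intro: exI[of _ "1::int"] exI[of _ "0::int"])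

lemma L_add: "a \<in> L \<Longrightarrow> b \<in> L \<Longrightarrow> a + b \<in> L"
  unfolding L_def
proof clarsimp
  fix m n m' n' :: int
  show "\<exists>ma na. of_int m + of_int n * \<tau> + (of_int m' + of_int n' * \<tau>) = of_int ma + of_int na * \<tau>"
    by (rule exI[of _ "m + m'"], rule exI[of _ "n + n'"]) (simp add: algebra_simps)
qed

lemma L_uminus: "a \<in> L \<Longrightarrow> - a \<in> L"
  unfolding L_def
proof clarsimp
  fix m n :: int
  show "\<exists>ma na. - of_int m - of_int n * \<tau> = of_int ma + of_int na * \<tau>"
    by (rule exI[of _ "- m"], rule exI[of _ "- n"]) (simp add: algebra_simps)
qed

lemma L_uminus_iff [simp]: "- a \<in> L \<longleftrightarrow> a \<in> L"
  using L_uminus[of a] L_uminus[of "-a"] by auto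

lemma L_diff: "a \<in> L \<Longrightarrow> b \<in> L \<Longrightarrow> a - b \<in> L"
  using L_add[of a "-b"] by simp

lemma L_minus_commute: "a - b \<in> L \<longleftrightarrow> b - a \<in> L"
  using L_uminus_iff[of "a - b"] by (simp del: L_uminus_iff)

lemma L_add_iff [simp]: "b \<in> L \<Longrightarrow> a + b \<in> L \<longleftrightarrow> a \<in> L"
  using L_add[of a b] L_diff[of "a+b" b] by auto

lemma L_add_iff' [simp]: "b \<in> L \<Longrightarrow> b + a \<in> L \<longleftrightarrow> a \<in> L"
  using L_add_iff[of b a] by (simp add: add.commute)

definition periodic :: "(complex \<Rightarrow> complex) \<Rightarrow> bool" where
  "periodic f \<longleftrightarrow> (\<forall>z. \<forall>w\<in>L. f (z + w) = f z)"

lemma periodicI: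
  assumes "\<And>z. f (z + 1) = f z" "\<And>z. f (z + \<tau>) = f z"
  shows "periodic f"
proof -
  have 1: "f (z + of_nat n) = f z" for z and n :: nat
    by (induction n) (use assms(1)[of "z + of_nat _"] in \<open>auto simp: algebra_simps\<close>)
  have 2: "f (z + of_nat n * \<tau>) = f z" for z and n :: nat
    by (induction n) (use assms(2)[of "z + of_nat _ * \<tau>"] in \<open>auto simp: algebra_simps\<close>)
  have 3: "f (z + of_int n) = f z" for z and n :: int
    using 1[of z "nat n"] 1[of "z + of_int n" "nat (-n)"]
    by (cases "n \<ge> 0") auto
  have 4: "f (z + of_int n * \<tau>) = f z" for z and n :: int
    using 2[of z "nat n"] 2[of "z + of_int n * \<tau>" "nat (-n)"]
    by (cases "n \<ge> 0") auto
  show ?thesis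
    unfolding periodic_def L_def using 3 4 by (auto simp flip: add.assoc)
qed

lemma periodicD: "periodic f \<Longrightarrow> w \<in> L \<Longrightarrow> f (z + w) = f z"
  by (auto simp: periodic_def)

lemma periodic_cong: "periodic f \<Longrightarrow> z - w \<in> L \<Longrightarrow> f z = f w"
  using periodicD[of f "z - w" w] by simp

lemma elliptic_fun_iff: "elliptic_fun \<tau> f \<longleftrightarrow> f nicely_meromorphic_on UNIV \<and> periodic f"
  unfolding elliptic_fun_def using periodicI periodicD[of f 1] periodicD[of f \<tau>] by auto

text \<open>\<open>sc z\<close> and \<open>tc z\<close> are the real coordinates of \<open>z\<close>
  in the basis 1, \<tau>. In them the lattice is the set of integer points and period parallelograms
  are unit squares.\<close>

definition tc :: "complex \<Rightarrow> real" where "tc z = Im z / Im \<tau>"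
definition sc :: "complex \<Rightarrow> real" where "sc z = Re z - tc z * Re \<tau>"

lemma coords: "z = of_real (sc z) + of_real (tc z) * \<tau>"
  using Im_pos by (auto simp: complex_eq_iff sc_def tc_def)

lemma sc_tc_linear [simp]:
  "sc (z + w) = sc z + sc w" "tc (z + w) = tc z + tc w"
  "sc (z - w) = sc z - sc w" "tc (z - w) = tc z - tc w"
  "sc (- z) = - sc z" "tc (- z) = - tc z"
  "sc (of_real c * z) = c * sc z" "tc (of_real c * z) = c * tc z"
  "sc 1 = 1" "tc 1 = 0" "sc \<tau> = 0" "tc \<tau> = 1" "sc 0 = 0" "tc 0 = 0"
  "sc (of_real c) = c" "tc (of_real c) = 0" "sc (of_real c * \<tau>) = 0" "tc (of_real c * \<tau>) = c"
  "sc (of_int n) = of_int n" "tc (of_int n) = 0"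
  "sc (of_int n * \<tau>) = 0" "tc (of_int n * \<tau>) = of_int n"
  using Im_pos by (auto simp: sc_def tc_def field_simps)

lemma coords_eqI: "sc z = sc w \<Longrightarrow> tc z = tc w \<Longrightarrow> z = w"
  using coords[of z] coords[of w] by simp

lemma L_iff: "z \<in> L \<longleftrightarrow> sc z \<in> \<int> \<and> tc z \<in> \<int>"
proof
  assume "z \<in> L"
  then show "sc z \<in> \<int> \<and> tc z \<in> \<int>" by (auto simp: L_def)
next
  assume "sc z \<in> \<int> \<and> tc z \<in> \<int>"
  then obtain m n :: int where "sc z = of_int m" "tc z = of_int n" by (auto elim!: Ints_cases)
  then have "z = of_int m + of_int n * \<tau>"
    by (intro coords_eqI) auto
  then show "z \<in> L" by (auto simp: L_def)
qed

lemma fund_par_iff: "z \<in> fund_par \<tau> \<longleftrightarrow> 0 \<le> sc z \<and> sc z < 1 \<and> 0 \<le> tc z \<and> tc z < 1"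
proof
  assume "z \<in> fund_par \<tau>"
  then show "0 \<le> sc z \<and> sc z < 1 \<and> 0 \<le> tc z \<and> tc z < 1" by (auto simp: fund_par_def)
next
  assume "0 \<le> sc z \<and> sc z < 1 \<and> 0 \<le> tc z \<and> tc z < 1"
  then show "z \<in> fund_par \<tau>" unfolding fund_par_def using coords[of z] by blast
qed

text \<open>Half-open, so each class modulo \<open>L\<close> has exactly one representative. The
  corner is a parameter because the contour of the argument principle has to be moved off the zeros
  and poles.\<close>

definition par :: "real \<Rightarrow> real \<Rightarrow> complex set" where
  "par s t = {z. s \<le> sc z \<and> sc z < s + 1 \<and> t \<le> tc z \<and> tc z < t + 1}"

lemma fund_par_eq_par: "fund_par \<tau> = par 0 0"
  by (auto simp: par_def fund_par_iff)

definition red :: "real \<Rightarrow> real \<Rightarrow> complex \<Rightarrow> complex" where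
  "red s t z = z - of_int \<lfloor>sc z - s\<rfloor> - of_int \<lfloor>tc z - t\<rfloor> * \<tau>"

lemma red_in_par: "red s t z \<in> par s t"
  by (auto simp: red_def par_def) linarith+

lemma red_equiv: "z - red s t z \<in> L"
  by (auto simp: red_def L_def)

lemma par_equiv_eq:
  assumes "z \<in> par s t" "w \<in> par s t" "z - w \<in> L" shows "z = w"
proof -
  obtain m n :: int where mn: "sc (z - w) = of_int m" "tc (z - w) = of_int n"
    using assms(3) unfolding L_iff by (auto elim!: Ints_cases)
  have "\<bar>sc (z - w)\<bar> < 1" "\<bar>tc (z - w)\<bar> < 1"
    using assms(1,2) by (auto simp: par_def)
  then have "m = 0" "n = 0" using mn by linarith+
  then show ?thesis using mn by (intro coords_eqI) auto
qed

lemma red_eq_iff: "red s t z = red s t w \<longleftrightarrow> z - w \<in> L"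
proof
  assume "red s t z = red s t w"
  then show "z - w \<in> L" using L_diff[OF red_equiv[of z s t] red_equiv[of w s t]] by (simp add: algebra_simps)
next
  assume "z - w \<in> L"
  then have "red s t z - red s t w \<in> L"
    using L_add[OF L_diff[OF \<open>z - w \<in> L\<close> red_equiv[of z s t]] red_equiv[of w s t]]
    by (simp add: algebra_simps)
  then show "red s t z = red s t w" by (intro par_equiv_eq[OF red_in_par red_in_par])
qed

text \<open>Both parallelograms represent each class once, so \<open>red\<close> is a bijection
  between them and a sum over classes does not see the corner.\<close>

lemma sum_par_eq:
  fixes g :: "complex \<Rightarrow> 'a :: comm_monoid_add"
  assumes "\<And>z w. w \<in> L \<Longrightarrow> P (z + w) \<longleftrightarrow> P z" "\<And>z w. w \<in> L \<Longrightarrow> g (z + w) = g z"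
  shows "(\<Sum>z\<in>{z\<in>par s t. P z}. g z) = (\<Sum>z\<in>{z\<in>par s' t'. P z}. g z)"
proof (rule sum.reindex_bij_witness[of _ "red s t" "red s' t'"])
  have P: "P (red a b z) \<longleftrightarrow> P z" "g (red a b z) = g z" for a b z
    using assms[of "z - red a b z" "red a b z"] red_equiv[of z a b] by auto
  have R: "red a b (red c d z) = z" if "z \<in> par a b" for a b c d z
    using that par_equiv_eq[OF red_in_par, of z a b "red c d z"]
      L_add[OF red_equiv[of "red c d z" a b] red_equiv[of z c d]] L_minus_commute
    by (metis add.commute diff_add_cancel diff_add_eq diff_diff_eq2)
  show "red s t (red s' t' z) = z" if "z \<in> {z \<in> par s t. P z}" for z using that R by auto
  show "red s' t' (red s t z) = z" if "z \<in> {z \<in> par s' t'. P z}" for z using that R by auto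
  show "red s t z \<in> {z \<in> par s t. P z}" if "z \<in> {z \<in> par s' t'. P z}" for z
    using that P red_in_par by auto
  show "red s' t' z \<in> {z \<in> par s' t'. P z}" if "z \<in> {z \<in> par s t. P z}" for z
    using that P red_in_par by auto
  show "g (red s' t' z) = g z" if "z \<in> {z \<in> par s t. P z}" for z using P by auto
qed

lemma norm_par_le: "z \<in> par s t \<Longrightarrow> norm z \<le> \<bar>s\<bar> + 1 + (\<bar>t\<bar> + 1) * norm \<tau>"
proof -
  assume "z \<in> par s t"
  then have *: "\<bar>sc z\<bar> \<le> \<bar>s\<bar> + 1" "\<bar>tc z\<bar> \<le> \<bar>t\<bar> + 1" by (auto simp: par_def)
  have "norm z \<le> norm (of_real (sc z) :: complex) + norm (of_real (tc z) * \<tau>)"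
    using norm_triangle_ineq[of "of_real (sc z)" "of_real (tc z) * \<tau>"] coords[of z] by simp
  also have "\<dots> = \<bar>sc z\<bar> + \<bar>tc z\<bar> * norm \<tau>" by (simp add: norm_mult)
  also have "\<dots> \<le> \<bar>s\<bar> + 1 + (\<bar>t\<bar> + 1) * norm \<tau>" using * by (intro add_mono mult_mono) auto
  finally show ?thesis .
qed

lemma continuous_sc_tc [continuous_intros]:
  "continuous_on A sc" "continuous_on A tc"
  unfolding sc_def[abs_def] tc_def[abs_def] using Im_pos by (auto intro!: continuous_intros)

lemma dist_L_ge: "\<exists>d>0. \<forall>w\<in>L. w \<noteq> 0 \<longrightarrow> norm w \<ge> d"
proof -
  let ?U = "sc -` {-1<..<1} \<inter> tc -` {-1<..<1}"
  have "open ?U"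
    by (intro open_Int open_vimage continuous_sc_tc) auto
  moreover have "0 \<in> ?U" by auto
  ultimately obtain d where d: "d > 0" "ball 0 d \<subseteq> ?U" using openE by blast
  have "norm w \<ge> d" if "w \<in> L" "w \<noteq> 0" for w
  proof (rule ccontr)
    assume "\<not> norm w \<ge> d"
    then have "w \<in> ?U" using d by (intro subsetD[OF d(2)]) auto
    then have "sc w = 0" "tc w = 0" using that(1) unfolding L_iff by (auto elim!: Ints_cases)
    then show False using that(2) coords_eqI[of w 0] by auto
  qed
  then show ?thesis using d by blast
qed

lemma L_closed: "closed L"
proof -
  have "L = sc -` \<int> \<inter> tc -` \<int>" by (auto simp: L_iff)
  moreover have "closed (sc -` \<int> \<inter> tc -` \<int>)"
    by (intro closed_Int closed_vimage continuous_sc_tc closed_Ints)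
  ultimately show ?thesis by simp
qed

lemma L_isolated: "\<exists>d>0. \<forall>w\<in>L. w \<noteq> z \<longrightarrow> dist w z \<ge> d"
proof (cases "z \<in> L")
  case True
  obtain d where d: "d > 0" "\<And>w. w \<in> L \<Longrightarrow> w \<noteq> 0 \<Longrightarrow> norm w \<ge> d" using dist_L_ge by blast
  have "dist w z \<ge> d" if "w \<in> L" "w \<noteq> z" for w
    using d(2)[of "w - z"] that True L_diff by (auto simp: dist_norm)
  then show ?thesis using d by blast
next
  case False
  have "open (- L)" using L_closed by auto
  then obtain d where "d > 0" "ball z d \<subseteq> - L" using False openE by blast
  then have "\<forall>w\<in>L. w \<noteq> z \<longrightarrow> dist w z \<ge> d" by (force simp: dist_commute)
  then show ?thesis using \<open>d > 0\<close> by blast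
qed

lemma L_sparse: "L sparse_in UNIV"
proof -
  have "\<not> z islimpt L" for z
    using L_isolated[of z] by (force simp: islimpt_approachable)
  then show ?thesis by (auto simp: sparse_in_def)
qed

lemma L_countable: "countable L"
  using sparse_imp_countable[OF open_UNIV L_sparse] by auto

lemma eventually_notin_L: "eventually (\<lambda>w. w \<notin> L) (at z)"
  using L_isolated[of z] unfolding eventually_at by (metis linorder_not_less)

lemma connected_compl_L: "connected (- L)"
  using sparse_imp_connected[OF _ _ _ L_sparse] by (auto simp: Compl_eq_Diff_UNIV)

lemma open_compl_L [simp]: "open (- L)" using L_closed by auto

text \<open>All values are already taken on one compact disc that contains a fundamental
  parallelogram; Liouville's theorem does the rest.\<close>

lemma periodic_entire_const:
  assumes "f holomorphic_on UNIV" "periodic f"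
  obtains c where "\<And>z. f z = c"
proof -
  let ?K = "cball (0::complex) (1 + norm \<tau>)"
  have "compact (f ` ?K)"
    using assms(1) by (intro compact_continuous_image holomorphic_on_imp_continuous_on)
      (auto intro: holomorphic_on_subset)
  then have "bounded (f ` ?K)" by (rule compact_imp_bounded)
  moreover have "range f \<subseteq> f ` ?K"
  proof
    fix y assume "y \<in> range f"
    then obtain z where "y = f z" by auto
    moreover have "f z = f (red 0 0 z)" using assms(2) red_equiv periodic_cong by blast
    moreover have "red 0 0 z \<in> ?K" using norm_par_le[OF red_in_par[of 0 0 z]] by auto
    ultimately show "y \<in> f ` ?K" by auto
  qed
  ultimately have "bounded (range f)" using bounded_subset by blast
  then show ?thesis using Liouville_theorem[OF assms(1)] that
    by (metis constant_on_def iso_tuple_UNIV_I)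
qed

end

section \<open>Orders of elliptic functions sum to zero\<close>

lemma deriv_translate:
  assumes "\<And>z. f (z + w) = f z" shows "deriv f (z + w) = deriv f z"
proof -
  have "deriv f (z + w) = deriv (\<lambda>x. f (z + w + x)) 0"
    by (subst deriv_shift_0) (simp add: o_def)
  also have "(\<lambda>x. f (z + w + x)) = (\<lambda>x. f (z + x))" using assms by (metis add.assoc add.commute)
  also have "deriv \<dots> 0 = deriv f z" by (subst (2) deriv_shift_0) (simp add: o_def)
  finally show ?thesis .
qed

lemma zorder_translate:
  assumes "\<And>z. f (z + w) = f z" shows "zorder f (z + w) = zorder f z"
proof -
  have "zorder f (z + w) = zorder (\<lambda>u. f (u + (z + w))) 0" by (rule zorder_shift)
  also have "(\<lambda>u. f (u + (z + w))) = (\<lambda>u. f (u + z))" using assms by (metis add.assoc)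
  also have "zorder \<dots> 0 = zorder f z" by (rule zorder_shift [symmetric])
  finally show ?thesis .
qed

lemma contour_integral_linepath_translate:
  assumes "\<And>z. g (z + w) = g z"
  shows "contour_integral (linepath (a + w) (b + w)) g = contour_integral (linepath a b) g"
proof -
  have "(g has_contour_integral i) (linepath (a + w) (b + w)) \<longleftrightarrow> (g has_contour_integral i) (linepath a b)" for i
  proof -
    have "linepath (a + w) (b + w) x = linepath a b x + w" for x
      by (simp add: linepath_def algebra_simps flip: scaleR_add_left)
    then show ?thesis by (simp add: has_contour_integral_linepath assms)
  qed
  then show ?thesis by (simp add: contour_integral_def contour_integrable_on_def)
qed

context period_lattice
begin

lemma zeros_sparse:
  assumes "f nicely_meromorphic_on UNIV" "f z0 \<noteq> 0"
  shows "{z. f z = 0} sparse_in UNIV"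
  using nicely_meromorphic_imp_constant_or_avoid[OF assms(1) open_UNIV connected_UNIV, of 0] assms(2)
  by (auto simp: eventually_cosparse)

lemma finite_par_Int_sparse:
  assumes "X sparse_in UNIV" shows "finite {z\<in>par s t. z \<in> X}"
proof -
  let ?K = "cball (0::complex) (\<bar>s\<bar> + 1 + (\<bar>t\<bar> + 1) * norm \<tau>)"
  have "finite (?K \<inter> X)"
    by (intro sparse_in_compact_finite sparse_in_subset[OF assms]) auto
  moreover have "{z\<in>par s t. z \<in> X} \<subseteq> ?K \<inter> X" using norm_par_le by auto
  ultimately show ?thesis using finite_subset by blast
qed

text \<open>The excluded \<open>s\<close> form countably many translates of the integers, hence a
  countable set of reals.\<close>

lemma ex_generic_translate:
  assumes "countable X"
  obtains s :: real where "\<And>x. x \<in> X \<Longrightarrow> x - s \<notin> \<int>"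
proof -
  have "countable (\<Union>x\<in>X. \<Union>n::int. {x - of_int n})" using assms by auto
  then obtain s where "s \<notin> (\<Union>x\<in>X. \<Union>n::int. {x - of_int n})"
    using uncountable_UNIV_real by (metis UNIV_eq_I)
  then have "x - s \<notin> \<int>" if "x \<in> X" for x
    using that by (auto elim!: Ints_cases) (metis add_diff_cancel_left' diff_add_cancel)
  then show ?thesis using that by blast
qed

text \<open>Integrate the logarithmic derivative around a period parallelogram whose sides avoid all zeros and
  poles; opposite sides cancel.\<close>
lemma sum_zorder_par:
  assumes f: "f nicely_meromorphic_on UNIV" and per: "periodic f" and nz: "f z0 \<noteq> 0"
  shows "(\<Sum>z\<in>{z\<in>par s0 t0. f z = 0}. zorder f z) = 0"
proof -
  define Z where "Z = {z. f z = 0}"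
  define poles where "poles = {z. is_pole f z}"
  have Zsp: "Z sparse_in UNIV" unfolding Z_def by (rule zeros_sparse[OF f nz])
  have Zc: "countable Z" using sparse_imp_countable[OF open_UNIV Zsp] by simp
  \<comment> \<open>A nicely meromorphic function has the value 0 at its poles. Hence
    \<open>Z\<close> contains zeros and poles alike, and summing \<open>zorder\<close> over
    \<open>Z\<close> gives the degree of the whole divisor.\<close>
  have pZ: "poles \<subseteq> Z" unfolding poles_def Z_def using is_pole_zero_at_nicely_mero[OF f] by auto
  obtain s where s: "\<And>z. z \<in> Z \<Longrightarrow> sc z - s \<notin> \<int>"
    using ex_generic_translate[OF countable_image[OF Zc, of sc]] by (metis imageI)
  obtain t where t: "\<And>z. z \<in> Z \<Longrightarrow> tc z - t \<notin> \<int>"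
    using ex_generic_translate[OF countable_image[OF Zc, of tc]] by (metis imageI)
  define a where "a = of_real s + of_real t * \<tau>"
  have [simp]: "sc a = s" "tc a = t" by (simp_all add: a_def)
  define l1 where "l1 = linepath a (a + 1)"
  define l2 where "l2 = linepath (a + 1) (a + 1 + \<tau>)"
  define l3 where "l3 = linepath (a + 1 + \<tau>) (a + \<tau>)"
  define l4 where "l4 = linepath (a + \<tau>) a"
  define \<gamma> where "\<gamma> = l1 +++ l2 +++ l3 +++ l4"
  define P where "P = {z. s \<le> sc z \<and> sc z \<le> s + 1 \<and> t \<le> tc z \<and> tc z \<le> t + 1}"
  define P0 where "P0 = {z. s < sc z \<and> sc z < s + 1 \<and> t < tc z \<and> tc z < t + 1}"
  have scl: "sc (linepath b c u) = (1 - u) * sc b + u * sc c"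
            "tc (linepath b c u) = (1 - u) * tc b + u * tc c" for b c u
    by (simp_all add: linepath_def scaleR_conv_of_real del: of_real_diff)
  have scR: "sc (u *\<^sub>R z) = u * sc z" "tc (u *\<^sub>R z) = u * tc z" for u z
    by (simp_all add: scaleR_conv_of_real)
  have conv: "convex P"
    unfolding convex_def
  proof (intro ballI allI impI)
    fix x y and u v :: real
    assume *: "x \<in> P" "y \<in> P" "0 \<le> u" "0 \<le> v" "u + v = 1"
    have lo: "b \<le> u * p + v * q" if "b \<le> p" "b \<le> q" for b p q
      using convex_bound_le[of "-p" "-b" "-q" u v] that * by simp
    have hi: "u * p + v * q \<le> b" if "p \<le> b" "q \<le> b" for b p q
      using convex_bound_le[of p b q u v] that * by simp
    show "u *\<^sub>R x + v *\<^sub>R y \<in> P" using * lo hi by (simp add: P_def scR)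
  qed
  have conv0: "convex P0"
    unfolding convex_def
  proof (intro ballI allI impI)
    fix x y and u v :: real
    assume *: "x \<in> P0" "y \<in> P0" "0 \<le> u" "0 \<le> v" "u + v = 1"
    have lo: "b < u * p + v * q" if "b < p" "b < q" for b p q
      using convex_bound_lt[of "-p" "-b" "-q" u v] that * by simp
    have hi: "u * p + v * q < b" if "p < b" "q < b" for b p q
      using convex_bound_lt[of p b q u v] that * by simp
    show "u *\<^sub>R x + v *\<^sub>R y \<in> P0" using * lo hi by (simp add: P0_def scR)
  qed
  have img: "z \<in> P \<and> (sc z - s \<in> \<int> \<or> tc z - t \<in> \<int>)"
    if "z \<in> path_image l1 \<union> path_image l2 \<union> path_image l3 \<union> path_image l4" for z
  proof -
    have "a \<in> P" "a + 1 \<in> P" "a + 1 + \<tau> \<in> P" "a + \<tau> \<in> P" by (auto simp: P_def)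
    then have "path_image l1 \<union> path_image l2 \<union> path_image l3 \<union> path_image l4 \<subseteq> P"
      unfolding l1_def l2_def l3_def l4_def path_image_linepath
      using conv by (simp add: closed_segment_subset)
    moreover have "sc z - s \<in> \<int> \<or> tc z - t \<in> \<int>"
      using that unfolding l1_def l2_def l3_def l4_def path_image_def
      by (auto simp: scl algebra_simps)
    ultimately show ?thesis using that by auto
  qed
  have pim: "path_image \<gamma> = path_image l1 \<union> path_image l2 \<union> path_image l3 \<union> path_image l4"
    unfolding \<gamma>_def l1_def l2_def l3_def l4_def by (simp add: path_image_join Un_assoc)
  have vp: "valid_path \<gamma>" unfolding \<gamma>_def l1_def l2_def l3_def l4_def by (simp add: valid_path_join)
  have loop: "pathfinish \<gamma> = pathstart \<gamma>" unfolding \<gamma>_def l1_def l4_def by simp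
  have avoid: "path_image \<gamma> \<inter> Z = {}" using img s t pim by blast
  obtain R where R: "R > 0" "P \<subseteq> ball 0 R"
  proof -
    have "P \<subseteq> ball 0 (\<bar>s\<bar> + 2 + (\<bar>t\<bar> + 2) * norm \<tau>)"
    proof
      fix z assume "z \<in> P"
      then have *: "\<bar>sc z\<bar> \<le> \<bar>s\<bar> + 1" "\<bar>tc z\<bar> \<le> \<bar>t\<bar> + 2" by (auto simp: P_def)
      have "norm z \<le> norm (of_real (sc z) :: complex) + norm (of_real (tc z) * \<tau>)"
        using norm_triangle_ineq[of "of_real (sc z)" "of_real (tc z) * \<tau>"] coords[of z] by simp
      also have "\<dots> = \<bar>sc z\<bar> + \<bar>tc z\<bar> * norm \<tau>" by (simp add: norm_mult)
      also have "\<dots> \<le> \<bar>s\<bar> + 1 + (\<bar>t\<bar> + 2) * norm \<tau>" using * by (intro add_mono mult_mono) auto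
      finally show "z \<in> ball 0 (\<bar>s\<bar> + 2 + (\<bar>t\<bar> + 2) * norm \<tau>)" by simp
    qed
    moreover have "\<bar>s\<bar> + 2 + (\<bar>t\<bar> + 2) * norm \<tau> > 0"
      by (rule add_pos_nonneg) (auto intro: add_nonneg_pos)
    ultimately show ?thesis using that by blast
  qed
  have holo: "f holomorphic_on UNIV - poles"
  proof -
    have "f analytic_on {z}" if "z \<notin> poles" for z
      using nicely_meromorphic_on_imp_analytic_at[OF f, of z] that by (auto simp: poles_def)
    then have "f analytic_on UNIV - poles" by (subst analytic_on_analytic_at) auto
    then show ?thesis by (rule analytic_imp_holomorphic)
  qed
  define pz where "pz = {w \<in> ball 0 R. f w = 0 \<or> w \<in> poles}"
  have pz: "pz = Z \<inter> ball 0 R" using pZ by (auto simp: pz_def Z_def)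
  have fin: "finite pz"
  proof -
    have "finite (cball 0 R \<inter> Z)"
      by (intro sparse_in_compact_finite sparse_in_subset[OF Zsp]) auto
    then show ?thesis unfolding pz by (rule finite_subset[rotated]) auto
  qed
  define g where "g = (\<lambda>x. deriv f x * 1 / f x)"
  have "contour_integral \<gamma> g = 2 * pi * \<i> * (\<Sum>p\<in>pz. winding_number \<gamma> p * 1 * zorder f p)"
    unfolding g_def pz_def
  proof (rule argument_principle)
    show "f holomorphic_on ball 0 R - poles" using holo by (rule holomorphic_on_subset) auto
    show "path_image \<gamma> \<subseteq> ball 0 R - {w \<in> ball 0 R. f w = 0 \<or> w \<in> poles}"
      using avoid img pim R pz unfolding pz_def by blast
    show "\<forall>z. z \<notin> ball 0 R \<longrightarrow> winding_number \<gamma> z = 0"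
      using winding_number_zero_outside[of \<gamma> "ball 0 R"] vp loop img pim R
      by (auto simp: valid_path_imp_path subset_iff)
    show "finite {w \<in> ball 0 R. f w = 0 \<or> w \<in> poles}" using fin unfolding pz_def .
    show "\<forall>p\<in>ball 0 R \<inter> poles. is_pole f p" by (auto simp: poles_def)
  qed (use vp loop in auto)
  moreover have "contour_integral \<gamma> g = 0"
  proof -
    have cont: "continuous_on (UNIV - Z) g"
    proof -
      have "f holomorphic_on UNIV - Z" using holo pZ by (auto intro: holomorphic_on_subset)
      moreover have "open (UNIV - Z)" using open_diff_sparse_pts[OF open_UNIV Zsp] .
      ultimately have "g holomorphic_on UNIV - Z"
        unfolding g_def by (intro holomorphic_intros) (auto simp: Z_def)
      then show ?thesis by (rule holomorphic_on_imp_continuous_on)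
    qed
    have ci: "g contour_integrable_on linepath b c"
      if "path_image (linepath b c) \<subseteq> path_image \<gamma>" for b c
      using that avoid cont
      by (intro contour_integrable_continuous_linepath continuous_on_subset[OF cont]) auto
    have per': "g (z + w) = g z" if "w \<in> L" for z w
      unfolding g_def using periodicD[OF per that] deriv_translate[of f w z] by simp
    have i: "g contour_integrable_on l1" "g contour_integrable_on l2"
            "g contour_integrable_on l3" "g contour_integrable_on l4"
      unfolding l1_def l2_def l3_def l4_def
      by (rule ci; unfold pim l1_def l2_def l3_def l4_def; blast)+
    have vl: "valid_path l1" "valid_path l2" "valid_path l3" "valid_path l4"
      and ends: "pathfinish l1 = pathstart l2" "pathfinish l2 = pathstart l3" "pathfinish l3 = pathstart l4"
      unfolding l1_def l2_def l3_def l4_def by simp_all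
    have i34: "g contour_integrable_on (l3 +++ l4)"
      using i vl by (intro contour_integrable_joinI)
    have i234: "g contour_integrable_on (l2 +++ l3 +++ l4)"
      using i i34 vl ends by (intro contour_integrable_joinI valid_path_join) auto
    have "contour_integral \<gamma> g = contour_integral l1 g + contour_integral (l2 +++ l3 +++ l4) g"
      unfolding \<gamma>_def using i i234 vl ends by (intro contour_integral_join valid_path_join) auto
    also have "contour_integral (l2 +++ l3 +++ l4) g = contour_integral l2 g + contour_integral (l3 +++ l4) g"
      using i i34 vl ends by (intro contour_integral_join valid_path_join) auto
    also have "contour_integral (l3 +++ l4) g = contour_integral l3 g + contour_integral l4 g"
      using i vl ends by (intro contour_integral_join) auto
    also have "contour_integral l3 g = - contour_integral l1 g"
    proof -
      have "continuous_on (closed_segment (a+1+\<tau>) (a+\<tau>)) g"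
        using avoid pim unfolding l3_def path_image_linepath by (intro continuous_on_subset[OF cont]) blast
      then have "contour_integral l3 g = - contour_integral (linepath (a + \<tau>) (a + 1 + \<tau>)) g"
        unfolding l3_def by (rule contour_integral_reverse_linepath)
      then show ?thesis
        unfolding l1_def using contour_integral_linepath_translate[of g \<tau> a "a + 1"] per' by simp
    qed
    also have "contour_integral l4 g = - contour_integral l2 g"
    proof -
      have "continuous_on (closed_segment (a+\<tau>) a) g"
        using avoid pim unfolding l4_def path_image_linepath by (intro continuous_on_subset[OF cont]) blast
      then have "contour_integral l4 g = - contour_integral (linepath a (a + \<tau>)) g"
        unfolding l4_def by (rule contour_integral_reverse_linepath)
      also have "contour_integral (linepath a (a + \<tau>)) g = contour_integral l2 g"
        unfolding l2_def using contour_integral_linepath_translate[of g 1 a "a + \<tau>"] per'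
        by (simp add: algebra_simps)
      finally show ?thesis .
    qed
    finally show ?thesis by simp
  qed
  ultimately have sum0: "(\<Sum>p\<in>pz. winding_number \<gamma> p * zorder f p) = 0" by simp
  have in_P0: "z \<in> P0 \<longleftrightarrow> z \<in> par s t" "z \<in> P0 \<longleftrightarrow> z \<in> P" if "z \<in> Z" for z
  proof -
    have "sc z \<noteq> s" "sc z \<noteq> s + 1" "tc z \<noteq> t" "tc z \<noteq> t + 1" using s[OF that] t[OF that] by auto
    then show "z \<in> P0 \<longleftrightarrow> z \<in> par s t" "z \<in> P0 \<longleftrightarrow> z \<in> P" by (auto simp: P0_def P_def par_def)
  qed
  have w0: "winding_number \<gamma> z = 0" if "z \<notin> P" for z
    using winding_number_zero_outside[of \<gamma> P z] vp loop img pim conv that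
    by (auto simp: valid_path_imp_path subset_iff)
  \<comment> \<open>An interior point lies strictly to the left of each side, so every side
    contributes a positive real part. This allows the common winding number to be cancelled at the
    end.\<close>
  have wpos: "Re (winding_number \<gamma> z) > 0" if "z \<in> P0" for z
  proof -
    define x where "x = sc z - s"
    define y where "y = tc z - t"
    have xy: "0 < x" "x < 1" "0 < y" "y < 1" using that by (auto simp: P0_def x_def y_def)
    have z: "z = a + of_real x + of_real y * \<tau>" by (intro coords_eqI) (simp_all add: x_def y_def del: of_real_diff)
    have im: "Im \<tau> * y > 0" "Im \<tau> * (1 - x) > 0" "Im \<tau> * (1 - y) > 0" "Im \<tau> * x > 0"
      using xy Im_pos by auto
    have "0 < Re (winding_number l1 z)" "0 < Re (winding_number l2 z)"
         "0 < Re (winding_number l3 z)" "0 < Re (winding_number l4 z)"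
      unfolding l1_def l2_def l3_def l4_def
      by (rule winding_number_linepath_pos_lt; use im in \<open>simp add: z algebra_simps\<close>)+
    moreover have "z \<notin> path_image \<gamma>"
    proof
      assume "z \<in> path_image \<gamma>"
      then have "sc z - s \<in> \<int> \<or> tc z - t \<in> \<int>" using img pim by blast
      then show False using xy unfolding x_def[symmetric] y_def[symmetric] by (auto elim!: Ints_cases)
    qed
    ultimately show ?thesis
      unfolding pim unfolding \<gamma>_def l1_def l2_def l3_def l4_def
      by (simp add: winding_number_join path_image_join)
  qed
  have "P0 \<inter> path_image \<gamma> = {}"
  proof -
    have False if "z \<in> P0" "z \<in> path_image \<gamma>" for z
    proof -
      have "sc z - s \<in> \<int> \<or> tc z - t \<in> \<int>" using that img pim by blast
      moreover have "0 < sc z - s" "sc z - s < 1" "0 < tc z - t" "tc z - t < 1"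
        using that by (auto simp: P0_def)
      ultimately show False by (auto elim!: Ints_cases)
    qed
    then show ?thesis by blast
  qed
  then have "winding_number \<gamma> constant_on P0"
    using vp loop conv0 by (intro winding_number_constant) (auto simp: valid_path_imp_path convex_connected)
  then obtain n where n: "\<And>z. z \<in> P0 \<Longrightarrow> winding_number \<gamma> z = n" by (auto simp: constant_on_def)
  have "(\<Sum>p\<in>pz. winding_number \<gamma> p * zorder f p) = (\<Sum>p\<in>{z\<in>par s t. f z = 0}. winding_number \<gamma> p * zorder f p)"
  proof (rule sum.mono_neutral_right[OF fin])
    show "{z \<in> par s t. f z = 0} \<subseteq> pz"
      using in_P0 R unfolding pz by (auto simp: Z_def)
    show "\<forall>i\<in>pz - {z \<in> par s t. f z = 0}. winding_number \<gamma> i * zorder f i = 0"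
      using in_P0 w0 unfolding pz by (auto simp: Z_def)
  qed
  also have "\<dots> = (\<Sum>p\<in>{z\<in>par s t. f z = 0}. n * zorder f p)"
    using n in_P0 by (intro sum.cong) (auto simp: Z_def)
  finally have "n * of_int (\<Sum>p\<in>{z\<in>par s t. f z = 0}. zorder f p) = 0"
    using sum0 by (simp add: sum_distrib_left)
  moreover have "n \<noteq> 0 \<or> {z\<in>par s t. f z = 0} = {}"
    using wpos n in_P0 by (force simp: Z_def)
  ultimately have "(\<Sum>p\<in>{z\<in>par s t. f z = 0}. zorder f p) = 0"
  proof (elim disjE)
    assume "{z\<in>par s t. f z = 0} = {}"
    then show ?thesis by (simp only: sum.empty)
  qed (simp del: of_int_sum)
  also have "(\<Sum>p\<in>{z\<in>par s t. f z = 0}. zorder f p) = (\<Sum>p\<in>{z\<in>par s0 t0. f z = 0}. zorder f p)"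
    using periodicD[OF per] zorder_translate[of f] by (intro sum_par_eq) auto
  finally show ?thesis .
qed

lemma elliptic_eventually_nonzero:
  assumes f: "f nicely_meromorphic_on UNIV" and nz: "f z0 \<noteq> 0"
  shows "eventually (\<lambda>w. f w \<noteq> 0) (at z)"
proof -
  have "eventually (\<lambda>w. f w \<noteq> 0) (cosparse UNIV)"
    using zeros_sparse[OF f nz] by (simp add: eventually_cosparse)
  then show ?thesis by (simp add: eventually_cosparse_open_eq)
qed

lemma zero_zorder_pos:
  assumes f: "f nicely_meromorphic_on UNIV" and nz: "f z0 \<noteq> 0" and z: "f z = 0" "\<not> is_pole f z"
  shows "zorder f z > 0"
proof -
  have "f analytic_on {z}" using nicely_meromorphic_on_imp_analytic_at[OF f _ z(2)] by simp
  moreover have "frequently (\<lambda>w. f w \<noteq> 0) (at z)"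
    by (intro eventually_frequently elliptic_eventually_nonzero[OF f nz]) simp
  ultimately show ?thesis using z(1) by (simp add: zorder_pos_iff')
qed

lemma is_pole_translate:
  fixes f :: "complex \<Rightarrow> complex"
  assumes "\<And>z. f (z + w) = f z" shows "is_pole f (z + w) \<longleftrightarrow> is_pole f z"
proof -
  have "is_pole f (z + w) \<longleftrightarrow> is_pole (\<lambda>u. f (z + w + u)) 0"
    unfolding is_pole_def filterlim_def by (subst at_to_0) (simp add: filtermap_filtermap add_ac)
  also have "(\<lambda>u. f (z + w + u)) = (\<lambda>u. f (z + u))" using assms by (metis add.assoc add.commute)
  also have "is_pole \<dots> 0 \<longleftrightarrow> is_pole f z"
    unfolding is_pole_def filterlim_def by (subst (2) at_to_0) (simp add: filtermap_filtermap add_ac)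
  finally show ?thesis .
qed

text \<open>The set where \<open>f\<close> takes the value 0 splits into poles and genuine zeros;
  that the orders over it sum to 0 says that both parts have the same weight.\<close>

lemma zero_count:
  assumes f: "f nicely_meromorphic_on UNIV" and per: "periodic f" and nz: "f z0 \<noteq> 0"
  shows "ell_degree \<tau> f = (\<Sum>z\<in>{z\<in>fund_par \<tau>. f z = 0 \<and> \<not> is_pole f z}. nat (zorder f z))"
proof -
  let ?Z = "{z\<in>fund_par \<tau>. f z = 0}"
  let ?P = "{z\<in>fund_par \<tau>. is_pole f z}" and ?N = "{z\<in>fund_par \<tau>. f z = 0 \<and> \<not> is_pole f z}"
  have Z: "?Z = ?P \<union> ?N" "?P \<inter> ?N = {}" using is_pole_zero_at_nicely_mero[OF f] by auto
  have fin: "finite ?Z"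
    using finite_par_Int_sparse[OF zeros_sparse[OF f nz], of 0 0] by (simp add: fund_par_eq_par)
  have neg: "zorder f z < 0" if "is_pole f z" for z
    using f that isolated_pole_imp_neg_zorder[of f z] meromorphic_on_isolated_singularity[of f z]
      meromorphic_on_subset[of f UNIV "{z}"]
    by (auto simp: nicely_meromorphic_on_def)
  have "0 = (\<Sum>z\<in>?Z. zorder f z)" using sum_zorder_par[OF f per nz, of 0 0] by (simp add: fund_par_eq_par)
  also have "\<dots> = (\<Sum>z\<in>?P. zorder f z) + (\<Sum>z\<in>?N. zorder f z)"
    using fin unfolding Z(1) by (intro sum.union_disjoint Z(2)) auto
  also have "(\<Sum>z\<in>?P. zorder f z) = - int (ell_degree \<tau> f)"
    unfolding ell_degree_def of_nat_sum sum_negf[symmetric]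
    by (intro sum.cong refl) (use neg in force)
  also have "(\<Sum>z\<in>?N. zorder f z) = int (\<Sum>z\<in>?N. nat (zorder f z))"
    unfolding of_nat_sum using zero_zorder_pos[OF f nz] by (intro sum.cong refl) force
  finally show ?thesis by linarith
qed

text \<open>The upper bound behind all later counting: inequivalent zeros stay distinct when moved
  into the fundamental parallelogram, and the zeros left out have nonnegative weight.\<close>

lemma zero_count_le:
  assumes f: "f nicely_meromorphic_on UNIV" and per: "periodic f" and nz: "f z0 \<noteq> 0"
    and A: "finite A" "\<And>p. p \<in> A \<Longrightarrow> f p = 0 \<and> \<not> is_pole f p"
      "\<And>p q. p \<in> A \<Longrightarrow> q \<in> A \<Longrightarrow> p - q \<in> L \<Longrightarrow> p = q"
  shows "(\<Sum>p\<in>A. nat (zorder f p)) \<le> ell_degree \<tau> f"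
proof -
  let ?r = "red 0 0"
  have inv: "f (?r z) = f z" "is_pole f (?r z) \<longleftrightarrow> is_pole f z" "zorder f (?r z) = zorder f z" for z
    using periodicD[OF per, of "z - ?r z"] red_equiv[of z 0 0] is_pole_translate[of f "z - ?r z" "?r z"]
      zorder_translate[of f "z - ?r z" "?r z"]
    by (metis diff_add_cancel add.commute)+
  have "(\<Sum>p\<in>A. nat (zorder f p)) = (\<Sum>p\<in>A. nat (zorder f (?r p)))" by (simp add: inv)
  also have "\<dots> = (\<Sum>p\<in>?r ` A. nat (zorder f p))"
    using A(3) red_eq_iff by (subst sum.reindex) (auto simp: inj_on_def)
  also have "\<dots> \<le> (\<Sum>z\<in>{z\<in>fund_par \<tau>. f z = 0 \<and> \<not> is_pole f z}. nat (zorder f z))"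
  proof (rule sum_mono2)
    have "finite {z\<in>fund_par \<tau>. f z = 0}"
      using finite_par_Int_sparse[OF zeros_sparse[OF f nz], of 0 0] by (simp add: fund_par_eq_par)
    then show "finite {z\<in>fund_par \<tau>. f z = 0 \<and> \<not> is_pole f z}" by (rule finite_subset[rotated]) auto
    show "?r ` A \<subseteq> {z\<in>fund_par \<tau>. f z = 0 \<and> \<not> is_pole f z}"
      using A(2) red_in_par by (auto simp: inv fund_par_eq_par)
  qed auto
  also have "\<dots> = ell_degree \<tau> f" by (rule zero_count[OF f per nz, symmetric])
  finally show ?thesis .
qed

section \<open>Functions with poles at lattice points only, graded by pole order\<close>

text \<open>The values on the lattice itself are junk.\<close>
definition LL :: "nat \<Rightarrow> (complex \<Rightarrow> complex) \<Rightarrow> complex \<Rightarrow> bool" where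
  "LL n f l \<longleftrightarrow> periodic f \<and> f holomorphic_on - L \<and> ((\<lambda>z. z ^ n * f z) \<longlongrightarrow> l) (at 0)"

lemma at_L_eq: "w \<in> L \<Longrightarrow> periodic f \<Longrightarrow> (f \<longlongrightarrow> l) (at w) \<longleftrightarrow> (f \<longlongrightarrow> l) (at 0)"
  using periodicD[of f w] by (subst at_to_0[of w]) (simp add: filterlim_filtermap)

lemma isolated_singularity_L:
  assumes "f holomorphic_on - L" shows "isolated_singularity_at f z"
proof -
  obtain d where d: "d > 0" "\<And>w. w \<in> L \<Longrightarrow> w \<noteq> z \<Longrightarrow> dist w z \<ge> d" using L_isolated by blast
  have "f holomorphic_on ball z d - {z}"
    by (rule holomorphic_on_subset[OF assms]) (use d in \<open>force simp: dist_commute\<close>)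
  then show ?thesis using d(1)
    unfolding isolated_singularity_at_def by (subst analytic_on_open) auto
qed

text \<open>Periodicity carries the finite limit from 0 to every lattice point, so all singularities
  are removable and the extension is entire and doubly periodic.\<close>

lemma LL_0_const:
  assumes "LL 0 f l" "z \<notin> L" shows "f z = l"
proof -
  have per: "periodic f" and hol: "f holomorphic_on - L" and lim: "(f \<longlongrightarrow> l) (at 0)"
    using assms by (auto simp: LL_def)
  have an: "f analytic_on {w}" if "w \<notin> L" for w using hol that analytic_at[of f w] open_compl_L by blast
  let ?g = "remove_sings f"
  have lim': "(f \<longlongrightarrow> l) (at w)" if "w \<in> L" for w using at_L_eq[OF that per] lim by simp
  have an': "?g analytic_on {w}" for w
  proof (cases "w \<in> L")
    case True then show ?thesis using lim' remove_sings_analytic_at isolated_singularity_L[OF hol] by blast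
  next
    case False then show ?thesis using an remove_sings_analytic_on by blast
  qed
  then have "?g holomorphic_on UNIV"
    by (meson analytic_on_analytic_at analytic_imp_holomorphic)
  moreover have g: "?g w = (if w \<in> L then l else f w)" for w using lim' an by auto
  have "periodic ?g" using per unfolding g[abs_def] periodic_def by simp
  ultimately obtain c where "\<And>z. ?g z = c" using periodic_entire_const by blast
  then show ?thesis using g[of 0] g[of z] assms(2) by auto
qed

text \<open>The extension of \<open>z ^ Suc n * f z\<close> is analytic with a zero at 0, and its
  difference quotient there is \<open>z ^ n * f z\<close>. So a vanishing leading coefficient lowers
  the pole order by one.\<close>

lemma tendsto_pole_lower:
  assumes sing: "isolated_singularity_at f 0" and lim: "((\<lambda>z. z ^ Suc n * f z) \<longlongrightarrow> 0) (at 0)"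
  obtains l where "((\<lambda>z. z ^ n * f z) \<longlongrightarrow> l) (at 0)"
proof -
  define h where "h = (\<lambda>z. z ^ Suc n * f z)"
  define g where "g = remove_sings h"
  have sing': "isolated_singularity_at h 0"
    unfolding h_def by (intro isolated_singularity_at_times sing isolated_singularity_at_analytic analytic_intros)
  have "g analytic_on {0}"
    unfolding g_def using remove_sings_analytic_at[OF sing'] lim h_def by blast
  moreover have g0: "g 0 = 0" unfolding g_def h_def using lim by (rule remove_sings_eqI)
  ultimately have "(g has_field_derivative deriv g 0) (at 0)"
    using analytic_on_imp_differentiable_at DERIV_deriv_iff_field_differentiable by blast
  then have "((\<lambda>z. g z / z) \<longlongrightarrow> deriv g 0) (at 0)"
    unfolding has_field_derivative_iff by (simp add: g0)
  moreover have "eventually (\<lambda>z. g z / z = z ^ n * f z) (at 0)"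
    using eventually_remove_sings_eq_at[OF sing'] eventually_neq_at_within[of 0]
    by eventually_elim (simp add: g_def h_def)
  ultimately have "((\<lambda>z. z ^ n * f z) \<longlongrightarrow> deriv g 0) (at 0)" using tendsto_cong by fast
  then show ?thesis using that by blast
qed

lemma LL_lower:
  assumes "LL (Suc n) f 0" obtains l where "LL n f l"
  using tendsto_pole_lower[OF isolated_singularity_L, of f n] assms that by (auto simp: LL_def)

text \<open>Adjusts the values on the lattice to the convention of nicely meromorphic functions,
  which are 0 at poles; elliptic functions are defined with that convention.\<close>

definition nice :: "(complex \<Rightarrow> complex) \<Rightarrow> complex \<Rightarrow> complex" where
  "nice f z = (if z \<in> L then 0 else f z)"

lemma nice_notin [simp]: "z \<notin> L \<Longrightarrow> nice f z = f z" by (simp add: nice_def)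

lemma eventually_nice_eq: "eventually (\<lambda>w. nice f w = f w) (at z)"
  using eventually_notin_L[of z] by eventually_elim simp

lemma LL_zorder:
  assumes "LL n f l" "l \<noteq> 0" "w \<in> L" shows "zorder f w = - int n"
proof -
  have per: "periodic f" and hol: "f holomorphic_on - L"
    and lim: "((\<lambda>z. z ^ n * f z) \<longlongrightarrow> l) (at 0)"
    using assms by (auto simp: LL_def)
  define h where "h = (\<lambda>z. z ^ n * f z)"
  define g where "g = remove_sings h"
  have hol': "h holomorphic_on - L" unfolding h_def using hol by (intro holomorphic_intros)
  have "g analytic_on {0}"
    unfolding g_def using remove_sings_analytic_at[OF isolated_singularity_L[OF hol']] lim h_def by blast
  then obtain A where A: "open A" "0 \<in> A" "g holomorphic_on A" using analytic_at by blast
  have g0: "g 0 = l" unfolding g_def h_def using lim by (rule remove_sings_eqI)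
  obtain B where B: "open B" "0 \<in> B" "\<And>w. w \<in> B \<Longrightarrow> w \<noteq> 0 \<Longrightarrow> g w = h w"
    using eventually_remove_sings_eq_at[OF isolated_singularity_L[OF hol', of 0]]
    by (auto simp: eventually_at_topological g_def)
  have "zorder f 0 = - int n"
  proof (rule zorder_eqI[of "A \<inter> B" 0 g])
    fix w assume w: "w \<in> A \<inter> B" "w \<noteq> 0"
    then show "f w = g w * (w - 0) powi - int n"
      using B(3)[of w] by (simp add: h_def power_int_minus field_simps)
  qed (use A B g0 assms in \<open>auto intro: holomorphic_on_subset\<close>)
  then show ?thesis using zorder_translate[of f w 0] periodicD[OF per assms(3)] by simp
qed

lemma LL_is_pole:
  assumes "LL n f l" "l \<noteq> 0" "n > 0" "w \<in> L" shows "is_pole f w"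
proof -
  have per: "periodic f" and lim: "((\<lambda>z. z ^ n * f z) \<longlongrightarrow> l) (at 0)"
    using assms by (auto simp: LL_def)
  have "filterlim (\<lambda>z. z ^ n * f z / z ^ n) at_infinity (at 0)"
    using assms by (intro filterlim_divide_at_infinity[OF lim] filterlim_atI tendsto_eq_intros)
      (auto simp: eventually_at intro!: exI[of _ 1] tendsto_eq_intros)
  moreover have "eventually (\<lambda>z. z ^ n * f z / z ^ n = f z) (at 0)"
    using eventually_neq_at_within[of 0] by eventually_elim auto
  ultimately have "is_pole f 0" unfolding is_pole_def using filterlim_cong by fast
  then show ?thesis using is_pole_translate[of f w 0] periodicD[OF per assms(4)] by simp
qed

text \<open>Within the fundamental parallelogram 0 is the only lattice point, so the pole order at 0
  is the whole degree.\<close>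

lemma LL_nice_elliptic:
  assumes "LL n f l" "l \<noteq> 0" "n > 0"
  shows "nice f nicely_meromorphic_on UNIV" "periodic (nice f)" "w \<in> L \<Longrightarrow> is_pole (nice f) w"
    "z \<notin> L \<Longrightarrow> \<not> is_pole (nice f) z" "w \<in> L \<Longrightarrow> zorder (nice f) w = - int n"
    "z \<notin> L \<Longrightarrow> zorder (nice f) z = zorder f z" "ell_degree \<tau> (nice f) = n"
    "\<exists>z0. nice f z0 \<noteq> 0"
proof -
  have per: "periodic f" and hol: "f holomorphic_on - L"
    and lim: "((\<lambda>z. z ^ n * f z) \<longlongrightarrow> l) (at 0)"
    using assms by (auto simp: LL_def)
  show per': "periodic (nice f)" using per by (auto simp: periodic_def nice_def)
  have hol': "nice f holomorphic_on - L" using hol by (rule holomorphic_transform) auto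
  then have an: "nice f analytic_on - L" by (simp add: analytic_on_open)
  show pole: "is_pole (nice f) w" if "w \<in> L" for w
    using LL_is_pole[OF assms that] is_pole_cong[OF eventually_nice_eq[of f w] refl] by simp
  show np: "\<not> is_pole (nice f) z" if "z \<notin> L" for z
    using an that analytic_on_subset[OF an, of "{z}"] analytic_at_imp_no_pole by blast
  show zo: "zorder (nice f) w = - int n" if "w \<in> L" for w
    using LL_zorder[OF assms(1,2) that] zorder_cong[OF eventually_nice_eq[of f w] refl] by simp
  show "zorder (nice f) z = zorder f z" if "z \<notin> L" for z
    using zorder_cong[OF eventually_nice_eq[of f z] refl] by simp
  show "nice f nicely_meromorphic_on UNIV"
    by (rule nicely_meromorphic_onI_open[of UNIV _ L])
      (use an pole isolated_singularity_L[OF hol'] in \<open>auto simp: Compl_eq_Diff_UNIV nice_def\<close>)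
  have "{z \<in> fund_par \<tau>. is_pole (nice f) z} = {0}"
  proof -
    have "z = 0" if "z \<in> fund_par \<tau>" "z \<in> L" for z
      using that par_equiv_eq[of z 0 0 0] by (simp add: fund_par_eq_par) (simp add: par_def)
    then show ?thesis using pole np by (auto simp: fund_par_iff)
  qed
  then show "ell_degree \<tau> (nice f) = n" using zo[of 0] by (simp add: ell_degree_def)
  show "\<exists>z0. nice f z0 \<noteq> 0"
  proof (rule ccontr)
    assume "\<not> ?thesis"
    then have "nice f = (\<lambda>_. 0)" by auto
    then show False using pole[of 0] by simp
  qed
qed

lemma LL_zero_count_le:
  assumes "LL n f l" "l \<noteq> 0" "n > 0"
    and A: "finite A" "\<And>p. p \<in> A \<Longrightarrow> p \<notin> L \<and> f p = 0"
      "\<And>p q. p \<in> A \<Longrightarrow> q \<in> A \<Longrightarrow> p - q \<in> L \<Longrightarrow> p = q"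
  shows "(\<Sum>p\<in>A. nat (zorder f p)) \<le> n"
proof -
  note N = LL_nice_elliptic[OF assms(1-3)]
  obtain z0 where z0: "nice f z0 \<noteq> 0" using N(8) by blast
  have "(\<Sum>p\<in>A. nat (zorder f p)) = (\<Sum>p\<in>A. nat (zorder (nice f) p))"
    using A(2) N(6) by (intro sum.cong) auto
  also have "\<dots> \<le> ell_degree \<tau> (nice f)"
    by (rule zero_count_le[OF N(1,2) z0]) (use A N(4) in auto)
  finally show ?thesis using N(7) by simp
qed

lemma LL_zorder_pos:
  assumes "LL n f l" "l \<noteq> 0" "n > 0" "p \<notin> L" "f p = 0"
  shows "zorder f p > 0"
proof -
  note N = LL_nice_elliptic[OF assms(1-3)]
  obtain z0 where z0: "nice f z0 \<noteq> 0" using N(8) by blast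
  show ?thesis using zero_zorder_pos[OF N(1) z0, of p] N(4,6)[of p] assms by auto
qed

lemma half_periods: "1/2 \<notin> L" "\<tau>/2 \<notin> L" "(1 + \<tau>)/2 \<notin> L" "\<tau>/2 - 1/2 \<notin> L" "1/2 - \<tau>/2 \<notin> L"
proof -
  have h: "(1/2::real) \<notin> \<int>" "(-1/2::real) \<notin> \<int>" by (auto elim!: Ints_cases)
  have c: "sc (z/2) = sc z / 2" "tc (z/2) = tc z / 2" for z by (auto simp: sc_def tc_def field_simps)
  show "1/2 \<notin> L" "\<tau>/2 \<notin> L" "(1 + \<tau>)/2 \<notin> L" "\<tau>/2 - 1/2 \<notin> L" "1/2 - \<tau>/2 \<notin> L"
    using h by (auto simp: L_iff c)
qed

text \<open>Otherwise the function would be odd up to a constant, hence vanish at two half periods.\<close>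
lemma LL_1_zero:
  assumes "LL 1 f l" shows "l = 0"
proof (rule ccontr)
  assume l: "l \<noteq> 0"
  have per: "periodic f" and hol: "f holomorphic_on - L"
    and lim: "((\<lambda>z. z * f z) \<longlongrightarrow> l) (at 0)"
    using assms by (auto simp: LL_def)
  define g where "g = (\<lambda>z. f z + f (- z))"
  have hol2: "(\<lambda>z. f (- z)) holomorphic_on - L"
    by (rule holomorphic_on_compose_gen[OF _ hol, of uminus, unfolded o_def]) (auto intro!: holomorphic_intros)
  have lim2: "((\<lambda>z. z * f (- z)) \<longlongrightarrow> - l) (at 0)"
  proof -
    have "((\<lambda>z. - z * f (- z)) \<longlongrightarrow> l) (at 0)"
      by (rule filterlim_compose[OF lim, of "uminus"])
        (auto intro!: filterlim_atI tendsto_eq_intros simp: eventually_at_filter)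
    from tendsto_minus[OF this] show ?thesis by simp
  qed
  have per2: "periodic (\<lambda>z. f (- z))" using per unfolding periodic_def
    by (metis (no_types, lifting) L_uminus minus_add_distrib)
  have "LL 1 g 0"
    unfolding LL_def g_def
    using per per2 hol hol2 tendsto_add[OF lim lim2]
    by (auto simp: periodic_def algebra_simps intro!: holomorphic_intros)
  then obtain k where "LL 0 g k" using LL_lower[of 0 g] by auto
  then have k: "f z + f (- z) = k" if "z \<notin> L" for z using LL_0_const[of g k z] that by (simp add: g_def)
  define h where "h = (\<lambda>z. f z - k / 2)"
  have "((\<lambda>z. z * f z - z * (k / 2)) \<longlongrightarrow> l - 0 * (k/2)) (at 0)"
    by (intro tendsto_intros lim)
  then have "LL 1 h l" using per hol
    by (auto simp: LL_def h_def periodic_def algebra_simps intro!: holomorphic_intros)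
  \<comment> \<open>A half period is equivalent to its negative, so \<open>f z + f (- z) = k\<close>
    determines the value there as \<open>k / 2\<close>.\<close>
  have z: "h (1/2) = 0" "h (\<tau>/2) = 0"
    using k[OF half_periods(1)] k[OF half_periods(2)] periodicD[OF per, of 1 "-(1/2)"]
      periodicD[OF per, of \<tau> "-(\<tau>/2)"] by (auto simp: h_def)
  define p1 p2 where "p1 = (1/2 :: complex)" and "p2 = \<tau>/2"
  have p: "p1 \<notin> L" "p2 \<notin> L" "p2 - p1 \<notin> L" "p1 - p2 \<notin> L" "h p1 = 0" "h p2 = 0"
    using half_periods z by (simp_all add: p1_def p2_def)
  have "(\<Sum>p\<in>{p1, p2}. nat (zorder h p)) \<le> 1"
    by (rule LL_zero_count_le[OF \<open>LL 1 h l\<close> l]) (use p in auto)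
  moreover have "zorder h p1 > 0" "zorder h p2 > 0"
    by (intro LL_zorder_pos[OF \<open>LL 1 h l\<close> l] p; simp)+
  moreover have "p1 \<noteq> p2" using p(3) by auto
  ultimately show False by simp
qed

lemma LL_1_const: assumes "LL 1 f l" obtains c where "\<And>z. z \<notin> L \<Longrightarrow> f z = c"
  using assms LL_1_zero[OF assms] LL_lower[of 0 f] LL_0_const by (metis One_nat_def)

end

section \<open>The Weierstrass function\<close>

lemma summable_on_geometric_int:
  fixes q :: real assumes "0 \<le> q" "q < 1"
  shows "(\<lambda>n::int. q ^ nat \<bar>n\<bar>) summable_on UNIV"
proof -
  have s: "(\<lambda>n::nat. q ^ n) summable_on UNIV"
    using assms by (subst summable_on_UNIV_nonneg_real_iff) (auto intro: summable_geometric)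
  have "(\<lambda>n::int. q ^ nat \<bar>n\<bar>) summable_on range int"
    by (subst summable_on_reindex) (use s in \<open>auto simp: o_def\<close>)
  moreover have "(\<lambda>n::int. q ^ nat \<bar>n\<bar>) summable_on range (\<lambda>n. - int n)"
    by (subst summable_on_reindex) (use s in \<open>auto simp: o_def inj_on_def\<close>)
  ultimately have "(\<lambda>n::int. q ^ nat \<bar>n\<bar>) summable_on (range int \<union> range (\<lambda>n. - int n))"
    by (rule summable_on_union)
  moreover have "range int \<union> range (\<lambda>n. - int n) = UNIV"
    by (auto intro: int_cases2)
  ultimately show ?thesis by simp
qed

text \<open>Up to a constant factor this is \<open>1 / sin^2 (pi w)\<close>. Summing it over the rows \<open>n * \<tau>\<close> of the lattice
  gives the Weierstrass function up to an affine map, by a series that converges geometrically.\<close>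
definition cosec2 :: "complex \<Rightarrow> complex" where
  "cosec2 w = exp (2 * of_real pi * \<i> * w) / (1 - exp (2 * of_real pi * \<i> * w))\<^sup>2"

lemma exp_2pii_eq_1_iff: "exp (2 * of_real pi * \<i> * w) = 1 \<longleftrightarrow> w \<in> \<int>"
proof -
  have "exp (2 * of_real pi * \<i> * w) = 1 \<longleftrightarrow> Im w = 0 \<and> (\<exists>n::int. Re w = of_int n)"
    by (simp add: exp_eq_1)
  also have "\<dots> \<longleftrightarrow> w \<in> \<int>" by (auto simp: Ints_def complex_eq_iff)
  finally show ?thesis .
qed

lemma cosec2_minus: "cosec2 (- w) = cosec2 w"
proof -
  let ?e = "exp (2 * of_real pi * \<i> * w)"
  have "cosec2 (- w) = inverse ?e / (1 - inverse ?e)\<^sup>2" by (simp add: cosec2_def exp_minus)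
  also have "\<dots> = cosec2 w" unfolding cosec2_def
    by (cases "?e = 1") (auto simp: divide_simps power2_eq_square exp_minus algebra_simps)
  finally show ?thesis .
qed

lemma cosec2_plus1: "cosec2 (w + 1) = cosec2 w"
  by (simp add: cosec2_def distrib_left exp_add)

lemma holomorphic_cosec2: "g holomorphic_on A \<Longrightarrow> (\<And>z. z \<in> A \<Longrightarrow> g z \<notin> \<int>) \<Longrightarrow> (\<lambda>z. cosec2 (g z)) holomorphic_on A"
  unfolding cosec2_def by (intro holomorphic_intros) (auto simp: exp_2pii_eq_1_iff)

lemma norm_cosec2_le:
  assumes "norm (exp (2 * of_real pi * \<i> * w)) \<le> 1/2"
  shows "norm (cosec2 w) \<le> 4 * norm (exp (2 * of_real pi * \<i> * w))"
proof -
  let ?e = "exp (2 * of_real pi * \<i> * w)"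
  have "1/2 \<le> norm (1 - ?e)" using norm_triangle_ineq2[of 1 ?e] assms by simp
  then have pos: "0 < norm (1 - ?e)" by linarith
  have "(1/2)^2 \<le> norm (1 - ?e) ^ 2" using \<open>1/2 \<le> norm (1 - ?e)\<close> by (intro power_mono) auto
  then have "norm ?e / norm (1 - ?e) ^ 2 \<le> norm ?e / (1/2)^2"
    using pos by (intro divide_left_mono mult_pos_pos zero_less_power) auto
  moreover have "norm (cosec2 w) = norm ?e / norm (1 - ?e) ^ 2"
    by (simp only: cosec2_def norm_divide norm_power)
  moreover have "norm ?e / (1/2)^2 = 4 * norm ?e" by (simp add: power2_eq_square)
  ultimately show ?thesis by simp
qed

lemma tendsto_cosec2: "((\<lambda>z. z\<^sup>2 * cosec2 z) \<longlongrightarrow> 1 / (2 * of_real pi * \<i>)\<^sup>2) (at 0)"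
proof -
  let ?c = "2 * of_real pi * \<i>"
  have "((\<lambda>z. exp (?c * z)) has_field_derivative ?c) (at 0)"
    by (auto intro!: derivative_eq_intros)
  then have 1: "((\<lambda>z. (exp (?c * z) - 1) / z) \<longlongrightarrow> ?c) (at 0)"
    by (simp add: has_field_derivative_iff)
  have 2: "((\<lambda>z. exp (?c * z)) \<longlongrightarrow> exp (?c * 0)) (at 0)" by (intro tendsto_intros)
  have "((\<lambda>z. exp (?c * z) / ((exp (?c * z) - 1) / z)\<^sup>2) \<longlongrightarrow> exp (?c * 0) / ?c\<^sup>2) (at 0)"
    by (intro tendsto_intros 1 2) auto
  moreover have "exp (?c * z) / ((exp (?c * z) - 1) / z)\<^sup>2 = z\<^sup>2 * cosec2 z" for z
    by (simp add: cosec2_def power_divide power2_commute)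
  ultimately show ?thesis by simp
qed

context period_lattice
begin

definition wsum :: "complex \<Rightarrow> complex" where
  "wsum z = (\<Sum>\<^sub>\<infinity>n::int. cosec2 (z + of_int n * \<tau>))"

text \<open>The absolute value of \<open>exp (2 * pi * \<i> * \<tau>)\<close>, in size the square of
  the classical nome; it is the ratio of the geometric majorant.\<close>

definition nome :: real where "nome = exp (- (2 * pi * Im \<tau>))"

lemma nome: "0 < nome" "nome < 1" using Im_pos by (auto simp: nome_def)

lemma norm_cosec2_shift:
  assumes "norm z \<le> R" "exp (2 * pi * R) * nome ^ nat \<bar>n\<bar> \<le> 1/2"
  shows "norm (cosec2 (z + of_int n * \<tau>)) \<le> 4 * (exp (2 * pi * R) * nome ^ nat \<bar>n\<bar>)"
proof -
  have *: "norm (cosec2 (u + of_nat m * \<tau>)) \<le> 4 * (exp (2 * pi * R) * nome ^ m)"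
    if "norm u \<le> R" "exp (2 * pi * R) * nome ^ m \<le> 1/2" for u and m :: nat
  proof -
    have "\<bar>Im u\<bar> \<le> R" using that abs_Im_le_cmod[of u] by linarith
    have "norm (exp (2 * of_real pi * \<i> * (u + of_nat m * \<tau>))) = exp (2 * pi * (- Im u)) * nome ^ m"
      by (simp add: nome_def algebra_simps flip: exp_of_nat_mult exp_add)
    also have "\<dots> \<le> exp (2 * pi * R) * nome ^ m"
    proof (intro mult_right_mono)
      have "- Im u \<le> R" using \<open>\<bar>Im u\<bar> \<le> R\<close> by linarith
      then have "2 * pi * (- Im u) \<le> 2 * pi * R" by (intro mult_left_mono) auto
      then show "exp (2 * pi * (- Im u)) \<le> exp (2 * pi * R)" by (rule iffD2[OF exp_le_cancel_iff])
    qed (use nome in auto)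
    finally have le: "norm (exp (2 * of_real pi * \<i> * (u + of_nat m * \<tau>))) \<le> exp (2 * pi * R) * nome ^ m" .
    show ?thesis using norm_cosec2_le[of "u + of_nat m * \<tau>"] le that(2) by linarith
  qed
  show ?thesis
  proof (cases "n \<ge> 0")
    case True then show ?thesis using *[of z "nat n"] assms by simp
  next
    case False
    have "cosec2 (z + of_int n * \<tau>) = cosec2 (- z + of_nat (nat (- n)) * \<tau>)"
      using cosec2_minus[of "z + of_int n * \<tau>"] False by (simp add: algebra_simps)
    then show ?thesis using *[of "-z" "nat (-n)"] assms False by simp
  qed
qed

text \<open>For large \<open>\<bar>n\<bar>\<close> a row has no pole in the disc and is dominated by
  a geometric series, so the tail is holomorphic by the Weierstrass test; \<open>K\<close> collects
  the remaining rows.\<close>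

lemma wsum_split:
  obtains K :: "int set" and H where "finite K" "0 \<in> K" "H holomorphic_on ball 0 R"
    "\<And>z. z \<in> ball 0 R \<Longrightarrow> wsum z = (\<Sum>n\<in>K. cosec2 (z + of_int n * \<tau>)) + H z"
    "\<And>z. z \<in> ball 0 R \<Longrightarrow> (\<lambda>n. cosec2 (z + of_int n * \<tau>)) summable_on UNIV"
proof -
  define M where "M = exp (2 * pi * R)"
  have "(\<lambda>n. M * nome ^ n) \<longlonglongrightarrow> M * 0" using nome by (intro tendsto_intros LIMSEQ_power_zero) auto
  then have "eventually (\<lambda>n. M * nome ^ n < 1/2) sequentially" by (intro order_tendstoD) auto
  then obtain N where N: "\<And>n. n \<ge> N \<Longrightarrow> M * nome ^ n < 1/2" by (auto simp: eventually_sequentially)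
  define K where "K = {n::int. \<bar>n\<bar> \<le> int N}"
  have K: "finite K" "0 \<in> K"
  proof -
    have "K = {- int N..int N}" by (auto simp: K_def)
    then show "finite K" "0 \<in> K" by auto
  qed
  let ?f = "\<lambda>n z. cosec2 (z + of_int n * \<tau>)"
  define H where "H = (\<lambda>z. \<Sum>\<^sub>\<infinity>n\<in>-K. ?f n z)"
  have bd: "norm (?f n z) \<le> 4 * (M * nome ^ nat \<bar>n\<bar>)" if "n \<in> - K" "z \<in> cball 0 R" for n z
  proof -
    have "N \<le> nat \<bar>n\<bar>" using that by (auto simp: K_def)
    from N[OF this] show ?thesis unfolding M_def by (intro norm_cosec2_shift) (use that in auto)
  qed
  have sm: "(\<lambda>n. 4 * (M * nome ^ nat \<bar>n\<bar>)) summable_on (- K)"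
    by (intro summable_on_cmult_right summable_on_subset_banach[OF summable_on_geometric_int]) (use nome in auto)
  have notint: "z + of_int n * \<tau> \<notin> \<int>" if "n \<in> - K" "z \<in> cball 0 R" for n z
  proof
    assume "z + of_int n * \<tau> \<in> \<int>"
    have a: "norm z \<le> R" "M * nome ^ nat \<bar>n\<bar> < 1/2" using that N[of "nat \<bar>n\<bar>"] by (auto simp: K_def)
    have "\<bar>Im z\<bar> \<le> R" using a(1) abs_Im_le_cmod[of z] by linarith
    moreover have "Im z = - (of_int n * Im \<tau>)"
      using \<open>z + of_int n * \<tau> \<in> \<int>\<close> by (auto elim!: Ints_cases simp: complex_eq_iff)
    ultimately have "of_int \<bar>n\<bar> * Im \<tau> \<le> R" using Im_pos by (simp add: abs_mult)
    \<comment> \<open>The preceding inequality in exponential form: it makes the majorant at least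
      1, against the choice of \<open>N\<close>.\<close>
    then have "1 \<le> exp (2 * pi * (R - of_int \<bar>n\<bar> * Im \<tau>))" by simp
    also have "\<dots> = M * nome ^ nat \<bar>n\<bar>"
      by (simp add: M_def nome_def algebra_simps flip: exp_of_nat_mult exp_add)
    finally show False using a(2) by simp
  qed
  have ul: "uniform_limit (cball 0 R) (\<lambda>X z. \<Sum>n\<in>X. ?f n z) H (finite_subsets_at_top (- K))"
    unfolding H_def by (rule Weierstrass_m_test_general[OF bd sm])
  have holf: "?f n holomorphic_on cball 0 R" if "n \<in> - K" for n
    using notint[OF that] by (intro holomorphic_cosec2 holomorphic_intros) auto
  have "H holomorphic_on ball 0 R"
  proof (rule holomorphic_uniform_limit[OF _ ul])
    show "\<forall>\<^sub>F X in finite_subsets_at_top (- K). continuous_on (cball 0 R) (\<lambda>z. \<Sum>n\<in>X. ?f n z) \<and>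
        (\<lambda>z. \<Sum>n\<in>X. ?f n z) holomorphic_on ball 0 R"
    proof (rule eventually_finite_subsets_at_top_weakI)
      fix X assume "finite X" "X \<subseteq> - K"
      then have "(\<lambda>z. \<Sum>n\<in>X. ?f n z) holomorphic_on cball 0 R"
        using holf by (intro holomorphic_on_sum) auto
      then show "continuous_on (cball 0 R) (\<lambda>z. \<Sum>n\<in>X. ?f n z) \<and>
          (\<lambda>z. \<Sum>n\<in>X. ?f n z) holomorphic_on ball 0 R"
        by (auto intro: holomorphic_on_imp_continuous_on holomorphic_on_subset)
    qed
  qed auto
  have smf: "(\<lambda>n. ?f n z) summable_on (- K)" if "z \<in> ball 0 R" for z
  proof (rule abs_summable_summable)
    show "(\<lambda>n. norm (?f n z)) summable_on (- K)"
      by (rule Infinite_Sum.abs_summable_on_comparison_test'[OF sm]) (use bd that in auto)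
  qed
  have smK: "(\<lambda>n. ?f n z) summable_on K" for z using K(1) by (rule summable_on_finite)
  have all: "K \<union> - K = UNIV" by auto
  show ?thesis
  proof (rule that[OF K \<open>H holomorphic_on ball 0 R\<close>])
    fix z :: complex assume z: "z \<in> ball 0 R"
    show "(\<lambda>n. ?f n z) summable_on UNIV"
      using summable_on_union[OF smK smf[OF z]] unfolding all .
    have "wsum z = infsum (\<lambda>n. ?f n z) K + H z"
      using infsum_Un_disjoint[OF smK smf[OF z]] unfolding all wsum_def H_def by auto
    then show "wsum z = (\<Sum>n\<in>K. ?f n z) + H z" using K(1) by simp
  qed
qed

lemma wsum_periodic: "periodic wsum"
proof (rule periodicI)
  show "wsum (z + 1) = wsum z" for z
    unfolding wsum_def using cosec2_plus1[of "z + of_int _ * \<tau>"] by (simp add: algebra_simps)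
  show "wsum (z + \<tau>) = wsum z" for z
  proof -
    have "wsum z = (\<Sum>\<^sub>\<infinity>n::int. cosec2 (z + of_int (n + 1) * \<tau>))"
      unfolding wsum_def
      by (rule infsum_reindex_bij_witness[of _ "\<lambda>n. n + 1" "\<lambda>n. n - 1"]) auto
    then show ?thesis by (simp add: wsum_def algebra_simps)
  qed
qed

lemma wsum_minus: "wsum (- z) = wsum z"
proof -
  have "wsum (- z) = (\<Sum>\<^sub>\<infinity>n::int. cosec2 (- z + of_int (- n) * \<tau>))"
    unfolding wsum_def by (rule infsum_reindex_bij_witness[of _ uminus uminus]) auto
  also have "\<dots> = wsum z" unfolding wsum_def
    using cosec2_minus[of "z + of_int _ * \<tau>"] by (simp add: algebra_simps)
  finally show ?thesis .
qed

lemma notin_L_shift: "z \<notin> L \<Longrightarrow> z + of_int n * \<tau> \<notin> \<int>"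
proof
  assume "z \<notin> L" "z + of_int n * \<tau> \<in> \<int>"
  then obtain m where "z = of_int m + of_int (- n) * \<tau>"
    by (auto elim!: Ints_cases simp: algebra_simps)
  then have "z \<in> L" unfolding L_def by blast
  with \<open>z \<notin> L\<close> show False by simp
qed

text \<open>Near 0 the only row with a pole is the one through 0, so the leading coefficient is that
  of \<open>cosec2\<close> itself.\<close>

lemma LL_wsum: "LL 2 wsum (1 / (2 * of_real pi * \<i>)\<^sup>2)"
  unfolding LL_def
proof (intro conjI wsum_periodic)
  have "wsum analytic_on - L"
  proof (subst analytic_on_analytic_at, safe)
    fix z assume z: "z \<notin> L"
    obtain K H where *: "finite K" "H holomorphic_on ball 0 (norm z + 1)"
      "\<And>w. w \<in> ball 0 (norm z + 1) \<Longrightarrow> wsum w = (\<Sum>n\<in>K. cosec2 (w + of_int n * \<tau>)) + H w"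
      using wsum_split[of "norm z + 1"] by metis
    have "(\<lambda>w. (\<Sum>n\<in>K. cosec2 (w + of_int n * \<tau>)) + H w) holomorphic_on ball 0 (norm z + 1) - L"
      using notin_L_shift
      by (intro holomorphic_intros holomorphic_cosec2 holomorphic_on_subset[OF *(2)]) auto
    then have "wsum holomorphic_on ball 0 (norm z + 1) - L"
      by (rule holomorphic_transform) (use *(3) in auto)
    then show "wsum analytic_on {z}"
      using z by (subst analytic_at) (auto intro!: exI[of _ "ball 0 (norm z + 1) - L"] simp: L_closed open_Diff)
  qed
  then show "wsum holomorphic_on - L" by (rule analytic_imp_holomorphic)
next
  obtain K H where *: "finite K" "0 \<in> K" "H holomorphic_on ball 0 1"
      "\<And>w. w \<in> ball 0 1 \<Longrightarrow> wsum w = (\<Sum>n\<in>K. cosec2 (w + of_int n * \<tau>)) + H w"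
    using wsum_split[of 1] by metis
  have H: "(H \<longlongrightarrow> H 0) (at 0)"
    using *(3) by (meson analytic_at analytic_at_imp_isCont centre_in_ball isContD open_ball zero_less_one)
  have c: "((\<lambda>w. cosec2 (w + of_int n * \<tau>)) \<longlongrightarrow> cosec2 (0 + of_int n * \<tau>)) (at 0)" if "n \<noteq> 0" for n :: int
  proof -
    let ?S = "{w. w + of_int n * \<tau> \<notin> \<int>}"
    have "of_int n * \<tau> \<notin> \<int>" using that Im_pos by (auto elim!: Ints_cases simp: complex_eq_iff)
    moreover have "open ?S"
    proof -
      have "closed ((\<lambda>w. w + of_int n * \<tau>) -` \<int>)"
        by (intro closed_vimage closed_Ints continuous_intros)
      then have "open (- ((\<lambda>w. w + of_int n * \<tau>) -` \<int>))" by (rule open_Compl)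
      moreover have "?S = - ((\<lambda>w. w + of_int n * \<tau>) -` \<int>)" by auto
      ultimately show ?thesis by (simp only:)
    qed
    moreover have "(\<lambda>w. cosec2 (w + of_int n * \<tau>)) holomorphic_on ?S"
      by (intro holomorphic_cosec2 holomorphic_intros) auto
    ultimately have "(\<lambda>w. cosec2 (w + of_int n * \<tau>)) analytic_on {0}"
      using analytic_at[of _ 0] by force
    from analytic_at_imp_isCont[OF this] show ?thesis by (simp add: isCont_def)
  qed
  have "((\<lambda>w. w\<^sup>2 * cosec2 w + (w\<^sup>2 * (\<Sum>n\<in>K-{0}. cosec2 (w + of_int n * \<tau>)) + w\<^sup>2 * H w)) \<longlongrightarrow>
     1 / (2 * of_real pi * \<i>)\<^sup>2 + (0\<^sup>2 * (\<Sum>n\<in>K-{0}. cosec2 (0 + of_int n * \<tau>)) + 0\<^sup>2 * H 0)) (at 0)"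
    by (intro tendsto_intros tendsto_cosec2 H c) auto
  moreover have "eventually (\<lambda>w. w\<^sup>2 * cosec2 w + (w\<^sup>2 * (\<Sum>n\<in>K-{0}. cosec2 (w + of_int n * \<tau>)) + w\<^sup>2 * H w)
     = w\<^sup>2 * wsum w) (at 0)"
  proof -
    have "eventually (\<lambda>w. w \<in> ball 0 1) (at (0::complex))" by (intro eventually_at_in_open') auto
    then show ?thesis
    proof eventually_elim
      case (elim w)
      show ?case using *(4)[OF elim] *(1,2) by (simp add: sum.remove[of K 0] algebra_simps)
    qed
  qed
  ultimately show "((\<lambda>z. z\<^sup>2 * wsum z) \<longlongrightarrow> 1 / (2 * of_real pi * \<i>)\<^sup>2) (at 0)"
    using tendsto_cong by fastforce
qed

lemma tendsto_odd_at_0: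
  fixes f :: "complex \<Rightarrow> complex"
  assumes "(f \<longlongrightarrow> l) (at 0)" "\<And>z. f (- z) = - f z" shows "l = 0"
proof -
  have "((\<lambda>z. f (- z)) \<longlongrightarrow> l) (at 0)"
    by (rule filterlim_compose[OF assms(1), of "uminus"])
       (auto intro!: filterlim_atI tendsto_eq_intros simp: eventually_at_filter)
  then have "((\<lambda>z. - f z) \<longlongrightarrow> l) (at 0)" by (simp add: assms(2))
  with tendsto_minus[OF assms(1)] have "- l = l" using tendsto_unique[OF at_neq_bot] by blast
  then show ?thesis by simp
qed

text \<open>Scaling \<open>wsum\<close> makes the double pole \<open>1 / z\<^sup>2\<close>. Evenness
  rules out a simple pole in the difference, and subtracting its limit \<open>c\<close> gives the
  usual normalisation without constant term.\<close>

lemma ex_wp: "\<exists>P. LL 2 P 1 \<and> (\<forall>z. P (- z) = P z) \<and> (\<forall>z\<in>L. P z = 0) \<and> ((\<lambda>z. P z - 1 / z\<^sup>2) \<longlongrightarrow> 0) (at 0)"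
proof -
  define l where "l = 1 / (2 * of_real pi * \<i>)\<^sup>2"
  have l: "l \<noteq> 0" by (simp add: l_def)
  define f where "f = (\<lambda>z. wsum z / l)"
  have f: "LL 2 f 1"
    using LL_wsum l tendsto_divide[OF _ tendsto_const, of "\<lambda>z. z\<^sup>2 * wsum z" l "at 0" l]
    unfolding LL_def f_def l_def[symmetric] by (auto simp: periodic_def intro!: holomorphic_intros)
  have fm: "f (- z) = f z" for z by (simp add: f_def wsum_minus)
  define d where "d = (\<lambda>z. f z - 1 / z\<^sup>2)"
  have dm: "d (- z) = d z" for z by (simp add: d_def fm)
  have hol: "d holomorphic_on - L" using f unfolding d_def LL_def
    by (intro holomorphic_intros) (use L_0 in auto)
  note sing = isolated_singularity_L[OF hol, of 0]
  have "((\<lambda>z. z\<^sup>2 * f z - 1) \<longlongrightarrow> 1 - 1) (at 0)" using f unfolding LL_def by (intro tendsto_intros) auto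
  moreover have "eventually (\<lambda>z. z\<^sup>2 * f z - 1 = z ^ Suc 1 * d z) (at 0)"
    using eventually_neq_at_within[of 0] by eventually_elim (auto simp: d_def field_simps power2_eq_square)
  ultimately have "((\<lambda>z. z ^ Suc 1 * d z) \<longlongrightarrow> 0) (at 0)" using tendsto_cong by fastforce
  from tendsto_pole_lower[OF sing this] obtain l1 where l1: "((\<lambda>z. z ^ 1 * d z) \<longlongrightarrow> l1) (at 0)" by blast
  with tendsto_odd_at_0[OF l1] have "((\<lambda>z. z ^ Suc 0 * d z) \<longlongrightarrow> 0) (at 0)" by (simp add: dm)
  from tendsto_pole_lower[OF sing this] obtain c where c: "(d \<longlongrightarrow> c) (at 0)" by auto
  define P where "P = nice (\<lambda>z. f z - c)"
  have ev: "eventually (\<lambda>z. P z = f z - c) (at 0)" unfolding P_def by (rule eventually_nice_eq)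
  have "((\<lambda>z. z\<^sup>2 * f z - z\<^sup>2 * c) \<longlongrightarrow> 1 - 0\<^sup>2 * c) (at 0)" using f unfolding LL_def by (intro tendsto_intros) auto
  moreover have "eventually (\<lambda>z. z\<^sup>2 * f z - z\<^sup>2 * c = z\<^sup>2 * P z) (at 0)"
    using ev by eventually_elim (simp add: right_diff_distrib)
  ultimately have "((\<lambda>z. z\<^sup>2 * P z) \<longlongrightarrow> 1) (at 0)" using tendsto_cong by fastforce
  moreover have "P holomorphic_on - L"
  proof (rule holomorphic_transform[of "\<lambda>z. f z - c"])
    show "(\<lambda>z. f z - c) holomorphic_on - L" using f unfolding LL_def by (intro holomorphic_intros) auto
  qed (simp add: P_def)
  moreover have "periodic P" using f by (auto simp: LL_def periodic_def P_def nice_def)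
  ultimately have "LL 2 P 1" by (simp add: LL_def)
  moreover have "P (- z) = P z" for z by (simp add: P_def nice_def fm)
  moreover have "P z = 0" if "z \<in> L" for z using that by (simp add: P_def nice_def)
  moreover have "((\<lambda>z. P z - 1 / z\<^sup>2) \<longlongrightarrow> 0) (at 0)"
  proof -
    have "((\<lambda>z. d z - c) \<longlongrightarrow> c - c) (at 0)" by (intro tendsto_intros c)
    moreover have "eventually (\<lambda>z. d z - c = P z - 1 / z\<^sup>2) (at 0)"
      using ev by eventually_elim (simp add: d_def)
    ultimately show ?thesis using tendsto_cong by fastforce
  qed
  ultimately show ?thesis by blast
qed

section \<open>Leading coefficients of sums and products\<close>

lemma LL_add: "LL n f a \<Longrightarrow> LL n g b \<Longrightarrow> LL n (\<lambda>z. f z + g z) (a + b)"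
  unfolding LL_def using tendsto_add[of "\<lambda>z. z ^ n * f z" a "at 0" "\<lambda>z. z ^ n * g z" b]
  by (auto simp: periodic_def distrib_left intro!: holomorphic_intros)

lemma LL_const: "LL 0 (\<lambda>_. c) c"
  unfolding LL_def by (auto simp: periodic_def)

lemma LL_mult: "LL n f a \<Longrightarrow> LL m g b \<Longrightarrow> LL (n + m) (\<lambda>z. f z * g z) (a * b)"
  unfolding LL_def using tendsto_mult[of "\<lambda>z. z ^ n * f z" a "at 0" "\<lambda>z. z ^ m * g z" b]
  by (auto simp: periodic_def power_add mult_ac intro!: holomorphic_intros)

lemma LL_cmult: "LL n f a \<Longrightarrow> LL n (\<lambda>z. c * f z) (c * a)"
  using LL_mult[OF LL_const] by simp

lemma LL_power: "LL n f a \<Longrightarrow> LL (k * n) (\<lambda>z. f z ^ k) (a ^ k)"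
  by (induction k) (use LL_const[of 1] LL_mult in auto)

lemma LL_diff: "LL n f a \<Longrightarrow> LL n g b \<Longrightarrow> LL n (\<lambda>z. f z - g z) (a - b)"
  using LL_add[OF _ LL_cmult[of n g b "-1"], of f a] by simp

lemma LL_mono: "LL n f a \<Longrightarrow> n < m \<Longrightarrow> LL m f 0"
proof -
  assume *: "LL n f a" "n < m"
  have "((\<lambda>z. z ^ (m - n) * (z ^ n * f z)) \<longlongrightarrow> 0 ^ (m - n) * a) (at 0)"
    using * unfolding LL_def by (intro tendsto_intros) auto
  moreover have "(\<lambda>z. z ^ (m - n) * (z ^ n * f z)) = (\<lambda>z. z ^ m * f z)"
    using * by (simp flip: power_add mult.assoc)
  ultimately have "((\<lambda>z. z ^ m * f z) \<longlongrightarrow> 0) (at 0)" using * by (simp add: power_0_left)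
  then show ?thesis using * by (auto simp: LL_def)
qed

lemma LL_parity:
  assumes "LL n f a" "\<And>z. (- z) ^ n * f (- z) = - (z ^ n * f z)" shows "a = 0"
  using tendsto_odd_at_0[of "\<lambda>z. z ^ n * f z" a] assms by (auto simp: LL_def)

section \<open>The Weierstrass equation and its invariants\<close>

definition wp :: "complex \<Rightarrow> complex" where
  "wp = (SOME P. LL 2 P 1 \<and> (\<forall>z. P (- z) = P z) \<and> (\<forall>z\<in>L. P z = 0) \<and> ((\<lambda>z. P z - 1 / z\<^sup>2) \<longlongrightarrow> 0) (at 0))"

lemma LL_wp: "LL 2 wp 1" and wp_minus [simp]: "wp (- z) = wp z" and wp_L [simp]: "z \<in> L \<Longrightarrow> wp z = 0"
  and wp_lim: "((\<lambda>z. wp z - 1 / z\<^sup>2) \<longlongrightarrow> 0) (at 0)"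
  using someI_ex[OF ex_wp] unfolding wp_def[symmetric] by auto

lemma wp_holo: "wp holomorphic_on - L" and wp_periodic: "periodic wp"
  using LL_wp by (auto simp: LL_def)

definition wp' :: "complex \<Rightarrow> complex" where "wp' = nice (deriv wp)"

lemma wp'_L [simp]: "z \<in> L \<Longrightarrow> wp' z = 0" by (simp add: wp'_def nice_def)

lemma wp_deriv [derivative_intros]: "z \<notin> L \<Longrightarrow> (wp has_field_derivative wp' z) (at z)"
  using holomorphic_derivI[OF wp_holo open_compl_L, of z] by (simp add: wp'_def)

lemma wp'_holo: "wp' holomorphic_on - L"
  unfolding wp'_def by (rule holomorphic_transform[OF holomorphic_deriv[OF wp_holo open_compl_L]]) auto

lemma wp'_periodic: "periodic wp'"
  unfolding periodic_def
proof safe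
  fix z w assume "w \<in> L"
  then show "wp' (z + w) = wp' z"
    using deriv_translate[of wp w z] periodicD[OF wp_periodic] by (auto simp: wp'_def nice_def)
qed

lemma wp'_minus [simp]: "wp' (- z) = - wp' z"
proof (cases "z \<in> L")
  case False
  then have "- z \<notin> L" by simp
  then have "((\<lambda>z. wp (- z)) has_field_derivative wp' (- z) * (- 1)) (at z)"
    by (intro DERIV_chain2[OF wp_deriv]) (auto intro!: derivative_eq_intros)
  then have "(wp has_field_derivative - wp' (- z)) (at z)" by simp
  then show ?thesis using wp_deriv[OF False] DERIV_unique by fastforce
qed simp

text \<open>The regular part of the Weierstrass function at 0. The differential equation is obtained
  by expanding in it, and two lattices are later compared through it.\<close>

definition wp0 :: "complex \<Rightarrow> complex" where "wp0 = remove_sings (\<lambda>z. wp z - 1 / z\<^sup>2)"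

lemma wp_minus_pole_holo: "(\<lambda>z. wp z - 1 / z\<^sup>2) holomorphic_on - L"
  by (intro holomorphic_intros wp_holo) (use L_0 in auto)

lemma wp_eq:
  assumes "z \<notin> L" shows "wp z = 1 / z\<^sup>2 + wp0 z"
proof -
  have "(\<lambda>z. wp z - 1 / z\<^sup>2) analytic_on {z}"
    using wp_minus_pole_holo assms analytic_at open_compl_L by blast
  then show ?thesis by (simp add: wp0_def)
qed

lemma wp0_0: "wp0 0 = 0" unfolding wp0_def using wp_lim by (rule remove_sings_eqI)

lemma wp0_analytic: "wp0 analytic_on {0}"
  unfolding wp0_def by (rule remove_sings_analytic_at[OF isolated_singularity_L[OF wp_minus_pole_holo] wp_lim])

lemma wp'_eq:
  assumes "z \<notin> L" shows "wp' z = - 2 / z ^ 3 + deriv wp0 z"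
proof -
  have z0: "z \<noteq> 0" using assms L_0 by auto
  have ev: "eventually (\<lambda>w. wp0 w = wp w - 1 / w\<^sup>2) (nhds z)"
    by (rule eventually_mono[OF eventually_nhds_in_open[of "- L" z]]) (use assms wp_eq in auto)
  have "((\<lambda>w. 1 / w\<^sup>2) has_field_derivative - 2 / z ^ 3) (at z)"
    using z0 by (auto intro!: derivative_eq_intros simp: field_simps power2_eq_square power3_eq_cube)
  from DERIV_diff[OF wp_deriv[OF assms] this]
  have "((\<lambda>w. wp w - 1 / w\<^sup>2) has_field_derivative wp' z + 2 / z ^ 3) (at z)" by simp
  then have "(wp0 has_field_derivative wp' z + 2 / z ^ 3) (at z)"
    by (rule iffD2[OF DERIV_cong_ev[OF refl ev refl]])
  then have "deriv wp0 z = wp' z + 2 / z ^ 3" by (rule DERIV_imp_deriv)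
  then show ?thesis by simp
qed

lemma wp0_lim: "(wp0 \<longlongrightarrow> 0) (at 0)" "(deriv wp0 \<longlongrightarrow> deriv wp0 0) (at 0)"
  using analytic_at_imp_isCont[OF wp0_analytic] analytic_at_imp_isCont[OF analytic_deriv[OF wp0_analytic]]
  by (simp_all add: isCont_def wp0_0)

lemma LL_wp': "LL 3 wp' (- 2)"
proof -
  have "((\<lambda>z. - 2 + z ^ 3 * deriv wp0 z) \<longlongrightarrow> - 2 + 0 ^ 3 * deriv wp0 0) (at 0)"
    by (intro tendsto_intros wp0_lim)
  moreover have "eventually (\<lambda>z. - 2 + z ^ 3 * deriv wp0 z = z ^ 3 * wp' z) (at 0)"
    using eventually_notin_L[of 0]
  proof eventually_elim
    case (elim z)
    then have "z \<noteq> 0" by auto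
    then show ?case using wp'_eq[OF elim] by (simp add: field_simps)
  qed
  ultimately have "((\<lambda>z. z ^ 3 * wp' z) \<longlongrightarrow> - 2) (at 0)" using tendsto_cong by fastforce
  then show ?thesis using wp'_periodic wp'_holo by (simp add: LL_def)
qed

text \<open>The poles of order 6 cancel in \<open>D\<close>; since \<open>wp0\<close> vanishes at 0,
  even \<open>z ^ 4 * D z\<close> tends to 0, and evenness of \<open>D\<close> removes order 3. A
  function with a pole of order at most 2 is affine in \<open>wp\<close>.\<close>

lemma ex_invariants: "\<exists>p. \<forall>z. z \<notin> L \<longrightarrow> (wp' z)\<^sup>2 = 4 * wp z ^ 3 - fst p * wp z - snd p"
proof -
  define D where "D = (\<lambda>z. (wp' z)\<^sup>2 - 4 * wp z ^ 3)"
  have "LL (2 * 3) (\<lambda>z. (wp' z)\<^sup>2) ((- 2)\<^sup>2)" "LL (3 * 2) (\<lambda>z. 4 * wp z ^ 3) (4 * 1 ^ 3)"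
    by (intro LL_power LL_wp' LL_cmult LL_wp)+
  then have "LL 6 (\<lambda>z. (wp' z)\<^sup>2) 4" "LL 6 (\<lambda>z. 4 * wp z ^ 3) 4" by simp_all
  from LL_diff[OF this] have D6: "LL 6 D 0" by (simp add: D_def)
  have Dm: "D (- z) = D z" for z by (simp add: D_def)
  have "((\<lambda>z. - 4 * z * deriv wp0 z + z ^ 4 * (deriv wp0 z)\<^sup>2 - 12 * wp0 z - 12 * z\<^sup>2 * (wp0 z)\<^sup>2 - 4 * z ^ 4 * wp0 z ^ 3) \<longlongrightarrow>
     - 4 * 0 * deriv wp0 0 + 0 ^ 4 * (deriv wp0 0)\<^sup>2 - 12 * 0 - 12 * 0\<^sup>2 * 0\<^sup>2 - 4 * 0 ^ 4 * 0 ^ 3) (at 0)"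
    by (intro tendsto_intros wp0_lim)
  moreover have "eventually (\<lambda>z. - 4 * z * deriv wp0 z + z ^ 4 * (deriv wp0 z)\<^sup>2 - 12 * wp0 z - 12 * z\<^sup>2 * (wp0 z)\<^sup>2 - 4 * z ^ 4 * wp0 z ^ 3
     = z ^ 4 * D z) (at 0)"
    using eventually_notin_L[of 0]
  proof eventually_elim
    case (elim z)
    then have z: "z \<noteq> 0" by auto
    define u where "u = 1 / z"
    have "z * u = 1" using z by (simp add: u_def)
    moreover have "wp' z = - 2 * u ^ 3 + deriv wp0 z" "wp z = u\<^sup>2 + wp0 z"
      using wp'_eq[OF elim] wp_eq[OF elim] by (simp_all add: u_def power_divide)
    ultimately show ?case unfolding D_def by algebra
  qed
  ultimately have "((\<lambda>z. z ^ 4 * D z) \<longlongrightarrow> 0) (at 0)" using tendsto_cong by fastforce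
  then have "LL (Suc 3) D 0" using D6 by (simp add: LL_def)
  then obtain l3 where l3: "LL 3 D l3" by (rule LL_lower)
  with LL_parity[OF l3] have "LL (Suc 2) D 0" by (simp add: Dm)
  then obtain l2 where l2: "LL 2 D l2" by (rule LL_lower)
  have "LL 2 (\<lambda>z. D z - l2 * wp z) 0"
    using LL_diff[OF l2 LL_cmult[OF LL_wp, of l2]] by simp
  then have "LL (Suc 1) (\<lambda>z. D z - l2 * wp z) 0" by (simp only: Suc_1)
  then obtain l1 where "LL 1 (\<lambda>z. D z - l2 * wp z) l1" by (rule LL_lower)
  from LL_1_const[OF this] obtain c where *: "\<And>z. z \<notin> L \<Longrightarrow> D z - l2 * wp z = c" by metis
  show ?thesis
  proof (rule exI[of _ "(- l2, - c)"], intro allI impI)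
    fix z assume "z \<notin> L"
    from *[OF this] show "(wp' z)\<^sup>2 = 4 * wp z ^ 3 - fst (- l2, - c) * wp z - snd (- l2, - c)"
      by (simp add: D_def algebra_simps)
  qed
qed

definition g2 :: complex where
  "g2 = fst (SOME p. \<forall>z. z \<notin> L \<longrightarrow> (wp' z)\<^sup>2 = 4 * wp z ^ 3 - fst p * wp z - snd p)"
definition g3 :: complex where
  "g3 = snd (SOME p. \<forall>z. z \<notin> L \<longrightarrow> (wp' z)\<^sup>2 = 4 * wp z ^ 3 - fst p * wp z - snd p)"

lemma wp'_squared: "z \<notin> L \<Longrightarrow> (wp' z)\<^sup>2 = 4 * wp z ^ 3 - g2 * wp z - g3"
  unfolding g2_def g3_def using someI_ex[OF ex_invariants] by blast

lemma LL_eventually_nonzero: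
  assumes "LL n f l" "l \<noteq> 0" "n > 0" "z \<notin> L" shows "eventually (\<lambda>w. w \<notin> L \<and> f w \<noteq> 0) (at z)"
proof -
  note N = LL_nice_elliptic[OF assms(1-3)]
  obtain z0 where z0: "nice f z0 \<noteq> 0" using N(8) by blast
  show ?thesis using elliptic_eventually_nonzero[OF N(1) z0, of z]
    by eventually_elim (auto simp: nice_def split: if_splits)
qed

lemma eq_0_continuation:
  assumes "f holomorphic_on - L" "z \<notin> L" "eventually (\<lambda>w. f w = 0) (at z)" shows "f z = (0::complex)"
proof -
  have "isCont f z" using assms by (meson ComplI analytic_at analytic_at_imp_isCont open_compl_L)
  then have "(f \<longlongrightarrow> f z) (at z)" by (simp add: isCont_def)
  moreover have "(f \<longlongrightarrow> 0) (at z)" using assms(3) by (rule tendsto_eventually)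
  ultimately show ?thesis using tendsto_unique[OF at_neq_bot] by blast
qed

text \<open>Differentiating the Weierstrass equation gives the claim multiplied by
  \<open>wp'\<close>. The factor is cancelled off the isolated zeros of \<open>wp'\<close>, and
  continuity covers those.\<close>

lemma wp'_deriv [derivative_intros]:
  assumes "z \<notin> L" shows "(wp' has_field_derivative 6 * (wp z)\<^sup>2 - g2 / 2) (at z)"
proof -
  let ?d = "\<lambda>z. deriv wp' z - (6 * (wp z)\<^sup>2 - g2 / 2)"
  have der: "(wp' has_field_derivative deriv wp' w) (at w)" if "w \<notin> L" for w
    using holomorphic_derivI[OF wp'_holo open_compl_L] that by simp
  have "wp' w * ?d w = 0" if w: "w \<notin> L" for w
  proof -
    have ev: "eventually (\<lambda>z. (wp' z)\<^sup>2 = 4 * wp z ^ 3 - g2 * wp z - g3) (nhds w)"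
      by (rule eventually_mono[OF eventually_nhds_in_open[of "- L" w]]) (use w wp'_squared in auto)
    have "((\<lambda>z. (wp' z)\<^sup>2) has_field_derivative 2 * wp' w * deriv wp' w) (at w)"
      by (rule derivative_eq_intros der[OF w] refl | simp)+
    moreover have "((\<lambda>z. 4 * wp z ^ 3 - g2 * wp z - g3) has_field_derivative 12 * (wp w)\<^sup>2 * wp' w - g2 * wp' w) (at w)"
      by (rule derivative_eq_intros wp_deriv[OF w] refl | simp)+
    ultimately have "2 * wp' w * deriv wp' w = 12 * (wp w)\<^sup>2 * wp' w - g2 * wp' w"
      using DERIV_cong_ev[OF refl ev refl] DERIV_unique by blast
    then show ?thesis by algebra
  qed
  moreover have "eventually (\<lambda>w. w \<notin> L \<and> wp' w \<noteq> 0) (at z)"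
    by (rule LL_eventually_nonzero[OF LL_wp']) (use assms in auto)
  ultimately have "eventually (\<lambda>w. ?d w = 0) (at z)"
    by (auto elim!: eventually_mono)
  moreover have "?d holomorphic_on - L"
    by (intro holomorphic_intros wp_holo holomorphic_deriv wp'_holo) auto
  ultimately have "?d z = 0" using assms by (intro eq_0_continuation)
  then show ?thesis using der[OF assms] by simp
qed

text \<open>If \<open>c\<close> were omitted, \<open>1 / (wp z - c)\<close> would have no pole and
  tend to 0 at the lattice, so it would be constantly 0.\<close>

lemma wp_surj: obtains z where "z \<notin> L" "wp z = c"
proof -
  have "\<exists>z. z \<notin> L \<and> wp z = c"
  proof (rule ccontr)
    assume *: "\<nexists>z. z \<notin> L \<and> wp z = c"
    let ?f = "\<lambda>z. 1 / (wp z - c)"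
    have "((\<lambda>z. z\<^sup>2 / (z\<^sup>2 * wp z - z\<^sup>2 * c)) \<longlongrightarrow> 0\<^sup>2 / (1 - 0\<^sup>2 * c)) (at 0)"
      using LL_wp unfolding LL_def by (intro tendsto_intros) auto
    moreover have "eventually (\<lambda>z. z\<^sup>2 / (z\<^sup>2 * wp z - z\<^sup>2 * c) = z ^ 0 * ?f z) (at 0)"
      using eventually_neq_at_within[of 0]
    proof eventually_elim
      case (elim z)
      then show ?case by (simp flip: right_diff_distrib)
    qed
    ultimately have "((\<lambda>z. z ^ 0 * ?f z) \<longlongrightarrow> 0) (at 0)" using tendsto_cong by fastforce
    moreover have "?f holomorphic_on - L" using * by (intro holomorphic_intros wp_holo) auto
    moreover have "periodic ?f" using wp_periodic by (auto simp: periodic_def)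
    ultimately have "LL 0 ?f 0" by (simp add: LL_def)
    from LL_0_const[OF this half_periods(1)] show False using * half_periods(1) by auto
  qed
  then show ?thesis using that by blast
qed

lemma LL_zorder_ge_2:
  assumes "LL n f l" "l \<noteq> 0" "n > 0" "p \<notin> L" "f p = 0" "(f has_field_derivative 0) (at p)"
  shows "zorder f p \<ge> 2"
proof -
  have hol: "f holomorphic_on - L" using assms by (simp add: LL_def)
  have "eventually (\<lambda>w. w \<notin> L \<and> f w \<noteq> 0) (at p)" by (rule LL_eventually_nonzero[OF assms(1-4)])
  then obtain w where w: "w \<notin> L" "f w \<noteq> 0" using eventually_happens'[OF at_neq_bot] by blast
  have "zorder f p \<ge> int 2"
  proof (rule zorder_geI[of f p "- L" w])
    show "f analytic_on {p}" using hol assms(4) analytic_at open_compl_L by blast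
    show "(deriv ^^ k) f p = 0" if "k < 2" for k
      using that assms(5) DERIV_imp_deriv[OF assms(6)] by (auto simp: less_2_cases_iff)
  qed (use hol w assms connected_compl_L in auto)
  then show ?thesis by simp
qed

lemma LL_wp_minus: "LL 2 (\<lambda>z. wp z - c) 1"
  using LL_diff[OF LL_wp LL_mono[OF LL_const[of c], of 2]] by simp

lemma wp_half_period: "\<omega> \<notin> L \<Longrightarrow> 2 * \<omega> \<in> L \<Longrightarrow> wp' \<omega> = 0"
  using periodicD[OF wp'_periodic, of "2 * \<omega>" "- \<omega>"] wp'_minus[of \<omega>] by simp

text \<open>\<open>wp - wp \<omega>\<close> has a pole of order 2 only, but equal values would give
  it a double zero at each of the two half periods, since \<open>wp'\<close> vanishes there.\<close>

lemma wp_half_periods_neq: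
  assumes "\<omega> \<notin> L" "2 * \<omega> \<in> L" "\<omega>' \<notin> L" "2 * \<omega>' \<in> L" "\<omega> - \<omega>' \<notin> L"
  shows "wp \<omega> \<noteq> wp \<omega>'"
proof
  assume eq: "wp \<omega> = wp \<omega>'"
  let ?f = "\<lambda>z. wp z - wp \<omega>"
  note f = LL_wp_minus[of "wp \<omega>"]
  have ne: "\<omega>' - \<omega> \<notin> L" "\<omega> \<noteq> \<omega>'" using assms(5) L_minus_commute by auto
  have d: "(?f has_field_derivative 0) (at \<omega>)" "(?f has_field_derivative 0) (at \<omega>')"
    using assms by (auto intro!: derivative_eq_intros simp: wp_half_period)
  have "zorder ?f \<omega> \<ge> 2" "zorder ?f \<omega>' \<ge> 2"
    by (rule LL_zorder_ge_2[OF f]; use assms eq d in simp)+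
  moreover have "(\<Sum>p\<in>{\<omega>, \<omega>'}. nat (zorder ?f p)) \<le> 2"
    by (rule LL_zero_count_le[OF f]) (use assms ne eq in auto)
  ultimately show False using ne by simp
qed

text \<open>The roots are the values of \<open>wp\<close> at the three half periods. As they are
  distinct, differences of the cubic equations can be divided by \<open>e1 - e2\<close> and
  \<open>e1 - e3\<close>, which yields the symmetric relations.\<close>

lemma roots_exist:
  obtains e1 e2 e3 where "e1 \<noteq> e2" "e1 \<noteq> e3" "e2 \<noteq> e3" "e1 + e2 + e3 = 0"
    "g2 = - 4 * (e1 * e2 + e1 * e3 + e2 * e3)" "g3 = 4 * e1 * e2 * e3"
proof -
  define p1 p2 p3 where "p1 = (1/2 :: complex)" and "p2 = \<tau>/2" and "p3 = (1 + \<tau>)/2"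
  have h: "\<omega>/2 \<notin> L \<Longrightarrow> \<omega> \<in> L \<Longrightarrow> \<omega>/2 \<notin> L \<and> 2 * (\<omega>/2) \<in> L" for \<omega> by simp
  have p: "p1 \<notin> L \<and> 2 * p1 \<in> L" "p2 \<notin> L \<and> 2 * p2 \<in> L" "p3 \<notin> L \<and> 2 * p3 \<in> L"
    unfolding p1_def p2_def p3_def by (intro h half_periods L_1 L_tau L_add)+
  have d: "p1 - p2 \<notin> L" "p1 - p3 \<notin> L" "p2 - p3 \<notin> L"
  proof -
    show "p1 - p2 \<notin> L" using half_periods(5) by (simp add: p1_def p2_def)
    have "p1 - p3 = - p2" "p2 - p3 = - p1" by (auto simp: p1_def p2_def p3_def field_simps)
    then show "p1 - p3 \<notin> L" "p2 - p3 \<notin> L" using p by simp_all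
  qed
  define e1 e2 e3 where "e1 = wp p1" and "e2 = wp p2" and "e3 = wp p3"
  have ne: "e1 \<noteq> e2" "e1 \<noteq> e3" "e2 \<noteq> e3"
    unfolding e1_def e2_def e3_def using p d by (intro wp_half_periods_neq; blast)+
  have r: "4 * e1 ^ 3 - g2 * e1 - g3 = 0" "4 * e2 ^ 3 - g2 * e2 - g3 = 0" "4 * e3 ^ 3 - g2 * e3 - g3 = 0"
    unfolding e1_def e2_def e3_def using wp'_squared[of p1] wp'_squared[of p2] wp'_squared[of p3]
      wp_half_period[of p1] wp_half_period[of p2] wp_half_period[of p3] p by simp_all
  have "(e1 - e2) * (4 * (e1\<^sup>2 + e1 * e2 + e2\<^sup>2) - g2) = 0" "(e1 - e3) * (4 * (e1\<^sup>2 + e1 * e3 + e3\<^sup>2) - g2) = 0"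
    using r by algebra+
  then have q: "4 * (e1\<^sup>2 + e1 * e2 + e2\<^sup>2) - g2 = 0" "4 * (e1\<^sup>2 + e1 * e3 + e3\<^sup>2) - g2 = 0"
    using ne by auto
  then have "4 * (e2 - e3) * (e1 + e2 + e3) = 0" by algebra
  then have s: "e1 + e2 + e3 = 0" using ne by auto
  have "g2 = - 4 * (e1 * e2 + e1 * e3 + e2 * e3)" using q s by algebra
  moreover from this have "g3 = 4 * e1 * e2 * e3" using r(1) s by algebra
  ultimately show ?thesis by (rule that[OF ne s])
qed

lemma discriminant_nonzero: "g2 ^ 3 \<noteq> 27 * g3\<^sup>2"
proof -
  obtain e1 e2 e3 where e: "e1 \<noteq> e2" "e1 \<noteq> e3" "e2 \<noteq> e3" "e1 + e2 + e3 = 0"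
    "g2 = - 4 * (e1 * e2 + e1 * e3 + e2 * e3)" "g3 = 4 * e1 * e2 * e3" by (rule roots_exist)
  have "g2 ^ 3 - 27 * g3\<^sup>2 = 16 * ((e1 - e2) * (e1 - e3) * (e2 - e3))\<^sup>2"
  proof -
    have e3: "e3 = - e1 - e2" using e(4) by algebra
    show ?thesis unfolding e(5,6) e3 by algebra
  qed
  moreover have "16 * ((e1 - e2) * (e1 - e3) * (e2 - e3))\<^sup>2 \<noteq> 0" using e(1-3) by simp
  ultimately have "g2 ^ 3 - 27 * g3\<^sup>2 \<noteq> 0" by metis
  then show ?thesis by (simp only: right_minus_eq simp_thms)
qed

end

section \<open>Normal form of the covers\<close>

context period_lattice
begin

lemma LL_unique:
  assumes "LL n f l" "\<And>z. z \<notin> L \<Longrightarrow> f z = 0" shows "l = 0"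
proof -
  have "((\<lambda>z. z ^ n * f z) \<longlongrightarrow> l) (at 0)" using assms by (simp add: LL_def)
  moreover have "eventually (\<lambda>z. z ^ n * f z = 0) (at 0)"
    using eventually_notin_L[of 0] by eventually_elim (simp add: assms)
  then have "((\<lambda>z. z ^ n * f z) \<longlongrightarrow> 0) (at 0)" by (rule tendsto_eventually)
  ultimately show ?thesis using tendsto_unique[OF at_neq_bot] by blast
qed

lemma LL_monomials:
  "LL 6 (\<lambda>z. c * wp z ^ 3) c" "LL 5 (\<lambda>z. c * (wp z * wp' z)) (- 2 * c)" "LL 4 (\<lambda>z. c * (wp z)\<^sup>2) c"
  "LL 3 (\<lambda>z. c * wp' z) (- 2 * c)" "LL 2 (\<lambda>z. c * wp z) c"
  using LL_cmult[OF LL_power[OF LL_wp, of 3], of c] LL_cmult[OF LL_mult[OF LL_wp LL_wp'], of c]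
    LL_cmult[OF LL_power[OF LL_wp, of 2], of c] LL_cmult[OF LL_wp', of c] LL_cmult[OF LL_wp, of c]
  by (simp_all add: mult.commute)

lemma LL_2_poly: "LL 2 (\<lambda>z. e * wp z + g) e"
  using LL_add[OF LL_monomials(5)[of e] LL_mono[OF LL_const[of g]]] by simp

lemma LL_3_poly: "LL 3 (\<lambda>z. d * wp' z + e * wp z + g) (- 2 * d)"
  using LL_add[OF LL_monomials(4)[of d] LL_mono[OF LL_2_poly[of e g]]] by (simp add: add.assoc)

lemma LL_4_poly: "LL 4 (\<lambda>z. c * (wp z)\<^sup>2 + d * wp' z + e * wp z + g) c"
  using LL_add[OF LL_monomials(3)[of c] LL_mono[OF LL_3_poly[of d e g]]] by (simp add: add.assoc)

lemma LL_5_poly: "LL 5 (\<lambda>z. b * (wp z * wp' z) + c * (wp z)\<^sup>2 + d * wp' z + e * wp z + g) (- 2 * b)"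
  using LL_add[OF LL_monomials(2)[of b] LL_mono[OF LL_4_poly[of c d e g]]] by (simp add: add.assoc)

lemma LL_6_poly:
  "LL 6 (\<lambda>z. a * wp z ^ 3 + b * (wp z * wp' z) + c * (wp z)\<^sup>2 + d * wp' z + e * wp z + g) a"
  using LL_add[OF LL_monomials(1)[of a] LL_mono[OF LL_5_poly[of b c d e g]]] by (simp add: add.assoc)

text \<open>The six functions have pole orders 6, 5, 4, 3, 2 and 0, so the highest surviving
  coefficient is always a leading coefficient and must vanish.\<close>

lemma monomials_indep:
  assumes "\<And>z. z \<notin> L \<Longrightarrow> a * wp z ^ 3 + b * (wp z * wp' z) + c * (wp z)\<^sup>2 + d * wp' z + e * wp z + g = 0"
  shows "a = 0 \<and> b = 0 \<and> c = 0 \<and> d = 0 \<and> e = 0 \<and> g = 0"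
proof -
  have a: "a = 0" using LL_unique[OF LL_6_poly assms] by simp
  have b: "b = 0" using LL_unique[OF LL_5_poly[of b c d e g]] assms a by simp
  have c: "c = 0" using LL_unique[OF LL_4_poly[of c d e g]] assms a b by simp
  have d: "d = 0" using LL_unique[OF LL_3_poly[of d e g]] assms a b c by simp
  have e: "e = 0" using LL_unique[OF LL_2_poly[of e g]] assms a b c d by simp
  have "g = 0" using assms[OF half_periods(1)] a b c d e by simp
  then show ?thesis using a b c d e by simp
qed

lemma LL_2_structure:
  assumes "LL 2 f l" obtains g where "\<And>z. z \<notin> L \<Longrightarrow> f z = l * wp z + g"
proof -
  have "LL 2 (\<lambda>z. f z - l * wp z) 0" using LL_diff[OF assms LL_monomials(5)[of l]] by simp
  then have "LL (Suc 1) (\<lambda>z. f z - l * wp z) 0" by (simp only: Suc_1)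
  then obtain l1 where "LL 1 (\<lambda>z. f z - l * wp z) l1" by (rule LL_lower)
  from LL_1_const[OF this] obtain g where "\<And>z. z \<notin> L \<Longrightarrow> f z - l * wp z = g" by metis
  then have "f z = l * wp z + g" if "z \<notin> L" for z using that by (metis add_diff_cancel_left' diff_add_cancel add.commute)
  then show ?thesis using that by blast
qed

text \<open>Elimination by pole order: each step subtracts the basis function with the same leading
  term. No basis function has order 1, because a single simple pole is impossible.\<close>

lemma LL_5_structure:
  assumes "LL 5 f l"
  obtains c d e g where "\<And>z. z \<notin> L \<Longrightarrow> f z = - l / 2 * (wp z * wp' z) + c * (wp z)\<^sup>2 + d * wp' z + e * wp z + g"
proof -
  define f4 where "f4 = (\<lambda>z. f z - (- l / 2) * (wp z * wp' z))"
  have "LL (Suc 4) f4 0" unfolding f4_def using LL_diff[OF assms LL_monomials(2)[of "- l / 2"]] by simp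
  then obtain c where f4: "LL 4 f4 c" by (rule LL_lower)
  define f3 where "f3 = (\<lambda>z. f4 z - c * (wp z)\<^sup>2)"
  have "LL (Suc 3) f3 0" unfolding f3_def using LL_diff[OF f4 LL_monomials(3)[of c]] by simp
  then obtain l3 where f3: "LL 3 f3 l3" by (rule LL_lower)
  define f2 where "f2 = (\<lambda>z. f3 z - (- l3 / 2) * wp' z)"
  have "LL 3 f2 0" unfolding f2_def using LL_diff[OF f3 LL_monomials(4)[of "- l3 / 2"]] by simp
  then have "LL (Suc 2) f2 0" by simp
  then obtain e where f2: "LL 2 f2 e" by (rule LL_lower)
  obtain g where g: "\<And>z. z \<notin> L \<Longrightarrow> f2 z = e * wp z + g" by (rule LL_2_structure[OF f2]) blast
  have "f z = - l / 2 * (wp z * wp' z) + c * (wp z)\<^sup>2 + (- l3 / 2) * wp' z + e * wp z + g" if "z \<notin> L" for z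
    using g[OF that] by (simp add: f4_def f3_def f2_def algebra_simps)
  then show ?thesis using that by blast
qed

text \<open>The coefficients of \<open>wp\<close> and of \<open>1\<close> in \<open>nf'\<close> are the ones that make it a derivative.\<close>
definition nf :: "complex \<times> complex \<times> complex \<Rightarrow> complex \<Rightarrow> complex" where
  "nf = (\<lambda>(P, S, T) z. 2 / 5 * (wp z * wp' z) + S / 2 * (wp z)\<^sup>2 + P / 6 * wp' z + T * wp z + 0)"

text \<open>The leading coefficient 4 is that of \<open>(wp' z)\<^sup>2\<close>, so the squares of
  the first family appear without a scaling factor.\<close>

definition nf' :: "complex \<times> complex \<times> complex \<Rightarrow> complex \<Rightarrow> complex" where
  "nf' = (\<lambda>(P, S, T) z. 4 * wp z ^ 3 + S * (wp z * wp' z) + P * (wp z)\<^sup>2 + T * wp' z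
     + (- (3 / 5) * g2) * wp z + (- (2 / 5) * g3 - P * g2 / 12))"

lemma LL_nf: "LL 5 (nf q) (- 4 / 5)"
proof (cases q)
  case (fields P S T)
  then show ?thesis using LL_5_poly[of "2/5" "S/2" "P/6" T 0] by (simp add: nf_def)
qed

lemma LL_nf': "LL 6 (nf' q) 4"
proof (cases q)
  case (fields P S T)
  then show ?thesis
    using LL_6_poly[of 4 S P T "- (3 / 5) * g2" "- (2 / 5) * g3 - P * g2 / 12"] by (simp add: nf'_def)
qed

lemma nf_deriv:
  assumes z: "z \<notin> L" shows "(nf q has_field_derivative nf' q z) (at z)"
proof (cases q)
  case (fields P S T)
  have "(nf q has_field_derivative (2 / 5 * (wp z * (6 * (wp z)\<^sup>2 - g2 / 2) + wp' z * wp' z) +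
      S / 2 * (2 * wp z * wp' z) + P / 6 * (6 * (wp z)\<^sup>2 - g2 / 2) + T * wp' z)) (at z)"
    unfolding nf_def fields prod.case
    by (rule derivative_eq_intros refl z | simp add: algebra_simps)+
  also have "2 / 5 * (wp z * (6 * (wp z)\<^sup>2 - g2 / 2) + wp' z * wp' z) +
      S / 2 * (2 * wp z * wp' z) + P / 6 * (6 * (wp z)\<^sup>2 - g2 / 2) + T * wp' z = nf' q z"
    unfolding nf'_def fields prod.case power2_eq_square[symmetric] wp'_squared[OF z]
    by (simp add: field_simps power2_eq_square power3_eq_cube)
  finally show ?thesis .
qed

text \<open>A triple point of \<open>nf q\<close> off the lattice is a multiple zero of its
  derivative; in this form the condition is algebraic in \<open>wp\<close> and
  \<open>wp'\<close>.\<close>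

definition good :: "complex \<times> complex \<times> complex \<Rightarrow> bool" where
  "good q \<longleftrightarrow> (\<exists>p1 p2 p3. p1 \<notin> L \<and> p2 \<notin> L \<and> p3 \<notin> L \<and> p1 - p2 \<notin> L \<and> p1 - p3 \<notin> L \<and> p2 - p3 \<notin> L \<and>
     (\<forall>p\<in>{p1, p2, p3}. nf' q p = 0 \<and> (nf' q has_field_derivative 0) (at p)))"

lemma nf_elliptic: "nf q nicely_meromorphic_on UNIV" "periodic (nf q)" "ell_degree \<tau> (nf q) = 5"
  "w \<in> L \<Longrightarrow> is_pole (nf q) w" "z \<notin> L \<Longrightarrow> \<not> is_pole (nf q) z" "ram_index (nf q) 0 = 5"
proof -
  have "nice (nf q) = nf q" by (auto simp: nice_def nf_def split: prod.splits)
  with LL_nice_elliptic[OF LL_nf[of q]]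
  show "nf q nicely_meromorphic_on UNIV" "periodic (nf q)" "ell_degree \<tau> (nf q) = 5"
    "w \<in> L \<Longrightarrow> is_pole (nf q) w" "z \<notin> L \<Longrightarrow> \<not> is_pole (nf q) z" "ram_index (nf q) 0 = 5"
    by (auto simp: ram_index_def)
qed

lemma nf_holo: "nf q holomorphic_on - L" and nf'_holo: "nf' q holomorphic_on - L"
  using LL_nf LL_nf' by (auto simp: LL_def)

section \<open>Moebius equivalence of covers\<close>

definition nonconst :: "(complex \<Rightarrow> complex) \<Rightarrow> bool" where
  "nonconst f \<longleftrightarrow> (\<forall>c z0. eventually (\<lambda>w. f w \<noteq> c) (at z0))"

lemma nonconstI:
  assumes f: "f nicely_meromorphic_on UNIV" and p: "is_pole f p" shows "nonconst f"
  unfolding nonconst_def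
proof safe
  fix c z0
  have "\<not> (\<forall>x. f x = c)"
  proof
    assume "\<forall>x. f x = c"
    then have "f = (\<lambda>_. c)" by auto
    then show False using p by simp
  qed
  then have "eventually (\<lambda>w. f w \<noteq> c) (cosparse UNIV)"
    using nicely_meromorphic_imp_constant_or_avoid[OF f open_UNIV connected_UNIV, of c] by auto
  then show "eventually (\<lambda>w. f w \<noteq> c) (at z0)" by (simp add: eventually_cosparse_open_eq)
qed

lemma covers5_iff: "f \<in> covers5 \<tau> \<longleftrightarrow> f nicely_meromorphic_on UNIV \<and> periodic f \<and> ell_degree \<tau> f = 5 \<and>
    ram_index f 0 \<ge> 5 \<and> (\<exists>p1 p2 p3. p1 \<notin> L \<and> p2 \<notin> L \<and> p3 \<notin> L \<and> p1 - p2 \<notin> L \<and> p1 - p3 \<notin> L \<and> p2 - p3 \<notin> L \<and>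
    ram_index f p1 \<ge> 3 \<and> ram_index f p2 \<ge> 3 \<and> ram_index f p3 \<ge> 3)"
  by (simp add: covers5_def elliptic_fun_iff lattice_equiv_iff conj_assoc)

lemma covers5_nonconst:
  assumes "f \<in> covers5 \<tau>" shows "nonconst f"
proof -
  have "{z \<in> fund_par \<tau>. is_pole f z} \<noteq> {}"
    using assms by (auto simp: covers5_iff ell_degree_def simp del: Collect_empty_eq)
  then obtain p where "is_pole f p" by blast
  then show ?thesis using assms nonconstI by (auto simp: covers5_iff)
qed

text \<open>For \<open>c\<close> nonzero, \<open>c * f + d\<close> vanishes only where
  \<open>f\<close> takes one fixed value, which a nonconstant \<open>f\<close> avoids on punctured
  neighbourhoods; \<open>moebius_equiv\<close> compares functions on exactly those.\<close>

lemma nonconst_linear: "nonconst f \<Longrightarrow> c \<noteq> 0 \<or> d \<noteq> 0 \<Longrightarrow> eventually (\<lambda>w. c * f w + d \<noteq> 0) (at z0)"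
proof (cases "c = 0")
  case False
  assume "nonconst f"
  then have "eventually (\<lambda>w. f w \<noteq> - d / c) (at z0)" by (simp add: nonconst_def)
  then show ?thesis by eventually_elim (use False in \<open>auto simp: field_simps add_eq_0_iff2\<close>)
qed auto

lemma moebius_refl: "moebius_equiv f f"
  unfolding moebius_equiv_def by (intro exI[of _ 1] exI[of _ 0]) auto

lemma moebius_sym:
  assumes "nonconst f" "moebius_equiv f g" shows "moebius_equiv g f"
proof -
  obtain a b c d where abcd: "a * d - b * c \<noteq> 0"
    and ev: "\<And>z0. \<forall>\<^sub>F w in at z0. g w = (a * f w + b) / (c * f w + d)"
    using assms(2) unfolding moebius_equiv_def by blast
  have "\<forall>\<^sub>F w in at z0. f w = (d * g w + (- b)) / ((- c) * g w + a)" for z0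
  proof -
    have "\<forall>\<^sub>F w in at z0. c * f w + d \<noteq> 0" using abcd by (intro nonconst_linear assms(1)) auto
    with ev[of z0] show ?thesis
    proof eventually_elim
      case (elim w)
      have "(- c) * g w + a = (a * d - b * c) / (c * f w + d)"
           "d * g w + (- b) = f w * (a * d - b * c) / (c * f w + d)"
        using elim by (simp_all add: field_simps)
      then show ?case using elim abcd by simp
    qed
  qed
  moreover have "d * a - (- b) * (- c) \<noteq> 0" using abcd by (simp add: mult.commute)
  ultimately show ?thesis unfolding moebius_equiv_def by blast
qed

lemma moebius_trans:
  assumes "nonconst f" "moebius_equiv f g" "moebius_equiv g h" shows "moebius_equiv f h"
proof -
  obtain a b c d where abcd: "a * d - b * c \<noteq> 0"
    and ev: "\<And>z0. \<forall>\<^sub>F w in at z0. g w = (a * f w + b) / (c * f w + d)"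
    using assms(2) unfolding moebius_equiv_def by blast
  obtain a' b' c' d' where abcd': "a' * d' - b' * c' \<noteq> 0"
    and ev': "\<And>z0. \<forall>\<^sub>F w in at z0. h w = (a' * g w + b') / (c' * g w + d')"
    using assms(3) unfolding moebius_equiv_def by blast
  have "\<forall>\<^sub>F w in at z0. h w = ((a' * a + b' * c) * f w + (a' * b + b' * d)) / ((c' * a + d' * c) * f w + (c' * b + d' * d))" for z0
  proof -
    have "\<forall>\<^sub>F w in at z0. c * f w + d \<noteq> 0" using abcd by (intro nonconst_linear assms(1)) auto
    with ev[of z0] ev'[of z0] show ?thesis
    proof eventually_elim
      case (elim w)
      have lin: "s * g w + t = ((s * a + t * c) * f w + (s * b + t * d)) / (c * f w + d)" for s t
        unfolding elim(1) using elim(3) by (simp add: field_simps)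
      have "a' * g w + b' = ((a' * a + b' * c) * f w + (a' * b + b' * d)) / (c * f w + d)"
           "c' * g w + d' = ((c' * a + d' * c) * f w + (c' * b + d' * d)) / (c * f w + d)"
        by (rule lin)+
      then show ?case using elim by simp
    qed
  qed
  moreover have "(a' * a + b' * c) * (c' * b + d' * d) - (a' * b + b' * d) * (c' * a + d' * c) =
      (a * d - b * c) * (a' * d' - b' * c')" by (simp add: algebra_simps)
  then have "(a' * a + b' * c) * (c' * b + d' * d) - (a' * b + b' * d) * (c' * a + d' * c) \<noteq> 0"
    using abcd abcd' by simp
  ultimately show ?thesis unfolding moebius_equiv_def by blast
qed

text \<open>Clearing the denominator turns the equivalence into one identity off the lattice. A pole
  of order 10 forces \<open>c = 0\<close>, the common normalisation of the poles of order 5 forces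
  \<open>d = a\<close>, and the independence of the monomials leaves \<open>q = q'\<close>.\<close>

lemma nf_moebius_inj:
  assumes "moebius_equiv (nf q) (nf q')" shows "q = q'"
proof -
  obtain a b c d where abcd: "a * d - b * c \<noteq> 0"
    and ev: "\<And>z0. \<forall>\<^sub>F w in at z0. nf q' w = (a * nf q w + b) / (c * nf q w + d)"
    using assms(1) unfolding moebius_equiv_def by blast
  have nc: "nonconst (nf q)" using nf_elliptic(1,4)[where q = q] nonconstI L_0 by blast
  let ?h = "\<lambda>w. c * nf q w * nf q' w + d * nf q' w - a * nf q w - b"
  have h0: "?h z = 0" if "z \<notin> L" for z
  proof (rule eq_0_continuation[OF _ that])
    show "?h holomorphic_on - L" by (intro holomorphic_intros nf_holo)
    have "\<forall>\<^sub>F w in at z. c * nf q w + d \<noteq> 0" using abcd by (intro nonconst_linear nc) auto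
    with ev[of z] show "\<forall>\<^sub>F w in at z. ?h w = 0"
      by eventually_elim (simp add: field_simps)
  qed
  have c: "c = 0"
  proof -
    have "LL 10 (\<lambda>w. c * (nf q w * nf q' w)) (c * (- 4 / 5 * (- 4 / 5)))"
      using LL_cmult[OF LL_mult[OF LL_nf[of q] LL_nf[of q']]] by simp
    moreover have "LL 5 (\<lambda>w. d * nf q' w - a * nf q w - b) (d * (- 4 / 5) - a * (- 4 / 5) - 0)"
      by (intro LL_diff LL_cmult LL_nf LL_mono[OF LL_const]) auto
    ultimately have "LL 10 (\<lambda>w. c * (nf q w * nf q' w) + (d * nf q' w - a * nf q w - b)) (c * (- 4 / 5 * (- 4 / 5)) + 0)"
      by (intro LL_add LL_mono[of 5]) auto
    then have "c * (- 4 / 5 * (- 4 / 5)) + 0 = 0"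
      by (rule LL_unique) (use h0 in \<open>simp add: algebra_simps\<close>)
    then show ?thesis by simp
  qed
  have ad: "d = a"
  proof -
    have "LL 5 (\<lambda>w. d * nf q' w - a * nf q w - b) (d * (- 4 / 5) - a * (- 4 / 5) - 0)"
      by (intro LL_diff LL_cmult LL_nf LL_mono[OF LL_const]) auto
    then have "d * (- 4 / 5) - a * (- 4 / 5) - 0 = 0"
      by (rule LL_unique) (use h0 c in simp)
    then show ?thesis by simp
  qed
  obtain P S T where q: "q = (P, S, T)" by (cases q)
  obtain P' S' T' where q': "q' = (P', S', T')" by (cases q')
  have "0 * wp z ^ 3 + 0 * (wp z * wp' z) + d * (S' / 2 - S / 2) * (wp z)\<^sup>2 + d * (P' / 6 - P / 6) * wp' z
     + d * (T' - T) * wp z + (- b) = 0" if "z \<notin> L" for z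
    using h0[OF that] c ad by (simp add: nf_def q q' algebra_simps)
  from monomials_indep[OF this] show ?thesis using abcd c ad by (simp add: q q')
qed

section \<open>Triple points under Moebius maps and the reduction to normal form\<close>

text \<open>Unlike \<open>ram_index f p \<ge> 3\<close>, this form is visibly invariant under Moebius maps.\<close>
definition tri :: "(complex \<Rightarrow> complex) \<Rightarrow> complex \<Rightarrow> bool" where
  "tri f p \<longleftrightarrow> (\<exists>\<psi> c. \<psi> analytic_on {p} \<and> eventually (\<lambda>w. f w = c + (w - p) ^ 3 * \<psi> w) (at p))"

lemma ram_index_imp_tri:
  assumes f: "f nicely_meromorphic_on UNIV" "nonconst f" and p: "\<not> is_pole f p" "ram_index f p \<ge> 3"
  shows "\<exists>\<psi>. \<psi> analytic_on {p} \<and> eventually (\<lambda>w. f w = f p + (w - p) ^ 3 * \<psi> w) (at p)"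
proof -
  let ?g = "\<lambda>w. f w - f p"
  have an: "?g analytic_on {p}" using nicely_meromorphic_on_imp_analytic_at[OF f(1) _ p(1)] by (auto intro: analytic_intros)
  define n where "n = zorder ?g p"
  have n: "n \<ge> 3" using p by (simp add: ram_index_def n_def)
  have fr: "\<exists>\<^sub>F w in at p. ?g w \<noteq> 0"
    using f(2) by (intro eventually_frequently) (auto simp: nonconst_def)
  obtain r where r: "r > 0" "zor_poly ?g p holomorphic_on cball p r"
    "\<And>w. w \<in> cball p r - {p} \<Longrightarrow> ?g w = zor_poly ?g p w * (w - p) powi n"
    using zorder_exist[OF isolated_singularity_at_analytic[OF an] not_essential_analytic[OF an] fr]
    unfolding n_def by blast
  define \<psi> where "\<psi> = (\<lambda>w. zor_poly ?g p w * (w - p) ^ nat (n - 3))"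
  have "\<psi> holomorphic_on ball p r" unfolding \<psi>_def
    using r(2) by (intro holomorphic_intros) (auto intro: holomorphic_on_subset)
  then have "\<psi> analytic_on {p}" using r(1) analytic_at by (meson centre_in_ball open_ball)
  moreover have "eventually (\<lambda>w. w \<in> ball p r - {p}) (at p)" using r(1) by (intro eventually_at_in_open) auto
  then have "eventually (\<lambda>w. f w = f p + (w - p) ^ 3 * \<psi> w) (at p)"
  proof eventually_elim
    case (elim w)
    have "(w - p) powi n = (w - p) ^ (3 + nat (n - 3))"
      using n by (subst power_int_of_nat[symmetric]) simp
    then have "?g w = (w - p) ^ 3 * \<psi> w" using r(3)[of w] elim by (simp add: \<psi>_def power_add)
    then show ?case by (simp add: algebra_simps)
  qed
  ultimately show ?thesis by blast
qed

text \<open>At a pole of order \<open>n\<close>, \<open>1 / (f - c)\<close> has a zero of the same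
  order for every finite \<open>c\<close>, so \<open>n \<ge> 3\<close> provides the factor
  \<open>(w - p) ^ 3\<close>.\<close>

lemma ram_index_pole:
  assumes f: "f nicely_meromorphic_on UNIV" "nonconst f" and p: "is_pole f p" "ram_index f p \<ge> 3"
  shows "\<exists>\<psi>. \<psi> analytic_on {p} \<and> eventually (\<lambda>w. 1 / (f w - c) = 0 + (w - p) ^ 3 * \<psi> w) (at p)"
proof -
  have mer: "f meromorphic_on {p}" using f(1) meromorphic_on_subset by (auto simp: nicely_meromorphic_on_def)
  define n where "n = - zorder f p"
  have n: "n \<ge> 3" using p by (simp add: ram_index_def n_def)
  have fr: "\<exists>\<^sub>F w in at p. f w \<noteq> 0"
    using f(2) by (intro eventually_frequently) (auto simp: nonconst_def)
  define h where "h = zor_poly f p"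
  obtain r where r: "r > 0" "h holomorphic_on cball p r" "h p \<noteq> 0"
    "\<And>w. w \<in> cball p r - {p} \<Longrightarrow> f w = h w * (w - p) powi (- n)"
    using zorder_exist[OF _ _ fr] mer unfolding n_def meromorphic_at_iff h_def by auto
  define k where "k = (\<lambda>w. h w - c * (w - p) ^ nat n)"
  define \<psi> where "\<psi> = (\<lambda>w. (w - p) ^ nat (n - 3) / k w)"
  have "h analytic_on {p}" using r(1,2) analytic_at[of h p]
    by (meson ball_subset_cball centre_in_ball holomorphic_on_subset open_ball)
  moreover have "k p \<noteq> 0" using r(3) n by (simp add: k_def power_0_left)
  ultimately have "\<psi> analytic_on {p}" unfolding \<psi>_def k_def by (intro analytic_intros) auto
  moreover have "eventually (\<lambda>w. w \<in> ball p r - {p}) (at p)" using r(1) by (intro eventually_at_in_open) auto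
  then have "eventually (\<lambda>w. 1 / (f w - c) = 0 + (w - p) ^ 3 * \<psi> w) (at p)"
  proof eventually_elim
    case (elim w)
    have pw: "(w - p) powi (- n) = 1 / (w - p) ^ nat n"
      using n by (simp add: power_int_def divide_inverse power_inverse)
    have e: "(w - p) ^ nat n = (w - p) ^ 3 * (w - p) ^ nat (n - 3)"
      using n by (simp flip: power_add add: nat_diff_distrib)
    have "f w - c = k w / (w - p) ^ nat n"
      using r(4)[of w] elim by (simp add: pw k_def field_simps)
    then show ?case by (simp add: \<psi>_def e)
  qed
  ultimately show ?thesis by blast
qed

text \<open>With \<open>t = (w - p) ^ 3 * \<psi> w\<close> and \<open>e = c - c0\<close>, the
  identity \<open>1 / (e + t) = 1 / e - t / (e * (e + t))\<close> keeps the factor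
  \<open>(w - p) ^ 3\<close>; the new cofactor is analytic since \<open>e\<close> is
  nonzero.\<close>

lemma tri_inverse:
  assumes "\<psi> analytic_on {p}" "eventually (\<lambda>w. f w = c + (w - p) ^ 3 * \<psi> w) (at p)" "c \<noteq> c0"
  shows "tri (\<lambda>w. 1 / (f w - c0)) p"
proof -
  define k where "k = (\<lambda>w. (c - c0) + (w - p) ^ 3 * \<psi> w)"
  have k: "k analytic_on {p}" unfolding k_def by (intro analytic_intros assms(1))
  have kp: "k p \<noteq> 0" using assms(3) by (simp add: k_def)
  define \<phi> where "\<phi> = (\<lambda>w. - \<psi> w / ((c - c0) * k w))"
  have "\<phi> analytic_on {p}" unfolding \<phi>_def using kp assms by (intro analytic_intros assms(1) k) auto
  moreover have "eventually (\<lambda>w. k w \<noteq> 0) (at p)"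
    by (rule tendsto_imp_eventually_ne[OF isContD[OF analytic_at_imp_isCont[OF k]] kp])
  with assms(2) have "eventually (\<lambda>w. 1 / (f w - c0) = 1 / (c - c0) + (w - p) ^ 3 * \<phi> w) (at p)"
  proof eventually_elim
    case (elim w)
    have f: "f w - c0 = k w" using elim by (simp add: k_def)
    have psi: "(w - p) ^ 3 * \<psi> w = k w - (c - c0)" by (simp add: k_def)
    have "1 / (c - c0) + (w - p) ^ 3 * \<phi> w = 1 / (c - c0) + - ((w - p) ^ 3 * \<psi> w) / ((c - c0) * k w)" by (simp add: \<phi>_def)
    also have "\<dots> = 1 / (c - c0) + - (k w - (c - c0)) / ((c - c0) * k w)" unfolding psi ..
    also have "\<dots> = 1 / k w"
    proof -
      have "1 / e + - (x - e) / (e * x) = 1 / x" if "x \<noteq> 0" "e \<noteq> 0" for x e :: complex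
        using that by (simp add: field_simps)
      then show ?thesis using elim assms(3) by simp
    qed
    finally show ?case unfolding f by (rule sym)
  qed
  ultimately show ?thesis unfolding tri_def by blast
qed

lemma tri_affine:
  assumes "tri f p" "eventually (\<lambda>w. g w = a * f w + b) (at p)" shows "tri g p"
proof -
  obtain \<psi> c where *: "\<psi> analytic_on {p}" "eventually (\<lambda>w. f w = c + (w - p) ^ 3 * \<psi> w) (at p)"
    using assms(1) by (auto simp: tri_def)
  have "(\<lambda>w. a * \<psi> w) analytic_on {p}" by (intro analytic_intros *)
  moreover have "eventually (\<lambda>w. g w = (a * c + b) + (w - p) ^ 3 * (a * \<psi> w)) (at p)"
    using *(2) assms(2) by eventually_elim (simp add: algebra_simps)
  ultimately show ?thesis unfolding tri_def by blast
qed

text \<open>Differentiating \<open>c + (w - p) ^ 3 * \<psi> w\<close> leaves a factor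
  \<open>(w - p)\<^sup>2\<close>. The formula holds first on a punctured neighbourhood, and
  continuity of \<open>nf'\<close> adds the point \<open>p\<close>.\<close>

lemma tri_nf:
  assumes "tri (nf q) p" "p \<notin> L" shows "nf' q p = 0 \<and> (nf' q has_field_derivative 0) (at p)"
proof -
  obtain \<psi> c where *: "\<psi> analytic_on {p}" "eventually (\<lambda>w. nf q w = c + (w - p) ^ 3 * \<psi> w) (at p)"
    using assms(1) by (auto simp: tri_def)
  obtain A where A: "open A" "p \<in> A" "\<psi> holomorphic_on A" using *(1) analytic_at by blast
  obtain B where B: "open B" "p \<in> B" "\<And>w. w \<in> B \<Longrightarrow> w \<noteq> p \<Longrightarrow> nf q w = c + (w - p) ^ 3 * \<psi> w"
    using *(2) by (auto simp: eventually_at_topological)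
  let ?C = "A \<inter> B \<inter> - L"
  have C: "open ?C" "p \<in> ?C" using A B assms by auto
  let ?d = "\<lambda>w. (w - p)\<^sup>2 * (3 * \<psi> w + (w - p) * deriv \<psi> w)"
  have der\<psi>: "(\<psi> has_field_derivative deriv \<psi> w) (at w)" if "w \<in> A" for w
    using holomorphic_derivI[OF A(3,1)] that by simp
  have ev1: "nf' q w = ?d w" if w: "w \<in> ?C" "w \<noteq> p" for w
  proof -
    have "((\<lambda>w. c + (w - p) ^ 3 * \<psi> w) has_field_derivative (w - p) ^ 3 * deriv \<psi> w + (3 * (w - p)\<^sup>2) * \<psi> w) (at w)"
      by (rule derivative_eq_intros der\<psi> refl | use w in simp)+
    moreover have "eventually (\<lambda>w. nf q w = c + (w - p) ^ 3 * \<psi> w) (nhds w)"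
      by (rule eventually_mono[OF eventually_nhds_in_open[of "B - {p}" w]]) (use B w in auto)
    ultimately have "(nf q has_field_derivative (w - p) ^ 3 * deriv \<psi> w + (3 * (w - p)\<^sup>2) * \<psi> w) (at w)"
      by (subst DERIV_cong_ev[OF refl _ refl])
    then have "nf' q w = (w - p) ^ 3 * deriv \<psi> w + (3 * (w - p)\<^sup>2) * \<psi> w"
      using nf_deriv[of w q] w by (intro DERIV_unique) auto
    then show ?thesis by (simp add: power2_eq_square power3_eq_cube algebra_simps)
  qed
  have dh: "?d holomorphic_on A" using A by (intro holomorphic_intros) auto
  have an: "nf' q analytic_on {p}" "?d analytic_on {p}"
    using nf'_holo[of q] open_compl_L dh A(1,2) assms(2) unfolding analytic_at by blast+
  note lim = isContD[OF analytic_at_imp_isCont[OF an(1)]] isContD[OF analytic_at_imp_isCont[OF an(2)]]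
  have "eventually (\<lambda>w. w \<in> ?C - {p}) (at p)" using C by (intro eventually_at_in_open) auto
  then have "eventually (\<lambda>w. nf' q w = ?d w) (at p)"
    by (rule eventually_mono) (use ev1 in blast)
  from Lim_transform_eventually[OF lim(1) this] lim(2) have "nf' q p = ?d p"
    using tendsto_unique[OF at_neq_bot] by blast
  with ev1 have eq: "nf' q w = ?d w" if "w \<in> ?C" for w using that by blast
  have "(\<lambda>w. 3 * \<psi> w + (w - p) * deriv \<psi> w) holomorphic_on A"
    using A by (intro holomorphic_intros) auto
  then obtain D where D: "((\<lambda>w. 3 * \<psi> w + (w - p) * deriv \<psi> w) has_field_derivative D) (at p)"
    using A holomorphic_derivI by blast
  have "((\<lambda>w. (w - p)\<^sup>2) has_field_derivative 0) (at p)" by (auto intro!: derivative_eq_intros)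
  from DERIV_mult[OF this D] have "(?d has_field_derivative 0) (at p)" by simp
  then have "(nf' q has_field_derivative 0) (at p)"
    by (rule has_field_derivative_transform_within_open[OF _ C]) (simp add: eq)
  moreover have "nf' q p = 0" using eq C by simp
  ultimately show ?thesis by simp
qed

lemma good_ram_index:
  assumes "p \<notin> L" "nf' q p = 0" "(nf' q has_field_derivative 0) (at p)" shows "ram_index (nf q) p \<ge> 3"
proof -
  let ?g = "\<lambda>w. nf q w - nf q p"
  have hol: "?g holomorphic_on - L" by (intro holomorphic_intros nf_holo)
  have "nonconst (nf q)" using nf_elliptic(1,4)[where q = q] nonconstI L_0 by blast
  then have "eventually (\<lambda>w. w \<notin> L \<and> ?g w \<noteq> 0) (at p)"
    using eventually_notin_L[of p] by (auto simp: nonconst_def intro: eventually_conj)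
  then obtain w where w: "w \<notin> L" "?g w \<noteq> 0" using eventually_happens'[OF at_neq_bot] by blast
  have d1: "deriv ?g z = nf' q z" if "z \<notin> L" for z
    by (rule DERIV_imp_deriv) (use nf_deriv[OF that, of q] in \<open>auto intro!: derivative_eq_intros\<close>)
  have d2: "deriv (deriv ?g) p = 0"
  proof (rule DERIV_imp_deriv)
    show "(deriv ?g has_field_derivative 0) (at p)"
      by (rule has_field_derivative_transform_within_open[OF assms(3) open_compl_L]) (use assms(1) d1 in auto)
  qed
  have "zorder ?g p \<ge> int 3"
  proof (rule zorder_geI[of ?g p "- L" w])
    show "?g analytic_on {p}" using hol assms(1) analytic_at open_compl_L by blast
    show "(deriv ^^ k) ?g p = 0" if "k < 3" for k
    proof -
      have "k = 0 \<or> k = 1 \<or> k = 2" using that by auto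
      then show ?thesis using d1[OF assms(1)] d2 assms(2) by (auto simp: numeral_2_eq_2)
    qed
  qed (use hol w assms connected_compl_L in auto)
  then show ?thesis using nf_elliptic(5)[OF assms(1), where q = q] by (simp add: ram_index_def)
qed

lemma good_imp_cover:
  assumes "good q" shows "nf q \<in> covers5 \<tau>"
proof -
  obtain p1 p2 p3 where p: "p1 \<notin> L" "p2 \<notin> L" "p3 \<notin> L" "p1 - p2 \<notin> L" "p1 - p3 \<notin> L" "p2 - p3 \<notin> L"
    "\<And>p. p \<in> {p1, p2, p3} \<Longrightarrow> nf' q p = 0 \<and> (nf' q has_field_derivative 0) (at p)"
    using assms unfolding good_def by blast
  have "ram_index (nf q) p \<ge> 3" if "p \<in> {p1, p2, p3}" for p
    using good_ram_index[of p q] p(1-3) p(7)[OF that] that by blast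
  then have "ram_index (nf q) p1 \<ge> 3" "ram_index (nf q) p2 \<ge> 3" "ram_index (nf q) p3 \<ge> 3" by simp_all
  with p(1-6) have "\<exists>p1 p2 p3. p1 \<notin> L \<and> p2 \<notin> L \<and> p3 \<notin> L \<and> p1 - p2 \<notin> L \<and> p1 - p3 \<notin> L \<and> p2 - p3 \<notin> L \<and>
    ram_index (nf q) p1 \<ge> 3 \<and> ram_index (nf q) p2 \<ge> 3 \<and> ram_index (nf q) p3 \<ge> 3" by blast
  then show ?thesis unfolding covers5_iff using nf_elliptic(1,2,3,6)[where q = q] by simp
qed

lemma elliptic_holo:
  assumes "f nicely_meromorphic_on UNIV" "\<And>z. is_pole f z \<Longrightarrow> z \<in> L" shows "f holomorphic_on - L"
proof -
  have "f analytic_on {z}" if "z \<notin> L" for z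
    using nicely_meromorphic_on_imp_analytic_at[OF assms(1)] assms(2) that by blast
  then have "f analytic_on - L" by (subst analytic_on_analytic_at) auto
  then show ?thesis by (rule analytic_imp_holomorphic)
qed

lemma polar_normal_form:
  assumes f: "f nicely_meromorphic_on UNIV" "periodic f" "is_pole f 0" "zorder f 0 = - 5"
    and poles: "\<And>z. is_pole f z \<Longrightarrow> z \<in> L"
  obtains q A E where "A \<noteq> 0" "\<And>z. z \<notin> L \<Longrightarrow> f z = A * nf q z + E"
proof -
  have mer: "f meromorphic_on {0}" using f(1) meromorphic_on_subset by (auto simp: nicely_meromorphic_on_def)
  have "nonconst f" using nonconstI f by blast
  then have fr: "\<exists>\<^sub>F w in at 0. f w \<noteq> 0" by (intro eventually_frequently) (auto simp: nonconst_def)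
  define h where "h = zor_poly f 0"
  obtain r where r: "r > 0" "h holomorphic_on cball 0 r" "h 0 \<noteq> 0"
    "\<And>w. w \<in> cball 0 r - {0} \<Longrightarrow> f w = h w * (w - 0) powi (- 5)"
    using zorder_exist[OF _ _ fr] mer f(4) unfolding meromorphic_at_iff h_def by auto
  have "h analytic_on {0}" using r(1,2) analytic_at[of h 0]
    by (meson ball_subset_cball centre_in_ball holomorphic_on_subset open_ball)
  then have "(h \<longlongrightarrow> h 0) (at 0)" by (intro isContD analytic_at_imp_isCont)
  moreover have "eventually (\<lambda>w. h w = w ^ 5 * f w) (at 0)"
  proof -
    have "eventually (\<lambda>w. w \<in> ball 0 r - {0}) (at 0)" using r(1) by (intro eventually_at_in_open) auto
    then show ?thesis
    proof eventually_elim
      case (elim w)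
      then show ?case using r(4)[of w] by (simp add: power_int_minus field_simps)
    qed
  qed
  ultimately have "((\<lambda>w. w ^ 5 * f w) \<longlongrightarrow> h 0) (at 0)" by (rule Lim_transform_eventually)
  then have "LL 5 f (h 0)" using f elliptic_holo[OF f(1) poles] by (simp add: LL_def)
  then obtain c d e g where s: "\<And>z. z \<notin> L \<Longrightarrow> f z = - h 0 / 2 * (wp z * wp' z) + c * (wp z)\<^sup>2 + d * wp' z + e * wp z + g"
    by (rule LL_5_structure) blast
  \<comment> \<open>\<open>nf\<close> has leading coefficient \<open>- 4 / 5\<close> at 0, so this
    factor matches the leading coefficient \<open>h 0\<close> of \<open>f\<close>.\<close>
  define A where "A = - 5 / 4 * h 0"
  have A: "A \<noteq> 0" using r(3) by (simp add: A_def)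
  have "f z = A * nf (6 * d / A, 2 * c / A, e / A) z + g" if "z \<notin> L" for z
  proof -
    have "A * nf (6 * d / A, 2 * c / A, e / A) z = A * (2 / 5) * (wp z * wp' z) + c * (wp z)\<^sup>2 + d * wp' z + e * wp z"
      using A by (simp add: nf_def distrib_left)
    moreover have "A * (2 / 5) = - h 0 / 2" by (simp add: A_def)
    ultimately show ?thesis using s[OF that] by simp
  qed
  then show ?thesis using that A by blast
qed

text \<open>Ramification at 0 uses up the whole degree 5. If 0 is a pole, it is the only one modulo
  the lattice; if not, \<open>f - f 0\<close> has its only zero there, and inverting it makes this
  zero the only pole. The triple points are passed along as \<open>tri\<close>, which survives the
  inversion.\<close>

lemma cover_polar:
  assumes "f \<in> covers5 \<tau>"
  shows "\<exists>g. g nicely_meromorphic_on UNIV \<and> periodic g \<and> is_pole g 0 \<and> zorder g 0 = - 5 \<and>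
     (\<forall>z. is_pole g z \<longrightarrow> z \<in> L) \<and> moebius_equiv f g \<and>
     (\<forall>p. p \<notin> L \<longrightarrow> ram_index f p \<ge> 3 \<longrightarrow> tri g p)"
proof -
  have f: "f nicely_meromorphic_on UNIV" "periodic f" "ell_degree \<tau> f = 5" "ram_index f 0 \<ge> 5"
    using assms by (auto simp: covers5_iff)
  have nc: "nonconst f" using covers5_nonconst[OF assms] .
  have mer: "f meromorphic_on {z}" for z using f(1) meromorphic_on_subset by (auto simp: nicely_meromorphic_on_def)
  have zf: "0 \<in> fund_par \<tau>" by (simp add: fund_par_iff)
  have neg: "zorder f z < 0" if "is_pole f z" for z
    using isolated_pole_imp_neg_zorder[OF meromorphic_on_isolated_singularity[OF mer] that] .
  show ?thesis
  proof (cases "is_pole f 0")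
    case True
    let ?P = "{z\<in>fund_par \<tau>. is_pole f z}"
    have fin: "finite ?P" using f(3) unfolding ell_degree_def by (metis sum.infinite zero_neq_numeral)
    have "5 = (\<Sum>z\<in>?P. nat (- zorder f z))" using f(3) by (simp add: ell_degree_def)
    also have "\<dots> = nat (- zorder f 0) + (\<Sum>z\<in>?P - {0}. nat (- zorder f z))"
      using fin True zf by (subst sum.remove[of _ 0]) auto
    finally have sm: "5 = nat (- zorder f 0) + (\<Sum>z\<in>?P - {0}. nat (- zorder f z))" .
    have "nat (- zorder f 0) \<ge> 5" using f(4) True by (simp add: ram_index_def)
    with sm have z0: "zorder f 0 = - 5" and "(\<Sum>z\<in>?P - {0}. nat (- zorder f z)) = 0" by linarith+
    then have all0: "\<forall>z\<in>?P - {0}. nat (- zorder f z) = 0" using fin by (subst (asm) sum_eq_0_iff) auto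
    have P0: "?P \<subseteq> {0}"
    proof
      fix z assume z: "z \<in> ?P"
      show "z \<in> {0}"
      proof (rule ccontr)
        assume "z \<notin> {0}"
        then have "nat (- zorder f z) = 0" using all0 z by blast
        then show False using neg[of z] z by simp
      qed
    qed
    have "z \<in> L" if "is_pole f z" for z
    proof -
      have "red 0 0 z \<in> ?P"
        using that is_pole_translate[of f "z - red 0 0 z" "red 0 0 z"] periodicD[OF f(2) red_equiv]
          red_in_par[of 0 0 z] by (simp add: fund_par_eq_par)
      then have "red 0 0 z = 0" using P0 by blast
      then show ?thesis using red_equiv[of z 0 0] by simp
    qed
    moreover have "tri f p" if "p \<notin> L" "ram_index f p \<ge> 3" for p
      using ram_index_imp_tri[OF f(1) nc _ that(2)] calculation that(1) unfolding tri_def by blast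
    ultimately show ?thesis using f True z0 moebius_refl by (intro exI[of _ f]) blast
  next
    case False
    define c where "c = f 0"
    \<comment> \<open>\<open>f - c\<close> has the value \<open>- c\<close> at the poles of
      \<open>f\<close>; \<open>remove_sings\<close> resets it to 0, so that \<open>h\<close> is
      nicely meromorphic and its zeros can be counted.\<close>
    define h where "h = remove_sings (\<lambda>z. f z - c)"
    have merc: "(\<lambda>z. f z - c) meromorphic_on A" for A
      using f(1) by (intro meromorphic_intros) (auto simp: nicely_meromorphic_on_def intro: meromorphic_on_subset)
    have h: "h nicely_meromorphic_on UNIV" unfolding h_def by (rule remove_sings_nicely_meromorphic[OF merc])
    have an: "f analytic_on {z}" if "\<not> is_pole f z" for z
      using nicely_meromorphic_on_imp_analytic_at[OF f(1) _ that] by simp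
    have sing: "isolated_singularity_at (\<lambda>z. f z - c) z" for z
      by (rule meromorphic_on_isolated_singularity[OF merc])
    have hz: "h z = (if is_pole f z then 0 else f z - c)" for z
      using an[of z] by (auto simp: h_def is_pole_minus_const_iff intro!: remove_sings_at_pole remove_sings_at_analytic analytic_intros)
    have hev: "eventually (\<lambda>w. h w = f w - c) (at z)" for z
      unfolding h_def by (rule eventually_remove_sings_eq_at[OF sing])
    have hp: "is_pole h z \<longleftrightarrow> is_pole f z" for z
      unfolding h_def by (simp add: sing is_pole_minus_const_iff)
    have hzo: "zorder h z = zorder (\<lambda>z. f z - c) z" for z unfolding h_def by (simp add: sing)
    have per: "periodic h" using periodicD[OF f(2)] is_pole_translate[of f] by (auto simp: periodic_def hz)
    have zop: "zorder h z = zorder f z" if "is_pole f z" for z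
    proof (cases "c = 0")
      case True then show ?thesis by (simp add: hzo)
    next
      case False
      have "zorder (\<lambda>z. f z - c) z = zorder f z"
        by (rule zorder_diff1)
          (use mer nc neg[OF that] False in \<open>auto simp: nonconst_def intro!: eventually_frequently\<close>)
      then show ?thesis by (simp add: hzo)
    qed
    have deg: "ell_degree \<tau> h = 5"
      using f(3) zop unfolding ell_degree_def hp by (metis (mono_tags, lifting) mem_Collect_eq sum.cong)
    have "h analytic_on {0}" using nicely_meromorphic_on_imp_analytic_at[OF h, of 0] False hp by simp
    have ncf: "eventually (\<lambda>w. f w - c \<noteq> 0) (at z)" for z
      using nc unfolding nonconst_def by (auto elim!: allE[of _ c])
    have hnz: "eventually (\<lambda>w. h w \<noteq> 0) (at z)" for z
      using ncf[of z] hev[of z] by eventually_elim simp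
    then obtain z1 where z1: "h z1 \<noteq> 0" using eventually_happens'[OF at_neq_bot] by blast
    have h0: "h 0 = 0" using False by (simp add: hz c_def)
    have zo0: "zorder h 0 \<ge> 5" using f(4) False by (simp add: ram_index_def hzo c_def)
    let ?Z = "{z\<in>fund_par \<tau>. h z = 0 \<and> \<not> is_pole h z}"
    have cnt: "5 = (\<Sum>z\<in>?Z. nat (zorder h z))" using zero_count[OF h per z1] deg by simp
    have fin: "finite ?Z" using cnt by (metis sum.infinite zero_neq_numeral)
    have sm: "5 = nat (zorder h 0) + (\<Sum>z\<in>?Z - {0}. nat (zorder h z))"
      using cnt fin False hp h0 zf by (subst (asm) sum.remove[of _ 0]) auto
    have "nat (zorder h 0) \<ge> 5" using zo0 by simp
    with sm have z0: "zorder h 0 = 5" and "(\<Sum>z\<in>?Z - {0}. nat (zorder h z)) = 0" by linarith+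
    then have all0: "\<forall>z\<in>?Z - {0}. nat (zorder h z) = 0" using fin by (subst (asm) sum_eq_0_iff) auto
    have P0: "?Z \<subseteq> {0}"
    proof
      fix z assume z: "z \<in> ?Z"
      show "z \<in> {0}"
      proof (rule ccontr)
        assume "z \<notin> {0}"
        then have "nat (zorder h z) = 0" using all0 z by blast
        then show False using zero_zorder_pos[OF h z1, of z] z by simp
      qed
    qed
    have zeros: "z \<in> L" if "h z = 0" "\<not> is_pole h z" for z
    proof -
      have "red 0 0 z \<in> ?Z"
        using that is_pole_translate[of h "z - red 0 0 z" "red 0 0 z"] periodicD[OF per red_equiv]
          red_in_par[of 0 0 z] periodic_cong[OF per red_equiv[of z 0 0]] by (simp add: fund_par_eq_par)
      then have "red 0 0 z = 0" using P0 by blast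
      then show ?thesis using red_equiv[of z 0 0] by simp
    qed
    define g where "g = (\<lambda>z. inverse (h z))"
    have g: "g nicely_meromorphic_on UNIV" unfolding g_def by (rule nicely_meromorphic_on_inverse[OF h])
    have gp: "is_pole g z \<Longrightarrow> h z = 0 \<and> \<not> is_pole h z" for z
    proof -
      assume "is_pole g z"
      then have iz: "isolated_zero h z" unfolding g_def by (simp add: is_pole_inverse_iff)
      then show "h z = 0 \<and> \<not> is_pole h z"
        using zero_isolated_zero_nicely_meromorphic[OF iz nicely_meromorphic_on_subset[OF h]] pole_is_not_zero by blast
    qed
    have merh: "h meromorphic_on {z}" for z using h meromorphic_on_subset by (auto simp: nicely_meromorphic_on_def)
    have "zorder g 0 = - zorder h 0" unfolding g_def
      using merh[of 0] hnz[of 0] by (intro zorder_inverse) (auto simp: meromorphic_at_iff intro!: eventually_frequently)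
    then have zg: "zorder g 0 = - 5" using z0 by simp
    have "is_pole g 0"
      unfolding g_def is_pole_inverse_iff using zorder_pos_imp_isolated_zero[OF merh hnz] z0 by simp
    moreover have "periodic g" using per by (simp add: periodic_def g_def)
    moreover have "moebius_equiv f g"
      unfolding moebius_equiv_def
    proof (rule exI[of _ 0], rule exI[of _ 1], rule exI[of _ 1], rule exI[of _ "- c"], intro conjI allI)
      show "\<forall>\<^sub>F w in at z0. g w = (0 * f w + 1) / (1 * f w + - c)" for z0
        using hev[of z0] by eventually_elim (simp add: g_def inverse_eq_divide)
    qed auto
    moreover have "tri g p" if p: "p \<notin> L" "ram_index f p \<ge> 3" for p
    proof -
      have "tri (\<lambda>w. 1 / (f w - c)) p"
      proof (cases "is_pole f p")
        case True
        then show ?thesis using ram_index_pole[OF f(1) nc True p(2), of c] unfolding tri_def by blast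
      next
        case False
        obtain \<psi> where psi: "\<psi> analytic_on {p}" "eventually (\<lambda>w. f w = f p + (w - p) ^ 3 * \<psi> w) (at p)"
          using ram_index_imp_tri[OF f(1) nc False p(2)] by blast
        \<comment> \<open>All zeros of \<open>h\<close> lie on the lattice, which keeps
          \<open>1 / (f - c)\<close> finite at \<open>p\<close>.\<close>
        have "f p \<noteq> c" using zeros[of p] p(1) False by (auto simp: hz hp)
        then show ?thesis by (rule tri_inverse[OF psi])
      qed
      moreover have "eventually (\<lambda>w. g w = 1 * (1 / (f w - c)) + 0) (at p)"
        using hev[of p] by eventually_elim (simp add: g_def inverse_eq_divide)
      ultimately show ?thesis by (rule tri_affine)
    qed
    ultimately show ?thesis using g zg gp zeros by (intro exI[of _ g]) blast
  qed
qed

lemma cover_normal_form: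
  assumes "f \<in> covers5 \<tau>" shows "\<exists>q. good q \<and> moebius_equiv f (nf q)"
proof -
  obtain g where g: "g nicely_meromorphic_on UNIV" "periodic g" "is_pole g 0" "zorder g 0 = - 5"
     "\<And>z. is_pole g z \<Longrightarrow> z \<in> L" "moebius_equiv f g" "\<And>p. p \<notin> L \<Longrightarrow> ram_index f p \<ge> 3 \<Longrightarrow> tri g p"
    using cover_polar[OF assms] by blast
  obtain q A E where A: "A \<noteq> 0" and gq: "\<And>z. z \<notin> L \<Longrightarrow> g z = A * nf q z + E"
    using polar_normal_form[OF g(1-5)] by metis
  have ev: "eventually (\<lambda>w. nf q w = 1 / A * g w + (- E / A)) (at z)" for z
    using eventually_notin_L[of z] by eventually_elim (use A gq in \<open>simp add: field_simps\<close>)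
  have "moebius_equiv g (nf q)"
    unfolding moebius_equiv_def
  proof (rule exI[of _ "1 / A"], rule exI[of _ "- E / A"], rule exI[of _ 0], rule exI[of _ 1], intro conjI allI)
    show "\<forall>\<^sub>F w in at z0. nf q w = (1 / A * g w + - E / A) / (0 * g w + 1)" for z0
      using ev[of z0] by eventually_elim simp
  qed (use A in auto)
  then have "moebius_equiv f (nf q)" using moebius_trans[OF covers5_nonconst[OF assms] g(6)] by blast
  moreover have "good q"
  proof -
    obtain p1 p2 p3 where p: "p1 \<notin> L" "p2 \<notin> L" "p3 \<notin> L" "p1 - p2 \<notin> L" "p1 - p3 \<notin> L" "p2 - p3 \<notin> L"
      "ram_index f p1 \<ge> 3" "ram_index f p2 \<ge> 3" "ram_index f p3 \<ge> 3"
      using assms unfolding covers5_iff by blast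
    have "nf' q p = 0 \<and> (nf' q has_field_derivative 0) (at p)" if "p \<notin> L" "ram_index f p \<ge> 3" for p
      by (rule tri_nf[OF tri_affine[OF g(7)[OF that] ev] that(1)])
    then show ?thesis unfolding good_def using p by blast
  qed
  ultimately show ?thesis by blast
qed

text \<open>Each Moebius class of covers contains exactly one function \<open>nf q\<close> with
  \<open>good q\<close>: existence is \<open>cover_normal_form\<close>, uniqueness is
  \<open>nf_moebius_inj\<close>.\<close>

lemma N5_eq_card_good: "N5 \<tau> = card {q. good q}"
proof -
  let ?C = "covers5 \<tau>"
  define R where "R = {(f, g). f \<in> ?C \<and> g \<in> ?C \<and> moebius_equiv f g}"
  have equiv: "R `` {f} = R `` {g}" if "f \<in> ?C" "g \<in> ?C" "moebius_equiv f g" for f g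
    using that moebius_trans moebius_sym covers5_nonconst unfolding R_def by blast
  have "?C // R = (\<lambda>q. R `` {nf q}) ` {q. good q}"
  proof safe
    fix X assume "X \<in> ?C // R"
    then obtain f where f: "f \<in> ?C" "X = R `` {f}" by (auto simp: quotient_def)
    obtain q where q: "good q" "moebius_equiv f (nf q)" using cover_normal_form[OF f(1)] by blast
    then have "X = R `` {nf q}" using f equiv good_imp_cover by blast
    then show "X \<in> (\<lambda>q. R `` {nf q}) ` {q. good q}" using q(1) by blast
  next
    fix q assume "good q"
    then show "R `` {nf q} \<in> ?C // R" by (intro quotientI good_imp_cover)
  qed
  moreover have "inj_on (\<lambda>q. R `` {nf q}) {q. good q}"
  proof (rule inj_onI)
    fix q q' assume g: "q \<in> {q. good q}" "q' \<in> {q. good q}" and eq: "R `` {nf q} = R `` {nf q'}"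
    have "(nf q', nf q') \<in> R" using g good_imp_cover moebius_refl by (auto simp: R_def)
    then have "(nf q, nf q') \<in> R" using eq by blast
    then show "q = q'" using nf_moebius_inj by (auto simp: R_def)
  qed
  ultimately have "card (?C // R) = card {q. good q}" using card_image by metis
  then show ?thesis by (simp add: N5_def R_def)
qed

end

section \<open>The two families of solutions\<close>

text \<open>Completed by a zero row, the system has a singular square matrix and hence a nonzero
  kernel vector.\<close>

lemma homogeneous_3_4:
  fixes r1 r2 r3 :: "complex ^ 4"
  obtains x :: "complex ^ 4" where "x \<noteq> 0" "\<And>r. r \<in> {r1, r2, r3} \<Longrightarrow> (\<Sum>j\<in>UNIV. r $ j * x $ j) = 0"
proof -
  define M :: "complex ^ 4 ^ 4" where "M = (\<chi> i. if i = 1 then r1 else if i = 2 then r2 else if i = 3 then r3 else 0)"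
  have "row 4 M = 0" by (simp add: row_def M_def vec_eq_iff)
  then have "det M = 0" by (rule det_zero_row)
  then have "\<not> (\<exists>B. B ** M = mat 1)" using invertible_det_nz[of M] invertible_left_inverse by blast
  then obtain x where x: "M *v x = 0" "x \<noteq> 0" unfolding matrix_left_invertible_ker by blast
  have "(\<Sum>j\<in>UNIV. M $ i $ j * x $ j) = 0" for i
    using x(1) by (simp add: matrix_vector_mult_def vec_eq_iff)
  from this[of 1] this[of 2] this[of 3] show ?thesis
    by (intro that[OF x(2)]) (auto simp: M_def)
qed

context period_lattice
begin

lemma remove_sings_translate:
  assumes "\<And>z. f (z + w) = f z" shows "remove_sings f (z + w) = remove_sings f z"
proof -
  have "remove_sings f (z + w) = remove_sings (\<lambda>u. f (z + w + u)) 0" by (rule remove_sings_shift_0)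
  also have "(\<lambda>u. f (z + w + u)) = (\<lambda>u. f (z + u))" using assms by (metis add.assoc add.commute)
  also have "remove_sings \<dots> 0 = remove_sings f z" by (rule remove_sings_shift_0 [symmetric])
  finally show ?thesis .
qed

lemma holo_imp_analytic: "f holomorphic_on - L \<Longrightarrow> z \<notin> L \<Longrightarrow> f analytic_on {z}"
  using open_compl_L analytic_at by blast

text \<open>A pole of order 6 allows zeros of total multiplicity 6, which the three multiple zeros
  exhaust; so each is exactly double and there is no further zero.\<close>

lemma nf'_zeros:
  assumes p: "p1 \<notin> L" "p2 \<notin> L" "p3 \<notin> L" "p1 - p2 \<notin> L" "p1 - p3 \<notin> L" "p2 - p3 \<notin> L"
    "\<And>p. p \<in> {p1, p2, p3} \<Longrightarrow> nf' q p = 0 \<and> (nf' q has_field_derivative 0) (at p)"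
    and w: "w \<notin> L" "nf' q w = 0"
  shows "zorder (nf' q) w = 2" "\<exists>p\<in>{p1, p2, p3}. w - p \<in> L"
proof -
  note LLu = LL_nf'[of q]
  have ge2: "zorder (nf' q) p \<ge> 2" if "p \<in> {p1, p2, p3}" for p
    by (rule LL_zorder_ge_2[OF LLu]) (use p that in auto)
  have ne: "p1 \<noteq> p2" "p1 \<noteq> p3" "p2 \<noteq> p3" using p(4-6) by auto
  have sym: "p2 - p1 \<notin> L" "p3 - p1 \<notin> L" "p3 - p2 \<notin> L" using p(4-6) L_minus_commute by blast+
  have "(\<Sum>p\<in>{p1, p2, p3}. nat (zorder (nf' q) p)) \<le> 6"
    by (rule LL_zero_count_le[OF LLu]) (use p sym in auto)
  then have le: "nat (zorder (nf' q) p1) + (nat (zorder (nf' q) p2) + nat (zorder (nf' q) p3)) \<le> 6" using ne by simp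
  have ge: "nat (zorder (nf' q) p1) \<ge> 2" "nat (zorder (nf' q) p2) \<ge> 2" "nat (zorder (nf' q) p3) \<ge> 2"
    using ge2[of p1] ge2[of p2] ge2[of p3] by auto
  have eq2: "zorder (nf' q) p = 2" if "p \<in> {p1, p2, p3}" for p
    using le ge that by auto
  show "\<exists>p\<in>{p1, p2, p3}. w - p \<in> L"
  proof (rule ccontr)
    assume "\<not> ?thesis"
    then have n: "w - p1 \<notin> L" "w - p2 \<notin> L" "w - p3 \<notin> L" by auto
    then have n': "p1 - w \<notin> L" "p2 - w \<notin> L" "p3 - w \<notin> L" using L_minus_commute by blast+
    have "w \<noteq> p1" "w \<noteq> p2" "w \<noteq> p3" using n by auto
    have "(\<Sum>p\<in>{w, p1, p2, p3}. nat (zorder (nf' q) p)) \<le> 6"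
      by (rule LL_zero_count_le[OF LLu]) (use p sym n n' w in auto)
    then have "nat (zorder (nf' q) w) + (nat (zorder (nf' q) p1) + (nat (zorder (nf' q) p2) + nat (zorder (nf' q) p3))) \<le> 6"
      using ne \<open>w \<noteq> p1\<close> \<open>w \<noteq> p2\<close> \<open>w \<noteq> p3\<close> by simp
    moreover have "zorder (nf' q) w > 0" by (rule LL_zorder_pos[OF LLu]) (use w in auto)
    ultimately show False using ge by linarith
  qed
  then obtain p where pp: "p \<in> {p1, p2, p3}" "w - p \<in> L" by blast
  have "zorder (nf' q) (p + (w - p)) = zorder (nf' q) p"
    using LLu periodicD[OF _ pp(2)] by (intro zorder_translate) (auto simp: LL_def)
  then show "zorder (nf' q) w = 2" using eq2[OF pp(1)] by simp
qed

definition kf :: "complex \<Rightarrow> complex \<Rightarrow> complex \<Rightarrow> complex \<Rightarrow> complex \<Rightarrow> complex" where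
  "kf c d e g z = c * (wp z)\<^sup>2 + d * wp' z + e * wp z + g"

lemma LL_kf: "LL 4 (kf c d e g) c"
  unfolding kf_def[abs_def] by (rule LL_4_poly)

lemma kf_holo: "kf c d e g holomorphic_on - L" and kf_periodic: "periodic (kf c d e g)"
  using LL_kf by (auto simp: LL_def)

text \<open>Three vanishing conditions on four coefficients give a function with a pole of order at most four and
  zeros at the triple points; its square divided by \<open>nf'\<close> has a pole of order at most two.\<close>
lemma good_square:
  assumes "good q"
  obtains c d e g l m where "c \<noteq> 0 \<or> d \<noteq> 0 \<or> e \<noteq> 0 \<or> g \<noteq> 0" "l = c\<^sup>2 / 4"
    "\<And>z. z \<notin> L \<Longrightarrow> (kf c d e g z)\<^sup>2 = nf' q z * (l * wp z + m)"
    "\<And>z. z \<notin> L \<Longrightarrow> nf' q z = 0 \<Longrightarrow> zorder (nf' q) z = 2"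
proof -
  obtain p1 p2 p3 where p: "p1 \<notin> L" "p2 \<notin> L" "p3 \<notin> L" "p1 - p2 \<notin> L" "p1 - p3 \<notin> L" "p2 - p3 \<notin> L"
    "\<And>p. p \<in> {p1, p2, p3} \<Longrightarrow> nf' q p = 0 \<and> (nf' q has_field_derivative 0) (at p)"
    using assms unfolding good_def by blast
  \<comment> \<open>The values at \<open>p\<close> of the basis \<open>(wp)\<^sup>2\<close>,
    \<open>wp'\<close>, \<open>wp\<close>, 1 of \<open>L(4 P)\<close>; a kernel vector is a
    coefficient vector for \<open>kf\<close>.\<close>
  define r :: "complex \<Rightarrow> complex ^ 4" where
    "r = (\<lambda>p. \<chi> i. if i = 1 then (wp p)\<^sup>2 else if i = 2 then wp' p else if i = 3 then wp p else 1)"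
  obtain x :: "complex ^ 4" where x: "x \<noteq> 0"
    "\<And>s. s \<in> {r p1, r p2, r p3} \<Longrightarrow> (\<Sum>j\<in>UNIV. s $ j * x $ j) = 0"
    using homogeneous_3_4[of "r p1" "r p2" "r p3"] by metis
  define k where "k = kf (x $ 1) (x $ 2) (x $ 3) (x $ 4)"
  have nz: "x $ 1 \<noteq> 0 \<or> x $ 2 \<noteq> 0 \<or> x $ 3 \<noteq> 0 \<or> x $ 4 \<noteq> 0"
    using x(1) by (auto simp: vec_eq_iff forall_4)
  have kp: "k p = 0" if "p \<in> {p1, p2, p3}" for p
  proof -
    have "(\<Sum>j\<in>UNIV. r p $ j * x $ j) = 0" using that by (intro x(2)) auto
    then show ?thesis by (simp add: sum_4 r_def k_def kf_def algebra_simps)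
  qed
  let ?u = "nf' q"
  have khol: "k holomorphic_on - L" and kper: "periodic k" unfolding k_def by (rule kf_holo kf_periodic)+
  have uper: "periodic ?u" using LL_nf'[of q] by (simp add: LL_def)
  have uz: "zorder ?u z = 2 \<and> k z = 0" if z: "z \<notin> L" "?u z = 0" for z
  proof -
    note zeros = nf'_zeros[OF p z]
    obtain p where "p \<in> {p1, p2, p3}" "z - p \<in> L" using zeros(2) by blast
    then have "k z = 0" using periodic_cong[OF kper] kp by metis
    then show ?thesis using zeros(1) by blast
  qed
  define Q0 where "Q0 = (\<lambda>z. (k z)\<^sup>2 / ?u z)"
  define Q where "Q = remove_sings Q0"
  have ksq: "(\<lambda>z. (k z)\<^sup>2) analytic_on {z}" if "z \<notin> L" for z
    by (intro analytic_intros holo_imp_analytic[OF khol that])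
  note uan = holo_imp_analytic[OF nf'_holo]
  have Qan: "Q analytic_on {z}" if z: "z \<notin> L" for z
  proof (cases "?u z = 0")
    case False
    have "Q0 analytic_on {z}" unfolding Q0_def
      by (intro analytic_on_divide ksq uan z) (use False in auto)
    then show ?thesis unfolding Q_def by (intro remove_sings_analytic_on)
  next
    case True
    \<comment> \<open>\<open>k\<close> vanishes at least simply and \<open>nf'\<close> exactly
      doubly, so after division by \<open>(w - z)\<^sup>2\<close> numerator and denominator have
      limits, the latter nonzero.\<close>
    have "((\<lambda>w. k w / (w - z)) \<longlongrightarrow> deriv k z) (at z)"
      using holomorphic_derivI[OF khol open_compl_L, of z] z uz[OF z True] by (simp add: has_field_derivative_iff)
    moreover obtain v where v: "v \<noteq> 0" "((\<lambda>w. ?u w / (w - z)\<^sup>2) \<longlongrightarrow> v) (at z)"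
    proof -
      have "eventually (\<lambda>w. w \<notin> L \<and> ?u w \<noteq> 0) (at z)" by (rule LL_eventually_nonzero[OF LL_nf']) (use z in auto)
      then obtain w where "w \<notin> L" "?u w \<noteq> 0" using eventually_happens'[OF at_neq_bot] by blast
      then have ex: "\<exists>w\<in>-L. ?u w \<noteq> 0" by auto
      obtain s where s: "s > 0" "zor_poly ?u z holomorphic_on cball z s"
        "\<And>w. w \<in> cball z s \<Longrightarrow> ?u w = zor_poly ?u z w * (w - z) ^ 2 \<and> zor_poly ?u z w \<noteq> 0"
      proof -
        have "\<exists>s>0. cball z s \<subseteq> - L \<and> zor_poly ?u z holomorphic_on cball z s \<and>
          (\<forall>w\<in>cball z s. ?u w = zor_poly ?u z w * (w - z) ^ nat (zorder ?u z) \<and> zor_poly ?u z w \<noteq> 0)"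
          using zorder_exist_zero[OF nf'_holo open_compl_L connected_compl_L _ ex, of z] z by blast
        moreover have "nat (zorder ?u z) = 2" using uz[OF z True] by simp
        ultimately show ?thesis using that by metis
      qed
      have "zor_poly ?u z analytic_on {z}" using s(1,2) analytic_at
        by (meson ball_subset_cball centre_in_ball holomorphic_on_subset open_ball)
      then have "(zor_poly ?u z \<longlongrightarrow> zor_poly ?u z z) (at z)" by (intro isContD analytic_at_imp_isCont)
      moreover have "eventually (\<lambda>w. w \<in> ball z s - {z}) (at z)" using s(1) by (intro eventually_at_in_open) auto
      then have "eventually (\<lambda>w. zor_poly ?u z w = ?u w / (w - z)\<^sup>2) (at z)"
        by eventually_elim (use s(3) in \<open>auto simp: field_simps\<close>)
      ultimately have "((\<lambda>w. ?u w / (w - z)\<^sup>2) \<longlongrightarrow> zor_poly ?u z z) (at z)" by (rule Lim_transform_eventually)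
      moreover have "zor_poly ?u z z \<noteq> 0" using s(1) s(3)[of z] by simp
      ultimately show ?thesis using that by blast
    qed
    ultimately have "((\<lambda>w. (k w / (w - z))\<^sup>2 / (?u w / (w - z)\<^sup>2)) \<longlongrightarrow> (deriv k z)\<^sup>2 / v) (at z)"
      by (intro tendsto_intros)
    moreover have "eventually (\<lambda>w. (k w / (w - z))\<^sup>2 / (?u w / (w - z)\<^sup>2) = Q0 w) (at z)"
      using eventually_neq_at_within[of z]
      by eventually_elim (simp add: Q0_def power_divide)
    ultimately have "(Q0 \<longlongrightarrow> (deriv k z)\<^sup>2 / v) (at z)" by (rule Lim_transform_eventually)
    moreover have "isolated_singularity_at Q0 z" unfolding Q0_def
      using ksq[OF z] uan[OF z]
      by (intro isolated_singularity_at_divide isolated_singularity_at_analytic not_essential_analytic)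
    ultimately show ?thesis unfolding Q_def by (intro remove_sings_analytic_at)
  qed
  have Qhol: "Q holomorphic_on - L"
    using Qan analytic_on_analytic_at analytic_imp_holomorphic by (metis ComplD)
  have Qeq: "Q z = Q0 z" if z: "z \<notin> L" "?u z \<noteq> 0" for z
  proof -
    have "Q0 analytic_on {z}" unfolding Q0_def
      by (intro analytic_on_divide ksq uan z) (use z in auto)
    then show ?thesis unfolding Q_def by simp
  qed
  have Qper: "periodic Q" unfolding periodic_def
  proof safe
    fix z w assume w: "w \<in> L"
    then have "Q0 (z + w) = Q0 z" for z using periodicD[OF kper w] periodicD[OF uper w] by (simp add: Q0_def)
    then show "Q (z + w) = Q z" unfolding Q_def by (rule remove_sings_translate)
  qed
  \<comment> \<open>The pole orders at 0 leave \<open>2 * 4 - 6 = 2\<close>. The leading coefficient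
    of \<open>nf'\<close> is 4, whence \<open>l = c\<^sup>2 / 4\<close>.\<close>
  have "((\<lambda>z. (z ^ 4 * k z)\<^sup>2 / (z ^ 6 * ?u z)) \<longlongrightarrow> (x $ 1)\<^sup>2 / 4) (at 0)"
    using LL_kf[of "x $ 1" "x $ 2" "x $ 3" "x $ 4"] LL_nf'[of q] unfolding LL_def k_def by (intro tendsto_intros) auto
  moreover have "eventually (\<lambda>z. z \<notin> L \<and> ?u z \<noteq> 0) (at 0)"
  proof -
    have "nonconst (nice ?u)"
      using LL_nice_elliptic(1,3)[OF LL_nf'[of q]] nonconstI[of "nice ?u" 0] by simp
    then have "eventually (\<lambda>z. nice ?u z \<noteq> 0) (at 0)" by (simp add: nonconst_def)
    then show ?thesis by eventually_elim (auto simp: nice_def split: if_splits)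
  qed
  then have "eventually (\<lambda>z. (z ^ 4 * k z)\<^sup>2 / (z ^ 6 * ?u z) = z\<^sup>2 * Q z) (at 0)"
  proof eventually_elim
    case (elim z)
    then have "z \<noteq> 0" by auto
    have "(z ^ 4)\<^sup>2 = z\<^sup>2 * z ^ 6" by (simp flip: power_mult power_add)
    then have "(z ^ 4 * k z)\<^sup>2 = z\<^sup>2 * z ^ 6 * (k z)\<^sup>2" by (simp only: power_mult_distrib)
    moreover have "A * v * K / (v * u) = A * (K / u)" if "v \<noteq> 0" for A v K u :: complex using that by simp
    ultimately show ?case using Qeq[of z] elim \<open>z \<noteq> 0\<close> by (simp only: Q0_def power_not_zero not_False_eq_True)
  qed
  ultimately have "((\<lambda>z. z\<^sup>2 * Q z) \<longlongrightarrow> (x $ 1)\<^sup>2 / 4) (at 0)" by (rule Lim_transform_eventually)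
  then have "LL 2 Q ((x $ 1)\<^sup>2 / 4)" using Qhol Qper by (simp add: LL_def)
  then obtain m where m: "\<And>z. z \<notin> L \<Longrightarrow> Q z = (x $ 1)\<^sup>2 / 4 * wp z + m" by (rule LL_2_structure) blast
  show ?thesis
  proof (rule that[OF nz refl])
    fix z assume z: "z \<notin> L"
    show "(kf (x $ 1) (x $ 2) (x $ 3) (x $ 4) z)\<^sup>2 = ?u z * ((x $ 1)\<^sup>2 / 4 * wp z + m)"
    proof (cases "?u z = 0")
      case True
      then show ?thesis using uz[OF z] by (simp add: k_def)
    next
      case False
      then show ?thesis using Qeq[OF z False] m[OF z] by (simp add: k_def Q0_def field_simps)
    qed
  qed (use uz in blast)
qed

text \<open>The triples for which \<open>nf'\<close> is \<open>(wp' + a * wp + b)\<^sup>2\<close>;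
  the two equations compare the coefficients of \<open>wp\<close> and of 1.\<close>

definition solA :: "(complex \<times> complex \<times> complex) set" where
  "solA = {(a\<^sup>2, 2 * a, 2 * b) |a b. a * b = g2 / 5 \<and> b\<^sup>2 = 3 / 5 * g3 - a\<^sup>2 * g2 / 12}"

text \<open>The triples for which \<open>nf'\<close> is \<open>4 * k\<^sup>2 / (wp - e)\<close> with
  \<open>k = (wp - e) * (wp + b) + a / 2 * wp'\<close>. The division is exact because
  \<open>e\<close> is a root, so that \<open>wp - e\<close> divides
  \<open>(wp')\<^sup>2\<close>.\<close>

definition solB :: "(complex \<times> complex \<times> complex) set" where
  "solB = {(4 * (2 * b - e + a\<^sup>2), 4 * a, 4 * (a * b)) |e a b. 4 * e ^ 3 - g2 * e - g3 = 0 \<and>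
     4 * (b\<^sup>2 - 2 * b * e + a\<^sup>2 * e) = - (3 / 5) * g2 \<and>
     4 * (a\<^sup>2 * (e\<^sup>2 - g2 / 4) - e * b\<^sup>2) = - (2 / 5) * g3 - 4 * (2 * b - e + a\<^sup>2) * g2 / 12}"

text \<open>The quotient \<open>l * wp + m\<close> is constant iff \<open>c = 0\<close>, and then a
  comparison of coefficients gives the first family. Otherwise it vanishes where
  \<open>wp = t\<close>; this \<open>t\<close> turns out to be a root of the cubic, and cancelling
  \<open>wp - t\<close> gives the second family.\<close>

lemma good_imp_sol:
  assumes "good q" shows "q \<in> solA \<union> solB"
proof -
  obtain P S T where q: "q = (P, S, T)" by (cases q)
  obtain c d e g l m where nz: "c \<noteq> 0 \<or> d \<noteq> 0 \<or> e \<noteq> 0 \<or> g \<noteq> 0" and l: "l = c\<^sup>2 / 4"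
    and eq: "\<And>z. z \<notin> L \<Longrightarrow> (kf c d e g z)\<^sup>2 = nf' q z * (l * wp z + m)"
    and zo: "\<And>z. z \<notin> L \<Longrightarrow> nf' q z = 0 \<Longrightarrow> zorder (nf' q) z = 2"
    using good_square[OF assms] by metis
  show ?thesis
  proof (cases "c = 0")
    case True
    have K: "4 * d\<^sup>2 - m * 4 = 0 \<and> 2 * d * e - m * S = 0 \<and> e\<^sup>2 - m * P = 0 \<and> 2 * d * g - m * T = 0 \<and>
       2 * e * g - d\<^sup>2 * g2 + m * (3 / 5) * g2 = 0 \<and> g\<^sup>2 - d\<^sup>2 * g3 + m * (2 / 5 * g3 + P * g2 / 12) = 0"
    proof -
      have "(4 * d\<^sup>2 - m * 4) * wp z ^ 3 + (2 * d * e - m * S) * (wp z * wp' z) + (e\<^sup>2 - m * P) * (wp z)\<^sup>2 +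
        (2 * d * g - m * T) * wp' z + (2 * e * g - d\<^sup>2 * g2 + m * (3 / 5) * g2) * wp z +
        (g\<^sup>2 - d\<^sup>2 * g3 + m * (2 / 5 * g3 + P * g2 / 12)) = 0" if z: "z \<notin> L" for z
      proof -
        have "(d * wp' z + e * wp z + g)\<^sup>2 = nf' q z * m"
          using eq[OF z] by (simp add: True l kf_def)
        moreover have "(4 * d\<^sup>2 - m * 4) * X ^ 3 + (2 * d * e - m * S) * (X * Y) + (e\<^sup>2 - m * P) * X\<^sup>2 +
          (2 * d * g - m * T) * Y + (2 * e * g - d\<^sup>2 * g2 + m * (3 / 5) * g2) * X +
          (g\<^sup>2 - d\<^sup>2 * g3 + m * (2 / 5 * g3 + P * g2 / 12)) =
          ((d * Y + e * X + g)\<^sup>2 - (4 * X ^ 3 + S * (X * Y) + P * X\<^sup>2 + T * Y + (- (3 / 5) * g2) * X +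
             (- (2 / 5) * g3 - P * g2 / 12)) * m) - d\<^sup>2 * (Y\<^sup>2 - (4 * X ^ 3 - g2 * X - g3))" for X Y
          by (simp add: field_simps power2_eq_square power3_eq_cube)
        ultimately show ?thesis using wp'_squared[OF z] unfolding nf'_def q prod.case by simp
      qed
      then show ?thesis by (rule monomials_indep)
    qed
    have h: "m = d\<^sup>2" "2 * d * e = m * S" "e\<^sup>2 = m * P" "2 * d * g = m * T" using K by auto
    have h': "2 * e * g - d\<^sup>2 * g2 + m * (3 / 5) * g2 = 0" "g\<^sup>2 - d\<^sup>2 * g3 + m * (2 / 5 * g3 + P * g2 / 12) = 0"
      using K by blast+
    \<comment> \<open>If \<open>d = 0\<close>, then \<open>m = 0\<close> and the remaining equations
      kill \<open>e\<close> and \<open>g\<close>, so all four coefficients of \<open>kf\<close>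
      would vanish.\<close>
    have d: "d \<noteq> 0"
    proof
      assume "d = 0"
      then have "e = 0" "g = 0" using h h' by auto
      then show False using nz True \<open>d = 0\<close> by simp
    qed
    define a b where "a = e / d" and "b = g / d"
    have e: "e = a * d" "g = b * d" using d by (simp_all add: a_def b_def)
    have "S = 2 * a" "P = a\<^sup>2" "T = 2 * b" using h(1-4) d by (simp_all add: e power2_eq_square)
    moreover have "a * b = g2 / 5"
    proof -
      have "d\<^sup>2 * (a * b - g2 / 5) = 0" using h'(1) unfolding h(1) e by (simp add: field_simps power2_eq_square)
      then show ?thesis using d by simp
    qed
    moreover have "b\<^sup>2 = 3 / 5 * g3 - a\<^sup>2 * g2 / 12"
    proof -
      have "d\<^sup>2 * (b\<^sup>2 - (3 / 5 * g3 - P * g2 / 12)) = 0"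
        using h'(2) unfolding h(1) e by (simp add: field_simps power2_eq_square)
      then show ?thesis using d \<open>P = a\<^sup>2\<close> by simp
    qed
    ultimately have "q \<in> solA" unfolding q solA_def by blast
    then show ?thesis by simp
  next
    case False
    define t where "t = - m / l"
    have l0: "l \<noteq> 0" using False unfolding l by simp
    obtain w where w: "w \<notin> L" "wp w = t" by (rule wp_surj)
    let ?k = "kf c d e g"
    have eq': "(?k z)\<^sup>2 = nf' q z * (l * (wp z - t))" if "z \<notin> L" for z
      using eq[OF that] l0 by (simp add: t_def field_simps)
    have kw: "?k w = 0" using eq'[OF w(1)] w(2) by simp
    \<comment> \<open>Parity: otherwise \<open>wp - t\<close> has a simple zero at \<open>w\<close>,
      and the even order of the square of \<open>kf\<close> would be 1 plus the order of
      \<open>nf'\<close>, which is 0 or 2.\<close>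
    have "wp' w = 0"
    proof (rule ccontr)
      assume y: "wp' w \<noteq> 0"
      have fr: "\<exists>\<^sub>F z in at w. f z \<noteq> 0" if "LL n f s" "s \<noteq> 0" "n > 0" for f n s
        using LL_eventually_nonzero[OF that w(1)] by (intro eventually_frequently) (auto elim: eventually_mono)
      have mer: "f meromorphic_on {w}" if "LL n f s" for f n s
        using that holo_imp_analytic[OF _ w(1)] by (auto simp: LL_def intro: analytic_on_imp_meromorphic_on)
      have lin: "LL 2 (\<lambda>z. l * (wp z - t)) (l * 1)" by (intro LL_cmult LL_wp_minus)
      have z1: "zorder (\<lambda>z. l * (wp z - t)) w = 1"
      proof (rule zorder_zero_eqI[where S = "- L"])
        show "(\<lambda>z. l * (wp z - t)) holomorphic_on - L" using lin by (simp add: LL_def)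
        have "((\<lambda>z. l * (wp z - t)) has_field_derivative l * wp' w) (at w)"
          by (rule derivative_eq_intros refl w | simp)+
        then have "deriv (\<lambda>z. l * (wp z - t)) w = l * wp' w" by (rule DERIV_imp_deriv)
        then show "(deriv ^^ nat 1) (\<lambda>z. l * (wp z - t)) w \<noteq> 0" using l0 y by simp
      qed (use w in auto)
      have "2 * zorder ?k w = zorder (\<lambda>z. (?k z)\<^sup>2) w"
        using zorder_power[OF mer[OF LL_kf] fr[OF LL_kf False], of d e g 2] by simp
      also have "\<dots> = zorder (\<lambda>z. nf' q z * (l * (wp z - t))) w"
      proof (rule zorder_cong[OF _ refl])
        show "eventually (\<lambda>z. (?k z)\<^sup>2 = nf' q z * (l * (wp z - t))) (at w)"
          using eventually_notin_L[of w] by eventually_elim (rule eq')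
      qed
      also have "\<dots> = zorder (nf' q) w + zorder (\<lambda>z. l * (wp z - t)) w"
        by (rule zorder_mult[OF mer[OF LL_nf'] fr[OF LL_nf'] mer[OF lin] fr[OF lin]]) (use l0 in auto)
      also have "\<dots> = zorder (nf' q) w + 1" using z1 by simp
      finally have par: "2 * zorder ?k w = zorder (nf' q) w + 1" .
      have zu: "zorder (nf' q) w = 0 \<or> zorder (nf' q) w = 2"
        using zo[OF w(1)] zorder_eq_0I[OF holo_imp_analytic[OF nf'_holo w(1)]] by blast
      have "2 * i \<noteq> j + 1" if "j = 0 \<or> j = 2" for i j :: int using that by presburger
      from this[OF zu] par show False by blast
    qed
    then have root: "4 * t ^ 3 - g2 * t - g3 = 0" using wp'_squared[OF w(1)] w(2) by simp
    have kt: "c * t\<^sup>2 + e * t + g = 0" using kw \<open>wp' w = 0\<close> w(2) by (simp add: kf_def)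
    \<comment> \<open>By \<open>kt\<close>, \<open>t\<close> is a root of
      \<open>c * x\<^sup>2 + e * x + g\<close>; the other root is \<open>- b\<close>, and
      \<open>a\<close> rescales the coefficient of \<open>wp'\<close>.\<close>
    define a b where "a = 2 * d / c" and "b = e / c + t"
    have s: "d = a * c / 2" "e = (b - t) * c" using False by (simp_all add: a_def b_def)
    have gg: "g = - (b * t * c)" using kt unfolding s by algebra
    have cub: "(wp' z)\<^sup>2 = 4 * (wp z - t) * ((wp z)\<^sup>2 + t * wp z + t\<^sup>2 - g2 / 4)" if "z \<notin> L" for z
      unfolding wp'_squared[OF that] using root by algebra
    have kk: "?k z = c * ((wp z - t) * (wp z + b) + a / 2 * wp' z)" for z
      unfolding kf_def s gg by (simp add: field_simps power2_eq_square)
    \<comment> \<open>\<open>V\<close> is \<open>4 * K\<^sup>2 / (wp - t)\<close> with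
      \<open>K\<close> the bracket in \<open>kk\<close>, the factor \<open>wp - t\<close> being
      cancelled by means of \<open>cub\<close>. Equality with \<open>nf'\<close> holds first where
      \<open>wp\<close> differs from \<open>t\<close>, then everywhere by continuity.\<close>
    define V where "V = (\<lambda>z. 4 * (wp z - t) * (wp z + b)\<^sup>2 + 4 * a * (wp z + b) * wp' z +
       4 * a\<^sup>2 * ((wp z)\<^sup>2 + t * wp z + t\<^sup>2 - g2 / 4))"
    have uV: "nf' q z - V z = 0" if z: "z \<notin> L" for z
    proof (rule eq_0_continuation[OF _ z])
      show "(\<lambda>z. nf' q z - V z) holomorphic_on - L" unfolding V_def
        by (intro holomorphic_intros nf'_holo wp_holo wp'_holo)
      have "eventually (\<lambda>w. w \<notin> L \<and> wp w - t \<noteq> 0) (at z)"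
        by (rule LL_eventually_nonzero[OF LL_wp_minus]) (use z in auto)
      then show "eventually (\<lambda>w. nf' q w - V w = 0) (at z)"
      proof eventually_elim
        case (elim w)
        then have w: "w \<notin> L" "wp w - t \<noteq> 0" by auto
        let ?K = "(wp w - t) * (wp w + b) + a / 2 * wp' w"
        have "4 * ?K\<^sup>2 = 4 * ((wp w - t) * (wp w + b))\<^sup>2 + 4 * a * ((wp w - t) * (wp w + b)) * wp' w + a\<^sup>2 * (wp' w)\<^sup>2"
          by (simp add: field_simps power2_eq_square)
        also have "\<dots> = (wp w - t) * V w"
          unfolding cub[OF w(1)] V_def by (simp add: field_simps power2_eq_square)
        finally have V: "(wp w - t) * V w = 4 * ?K\<^sup>2" by (rule sym)
        have "c\<^sup>2 * ?K\<^sup>2 = nf' q w * (c\<^sup>2 / 4 * (wp w - t))"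
          using eq'[OF w(1)] unfolding kk l power_mult_distrib[of c] .
        then have "c\<^sup>2 * ((wp w - t) * nf' q w) = c\<^sup>2 * (4 * ?K\<^sup>2)" by (simp add: field_simps)
        then have "c\<^sup>2 * ((wp w - t) * nf' q w) = c\<^sup>2 * ((wp w - t) * V w)" unfolding V .
        then show ?case using w False by simp
      qed
    qed
    \<comment> \<open>Both coefficients of \<open>wp ^ 3\<close> are 4; the first conjunct fills the
      slot for their difference in \<open>monomials_indep\<close>.\<close>
    have "(4::complex) - 4 = 0 \<and> S - 4 * a = 0 \<and> P - 4 * (2 * b - t + a\<^sup>2) = 0 \<and> T - 4 * (a * b) = 0 \<and>
      - (3 / 5) * g2 - 4 * (b\<^sup>2 - 2 * b * t + a\<^sup>2 * t) = 0 \<and>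
      - (2 / 5) * g3 - P * g2 / 12 - 4 * (a\<^sup>2 * (t\<^sup>2 - g2 / 4) - t * b\<^sup>2) = 0"
    proof -
      have "(4 - 4) * wp z ^ 3 + (S - 4 * a) * (wp z * wp' z) + (P - 4 * (2 * b - t + a\<^sup>2)) * (wp z)\<^sup>2 +
        (T - 4 * (a * b)) * wp' z + (- (3 / 5) * g2 - 4 * (b\<^sup>2 - 2 * b * t + a\<^sup>2 * t)) * wp z +
        (- (2 / 5) * g3 - P * g2 / 12 - 4 * (a\<^sup>2 * (t\<^sup>2 - g2 / 4) - t * b\<^sup>2)) = nf' q z - V z" for z
        unfolding nf'_def q prod.case V_def by (simp add: field_simps power2_eq_square power3_eq_cube)
      then have "(4 - 4) * wp z ^ 3 + (S - 4 * a) * (wp z * wp' z) + (P - 4 * (2 * b - t + a\<^sup>2)) * (wp z)\<^sup>2 +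
        (T - 4 * (a * b)) * wp' z + (- (3 / 5) * g2 - 4 * (b\<^sup>2 - 2 * b * t + a\<^sup>2 * t)) * wp z +
        (- (2 / 5) * g3 - P * g2 / 12 - 4 * (a\<^sup>2 * (t\<^sup>2 - g2 / 4) - t * b\<^sup>2)) = 0" if "z \<notin> L" for z
        using uV[OF that] by (simp only:)
      then show ?thesis by (rule monomials_indep)
    qed
    then have "S = 4 * a" "P = 4 * (2 * b - t + a\<^sup>2)" "T = 4 * (a * b)"
      "4 * (b\<^sup>2 - 2 * b * t + a\<^sup>2 * t) = - (3 / 5) * g2"
      "4 * (a\<^sup>2 * (t\<^sup>2 - g2 / 4) - t * b\<^sup>2) = - (2 / 5) * g3 - P * g2 / 12" by auto
    then have "q \<in> solB" unfolding q solB_def using root by blast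
    then show ?thesis by simp
  qed
qed

section \<open>Solutions of the equations give covers\<close>

lemma wp_lift:
  assumes "y\<^sup>2 = 4 * x ^ 3 - g2 * x - g3" obtains z where "z \<notin> L" "wp z = x" "wp' z = y"
proof -
  obtain z where z: "z \<notin> L" "wp z = x" by (rule wp_surj)
  have "(wp' z)\<^sup>2 = y\<^sup>2" using wp'_squared[OF z(1)] z(2) assms by simp
  then have "wp' z = y \<or> wp' z = - y" by (simp add: power2_eq_iff)
  then show ?thesis
  proof
    assume "wp' z = - y"
    then show ?thesis using that[of "- z"] z by simp
  qed (use that z in blast)
qed

text \<open>\<open>wp\<close> is periodic, so distinct values of \<open>wp\<close> make the points
  inequivalent; whether triple points are distinct can then be decided by the discriminant of a
  cubic in \<open>x\<close>.\<close>

lemma goodI: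
  assumes "x1 \<noteq> x2" "x1 \<noteq> x3" "x2 \<noteq> x3"
    and "\<And>x. x \<in> {x1, x2, x3} \<Longrightarrow> \<exists>z. z \<notin> L \<and> wp z = x \<and> nf' q z = 0 \<and> (nf' q has_field_derivative 0) (at z)"
  shows "good q"
proof -
  obtain p1 p2 p3 where p: "p1 \<notin> L" "wp p1 = x1" "nf' q p1 = 0 \<and> (nf' q has_field_derivative 0) (at p1)"
    "p2 \<notin> L" "wp p2 = x2" "nf' q p2 = 0 \<and> (nf' q has_field_derivative 0) (at p2)"
    "p3 \<notin> L" "wp p3 = x3" "nf' q p3 = 0 \<and> (nf' q has_field_derivative 0) (at p3)"
    using assms(4) by (metis insertCI)
  have "p1 - p2 \<notin> L" "p1 - p3 \<notin> L" "p2 - p3 \<notin> L"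
    using p assms(1-3) periodic_cong[OF wp_periodic] by metis+
  then show ?thesis unfolding good_def using p by blast
qed

text \<open>Where \<open>wp' = - (a * wp + b)\<close> the square vanishes doubly. Inserting this
  into the Weierstrass equation gives the cubic for the \<open>x\<close>-coordinates, and
  \<open>wp_lift\<close> picks the point over a root with the right sign of
  \<open>wp'\<close>.\<close>

lemma solA_good:
  assumes ab: "a * b = g2 / 5" "b\<^sup>2 = 3 / 5 * g3 - a\<^sup>2 * g2 / 12"
    and x: "x1 \<noteq> x2" "x1 \<noteq> x3" "x2 \<noteq> x3"
      "\<And>x. x \<in> {x1, x2, x3} \<Longrightarrow> 4 * x ^ 3 - g2 * x - g3 - (a * x + b)\<^sup>2 = 0"
  shows "good (a\<^sup>2, 2 * a, 2 * b)"
proof (rule goodI[OF x(1-3)])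
  fix x assume "x \<in> {x1, x2, x3}"
  then have "(- (a * x + b))\<^sup>2 = 4 * x ^ 3 - g2 * x - g3" using x(4)[of x] unfolding power2_minus by simp
  then obtain z where z: "z \<notin> L" "wp z = x" "wp' z = - (a * x + b)" by (rule wp_lift)
  have u: "nf' (a\<^sup>2, 2 * a, 2 * b) w = (wp' w + a * wp w + b)\<^sup>2" if "w \<notin> L" for w
  proof -
    have "(wp' w + a * wp w + b)\<^sup>2 = (wp' w)\<^sup>2 + 2 * a * (wp w * wp' w) + 2 * b * wp' w
           + a\<^sup>2 * (wp w)\<^sup>2 + 2 * (a * b) * wp w + b\<^sup>2" by algebra
    then show ?thesis unfolding wp'_squared[OF that] ab nf'_def prod.case by (simp add: field_simps)
  qed
  have "((\<lambda>w. (wp' w + a * wp w + b)\<^sup>2) has_field_derivative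
     2 * (wp' z + a * wp z + b) * (6 * (wp z)\<^sup>2 - g2 / 2 + a * wp' z)) (at z)"
    by (rule derivative_eq_intros refl z | simp add: algebra_simps)+
  then have "((\<lambda>w. (wp' w + a * wp w + b)\<^sup>2) has_field_derivative 0) (at z)" using z by simp
  then have "(nf' (a\<^sup>2, 2 * a, 2 * b) has_field_derivative 0) (at z)"
    by (rule has_field_derivative_transform_within_open[OF _ open_compl_L]) (use z u in auto)
  moreover have "nf' (a\<^sup>2, 2 * a, 2 * b) z = 0" using u[OF z(1)] z by simp
  ultimately show "\<exists>z. z \<notin> L \<and> wp z = x \<and> nf' (a\<^sup>2, 2 * a, 2 * b) z = 0 \<and>
    (nf' (a\<^sup>2, 2 * a, 2 * b) has_field_derivative 0) (at z)" using z by blast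
qed

text \<open>\<open>k = 0\<close> prescribes \<open>wp' = - 2 * (x - e) * (x + b) / a\<close>;
  squaring, inserting the Weierstrass equation and cancelling \<open>x - e\<close> gives the cubic.
  As \<open>e\<close> is a simple root and \<open>a\<close> is nonzero, \<open>x = e\<close> does
  not solve it, so dividing \<open>k\<^sup>2\<close> by \<open>wp - e\<close> keeps the double
  zero.\<close>

lemma solB_good:
  assumes e: "4 * e ^ 3 - g2 * e - g3 = 0"
    and ab: "4 * (b\<^sup>2 - 2 * b * e + a\<^sup>2 * e) = - (3 / 5) * g2"
     "4 * (a\<^sup>2 * (e\<^sup>2 - g2 / 4) - e * b\<^sup>2) = - (2 / 5) * g3 - 4 * (2 * b - e + a\<^sup>2) * g2 / 12"
    and a: "a \<noteq> 0" and simple: "12 * e\<^sup>2 \<noteq> g2"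
    and x: "x1 \<noteq> x2" "x1 \<noteq> x3" "x2 \<noteq> x3"
      "\<And>x. x \<in> {x1, x2, x3} \<Longrightarrow> (x - e) * (x + b)\<^sup>2 - a\<^sup>2 * (x\<^sup>2 + e * x + e\<^sup>2 - g2 / 4) = 0"
  shows "good (4 * (2 * b - e + a\<^sup>2), 4 * a, 4 * (a * b))"
proof (rule goodI[OF x(1-3)])
  let ?q = "(4 * (2 * b - e + a\<^sup>2), 4 * a, 4 * (a * b))"
  let ?k = "\<lambda>w. (wp w - e) * (wp w + b) + a / 2 * wp' w"
  fix x assume "x \<in> {x1, x2, x3}"
  then have xe: "(x - e) * (x + b)\<^sup>2 - a\<^sup>2 * (x\<^sup>2 + e * x + e\<^sup>2 - g2 / 4) = 0" by (rule x(4))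
  have "x \<noteq> e"
  proof
    assume "x = e"
    then have "a\<^sup>2 * (12 * e\<^sup>2 - g2) = 0" using xe by (simp add: power2_eq_square)
    then show False using a simple by simp
  qed
  have "(- 2 * (x - e) * (x + b) / a)\<^sup>2 = 4 * x ^ 3 - g2 * x - g3"
  proof -
    have y: "4 * x ^ 3 - g2 * x - g3 = 4 * (x - e) * (x\<^sup>2 + e * x + e\<^sup>2 - g2 / 4)" using e by algebra
    have "a\<^sup>2 * (4 * x ^ 3 - g2 * x - g3) = 4 * (x - e) * (a\<^sup>2 * (x\<^sup>2 + e * x + e\<^sup>2 - g2 / 4))"
      unfolding y by (simp only: mult_ac)
    also have "a\<^sup>2 * (x\<^sup>2 + e * x + e\<^sup>2 - g2 / 4) = (x - e) * (x + b)\<^sup>2" using xe by simp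
    finally have "a\<^sup>2 * (4 * x ^ 3 - g2 * x - g3) = 4 * ((x - e) * (x + b))\<^sup>2"
      by (simp add: power_mult_distrib power2_eq_square)
    then have "4 * x ^ 3 - g2 * x - g3 = 4 * ((x - e) * (x + b))\<^sup>2 / a\<^sup>2" using a by (simp add: eq_divide_eq mult.commute)
    moreover have "(- 2 * (x - e) * (x + b) / a)\<^sup>2 = 4 * ((x - e) * (x + b))\<^sup>2 / a\<^sup>2"
      unfolding power_divide by (simp only: power_mult_distrib mult.assoc) simp
    ultimately show ?thesis by simp
  qed
  then obtain z where z: "z \<notin> L" "wp z = x" "wp' z = - 2 * (x - e) * (x + b) / a" by (rule wp_lift)
  have kz: "?k z = 0" using z a by (simp add: field_simps)
  have u: "nf' ?q w * (wp w - e) = 4 * (?k w)\<^sup>2" if "w \<notin> L" for w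
  proof -
    have Y: "(wp' w)\<^sup>2 = 4 * (wp w - e) * ((wp w)\<^sup>2 + e * wp w + e\<^sup>2 - g2 / 4)"
      unfolding wp'_squared[OF that] using e by algebra
    have k: "4 * (?k w)\<^sup>2 = 4 * ((wp w - e) * (wp w + b))\<^sup>2 + 4 * a * ((wp w - e) * (wp w + b)) * wp' w + a\<^sup>2 * (wp' w)\<^sup>2"
      by (simp add: field_simps power2_eq_square)
    show ?thesis unfolding k Y nf'_def prod.case ab[symmetric]
      by (simp add: field_simps power2_eq_square power3_eq_cube)
  qed
  have ue: "nf' ?q w = 4 * (?k w)\<^sup>2 / (wp w - e)" if "w \<notin> L" "wp w \<noteq> e" for w
    using u[OF that(1)] that(2) by (simp add: field_simps)
  have "((\<lambda>w. 4 * (?k w)\<^sup>2 / (wp w - e)) has_field_derivative 0) (at z)"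
  proof -
    have "((\<lambda>w. ?k w) has_field_derivative (wp' z * (wp z + b) + (wp z - e) * wp' z + a / 2 * (6 * (wp z)\<^sup>2 - g2 / 2))) (at z)"
      by (rule derivative_eq_intros refl z | simp add: mult.commute)+
    then obtain D where D: "(?k has_field_derivative D) (at z)" by blast
    have "((\<lambda>w. 4 * (?k w)\<^sup>2) has_field_derivative 4 * (2 * ?k z * D)) (at z)"
      by (rule derivative_eq_intros D refl | simp)+
    then have D4: "((\<lambda>w. 4 * (?k w)\<^sup>2) has_field_derivative 0) (at z)" unfolding kz by simp
    have De: "((\<lambda>w. wp w - e) has_field_derivative wp' z) (at z)"
      by (rule derivative_eq_intros refl z | simp)+
    have ne: "wp z - e \<noteq> 0" using z \<open>x \<noteq> e\<close> by simp
    from DERIV_divide[OF D4 De ne] show ?thesis using kz by simp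
  qed
  moreover have "open (- L \<inter> {w. wp w \<noteq> e})"
  proof -
    have "continuous_on (- L) wp" by (intro holomorphic_on_imp_continuous_on wp_holo)
    then have "open (- L \<inter> wp -` (- {e}))" by (intro continuous_open_preimage) auto
    moreover have "- L \<inter> wp -` (- {e}) = - L \<inter> {w. wp w \<noteq> e}" by auto
    ultimately show ?thesis by (simp only:)
  qed
  ultimately have "(nf' ?q has_field_derivative 0) (at z)"
    by (rule has_field_derivative_transform_within_open) (use z \<open>x \<noteq> e\<close> ue in auto)
  moreover have "nf' ?q z = 0" using u[OF z(1)] kz z \<open>x \<noteq> e\<close> by simp
  ultimately show "\<exists>z. z \<notin> L \<and> wp z = x \<and> nf' ?q z = 0 \<and> (nf' ?q has_field_derivative 0) (at z)" using z by blast
qed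

end

section \<open>Counting the solutions\<close>

lemma biquadratic_card:
  fixes \<alpha> \<beta> \<gamma> :: complex
  assumes "\<alpha> \<noteq> 0" "\<gamma> \<noteq> 0" "\<beta>\<^sup>2 \<noteq> 4 * \<alpha> * \<gamma>"
  shows "card {a. \<alpha> * a ^ 4 + \<beta> * a\<^sup>2 + \<gamma> = 0} = 4"
proof -
  define s where "s = csqrt (\<beta>\<^sup>2 - 4 * \<alpha> * \<gamma>)"
  have s2: "s\<^sup>2 = \<beta>\<^sup>2 - 4 * \<alpha> * \<gamma>" by (simp add: s_def)
  have s0: "s \<noteq> 0" using assms(3) s2 by auto
  define A1 A2 where "A1 = (- \<beta> + s) / (2 * \<alpha>)" and "A2 = (- \<beta> - s) / (2 * \<alpha>)"
  have ne: "A1 \<noteq> A2" using s0 assms(1) by (simp add: A1_def A2_def field_simps)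
  have sp: "A1 + A2 = - \<beta> / \<alpha>" "A1 * A2 = \<gamma> / \<alpha>"
  proof -
    show "A1 + A2 = - \<beta> / \<alpha>" using assms(1) by (simp add: A1_def A2_def field_simps)
    have "A1 * A2 = (\<beta>\<^sup>2 - s\<^sup>2) / (4 * \<alpha>\<^sup>2)"
      using assms(1) by (simp add: A1_def A2_def field_simps power2_eq_square)
    also have "\<dots> = \<gamma> / \<alpha>" unfolding s2 using assms(1) by (simp add: power2_eq_square)
    finally show "A1 * A2 = \<gamma> / \<alpha>" .
  qed
  have nz: "A1 \<noteq> 0" "A2 \<noteq> 0" using sp(2) assms by auto
  have fac: "\<alpha> * a ^ 4 + \<beta> * a\<^sup>2 + \<gamma> = \<alpha> * (a\<^sup>2 - A1) * (a\<^sup>2 - A2)" for a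
  proof -
    have "\<alpha> * (a\<^sup>2 - A1) * (a\<^sup>2 - A2) = \<alpha> * a ^ 4 - \<alpha> * (A1 + A2) * a\<^sup>2 + \<alpha> * (A1 * A2)"
      by (simp add: algebra_simps power2_eq_square power4_eq_xxxx)
    then show ?thesis using assms(1) by (simp add: sp)
  qed
  define r1 r2 where "r1 = csqrt A1" and "r2 = csqrt A2"
  have r: "A1 = r1\<^sup>2" "A2 = r2\<^sup>2" by (simp_all add: r1_def r2_def)
  have "{a. \<alpha> * a ^ 4 + \<beta> * a\<^sup>2 + \<gamma> = 0} = {r1, - r1, r2, - r2}"
    unfolding fac r using assms(1) by (auto simp: power2_eq_iff)
  moreover have "card {r1, - r1, r2, - r2} = 4"
  proof -
    have "r1 \<noteq> 0" "r2 \<noteq> 0" using nz r by auto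
    moreover have "r1 \<noteq> r2" "r1 \<noteq> - r2" using ne r by auto
    moreover have "x \<noteq> 0 \<Longrightarrow> x \<noteq> - x" for x :: complex by (auto simp: complex_eq_iff)
    ultimately show ?thesis by (auto simp: card_insert_if equation_minus_iff)
  qed
  ultimately show ?thesis by simp
qed

text \<open>The expression in \<open>disc\<close> is \<open>c ^ 4\<close> times the squared product
  of the root differences.\<close>

lemma cubic_distinct_roots:
  fixes c p q r :: complex
  assumes c: "c \<noteq> 0" and disc: "p\<^sup>2 * q\<^sup>2 - 4 * c * q ^ 3 - 4 * p ^ 3 * r - 27 * c\<^sup>2 * r\<^sup>2 + 18 * c * p * q * r \<noteq> 0"
  obtains x1 x2 x3 where "x1 \<noteq> x2" "x1 \<noteq> x3" "x2 \<noteq> x3"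
    "\<And>x. x \<in> {x1, x2, x3} \<Longrightarrow> c * x ^ 3 + p * x\<^sup>2 + q * x + r = 0"
proof -
  have "\<not> constant (poly [:r, q, p, c:])" using c by (simp add: constant_degree)
  then obtain x1 where "poly [:r, q, p, c:] x1 = 0" using fundamental_theorem_of_algebra by blast
  then have x1: "r = - (c * x1 ^ 3 + p * x1\<^sup>2 + q * x1)"
    by (simp add: algebra_simps power2_eq_square power3_eq_cube eq_neg_iff_add_eq_0)
  \<comment> \<open>Division by \<open>x - x1\<close>: the remaining factor is
    \<open>c * x\<^sup>2 + u * x + v\<close>.\<close>
  define u v where "u = p + c * x1" and "v = q + x1 * u"
  have pq: "p = u - c * x1" "q = v - x1 * u" by (simp_all add: u_def v_def)
  define s where "s = csqrt (u\<^sup>2 - 4 * c * v)"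
  have s2: "s\<^sup>2 = u\<^sup>2 - 4 * c * v" by (simp add: s_def)
  define x2 x3 where "x2 = (- u + s) / (2 * c)" and "x3 = (- u - s) / (2 * c)"
  have sp: "u = - c * (x2 + x3)" "v = c * (x2 * x3)"
  proof -
    show "u = - c * (x2 + x3)" using c by (simp add: x2_def x3_def field_simps)
    have "c * (x2 * x3) = (u\<^sup>2 - s\<^sup>2) / (4 * c)"
      using c by (simp add: x2_def x3_def field_simps power2_eq_square)
    then show "v = c * (x2 * x3)" using c by (simp add: s2)
  qed
  have co: "p = - c * (x1 + x2 + x3)" "q = c * (x1 * x2 + x1 * x3 + x2 * x3)"
    unfolding pq sp by (simp_all add: algebra_simps)
  have ro: "r = - c * (x1 * x2 * x3)"
    unfolding x1 co by (simp add: algebra_simps power2_eq_square power3_eq_cube)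
  have "p\<^sup>2 * q\<^sup>2 - 4 * c * q ^ 3 - 4 * p ^ 3 * r - 27 * c\<^sup>2 * r\<^sup>2 + 18 * c * p * q * r
      = c ^ 4 * ((x1 - x2) * (x1 - x3) * (x2 - x3))\<^sup>2" unfolding co ro by algebra
  then have "x1 \<noteq> x2" "x1 \<noteq> x3" "x2 \<noteq> x3" using disc by auto
  moreover have "c * x ^ 3 + p * x\<^sup>2 + q * x + r = c * (x - x1) * (x - x2) * (x - x3)" for x
    unfolding co ro by algebra
  then have "\<And>x. x \<in> {x1, x2, x3} \<Longrightarrow> c * x ^ 3 + p * x\<^sup>2 + q * x + r = 0" by auto
  ultimately show ?thesis using that by blast
qed

context period_lattice
begin

text \<open>At a root the modular discriminant factors as
  \<open>(g2 - 12 * e\<^sup>2)\<^sup>2 * (g2 - 3 * e\<^sup>2)\<close>. The first factor vanishes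
  when \<open>e\<close> is a multiple root, the second when the other two roots coincide.\<close>

lemma root_nondegenerate:
  assumes "4 * e ^ 3 - g2 * e - g3 = 0" shows "12 * e\<^sup>2 \<noteq> g2" "3 * e\<^sup>2 \<noteq> g2"
proof -
  have g3: "g3 = 4 * e ^ 3 - g2 * e" using assms by simp
  have "g2 ^ 3 - 27 * g3\<^sup>2 = (g2 - 12 * e\<^sup>2)\<^sup>2 * (g2 - 3 * e\<^sup>2)" unfolding g3 by algebra
  then show "12 * e\<^sup>2 \<noteq> g2" "3 * e\<^sup>2 \<noteq> g2" using discriminant_nonzero by auto
qed

text \<open>\<open>A\<close> stands for \<open>a\<^sup>2\<close> and enters both equations linearly.
  Eliminating it leaves the quadratic for \<open>b\<close> times a multiple of
  \<open>12 * e\<^sup>2 - g2\<close>, which is nonzero; the relation for \<open>A\<close> is then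
  recovered from whichever of \<open>e\<close> and \<open>e\<^sup>2 - g2 / 6\<close> does not
  vanish.\<close>

lemma solB_simplify:
  assumes e: "4 * e ^ 3 - g2 * e - g3 = 0"
  shows "(4 * (b\<^sup>2 - 2 * b * e + A * e) = - (3 / 5) * g2 \<and>
     4 * (A * (e\<^sup>2 - g2 / 4) - e * b\<^sup>2) = - (2 / 5) * g3 - 4 * (2 * b - e + A) * g2 / 12) \<longleftrightarrow>
     (b = A + e / 5 \<and> b\<^sup>2 - b * e + (3 * g2 - 4 * e\<^sup>2) / 20 = 0)" (is "?I \<and> ?II \<longleftrightarrow> ?X \<and> ?III")
proof -
  define i where "i = b\<^sup>2 - 2 * b * e + A * e + 3 * g2 / 20"
  define ii where "ii = A * (e\<^sup>2 - g2 / 6) - e * b\<^sup>2 + b * g2 / 6 + 2 * e ^ 3 / 5 - 11 * e * g2 / 60"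
  define iii where "iii = b\<^sup>2 - b * e + (3 * g2 - 4 * e\<^sup>2) / 20"
  define x where "x = A - b + e / 5"
  have I: "?I \<longleftrightarrow> i = 0" unfolding i_def by (auto simp: field_simps)
  have g3: "g3 = 4 * e ^ 3 - g2 * e" using e by simp
  have "4 * (A * (e\<^sup>2 - g2 / 4) - e * b\<^sup>2) - (- (2 / 5) * g3 - 4 * (2 * b - e + A) * g2 / 12) = 4 * ii"
    unfolding ii_def g3 by (simp add: field_simps)
  then have II: "?II \<longleftrightarrow> ii = 0" by (metis eq_iff_diff_eq_0 mult_eq_0_iff zero_neq_numeral)
  have r1: "(e\<^sup>2 - g2 / 6) * i - e * ii = (12 * e\<^sup>2 - g2) / 6 * iii"
    unfolding i_def ii_def iii_def by (simp add: field_simps power2_eq_square power3_eq_cube)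
  have r2: "i - iii = e * x" unfolding i_def iii_def x_def by (simp add: field_simps power2_eq_square)
  have r3: "ii + e * iii = (e\<^sup>2 - g2 / 6) * x"
    unfolding ii_def iii_def x_def by (simp add: field_simps power2_eq_square power3_eq_cube)
  have "i = 0 \<and> ii = 0 \<longleftrightarrow> x = 0 \<and> iii = 0"
  proof
    assume "i = 0 \<and> ii = 0"
    then have "iii = 0" using r1 root_nondegenerate(1)[OF e] by simp
    moreover have "x = 0"
    proof (cases "e = 0")
      case True
      then show ?thesis using r3 \<open>i = 0 \<and> ii = 0\<close> \<open>iii = 0\<close> root_nondegenerate(1)[OF e] by simp
    next
      case False
      then show ?thesis using r2 \<open>i = 0 \<and> ii = 0\<close> \<open>iii = 0\<close> by simp
    qed
    ultimately show "x = 0 \<and> iii = 0" by simp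
  next
    assume "x = 0 \<and> iii = 0"
    then show "i = 0 \<and> ii = 0" using r2 r3 by simp
  qed
  moreover have "?X \<longleftrightarrow> x = 0" unfolding x_def by (auto simp: algebra_simps)
  ultimately show ?thesis using I II iii_def by simp
qed

text \<open>With \<open>g2\<close> nonzero the product \<open>a * b\<close> is nonzero, so
  \<open>b\<close> can be eliminated; multiplying the second equation by \<open>a\<^sup>2\<close>
  makes it biquadratic.\<close>

lemma solA_eq:
  assumes "g2 \<noteq> 0"
  shows "solA = (\<lambda>a. (a\<^sup>2, 2 * a, 2 * (g2 / (5 * a)))) ` {a. g2 / 12 * a ^ 4 + (- (3 / 5) * g3) * a\<^sup>2 + g2\<^sup>2 / 25 = 0}"
proof -
  have eq: "a * b = g2 / 5 \<and> b\<^sup>2 = 3 / 5 * g3 - a\<^sup>2 * g2 / 12 \<longleftrightarrow>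
    a \<noteq> 0 \<and> b = g2 / (5 * a) \<and> g2 / 12 * a ^ 4 + (- (3 / 5) * g3) * a\<^sup>2 + g2\<^sup>2 / 25 = 0" for a b
  proof (cases "a = 0")
    case True then show ?thesis using assms by auto
  next
    case False
    have 1: "a * b = g2 / 5 \<longleftrightarrow> b = g2 / (5 * a)" using False by (auto simp: field_simps)
    have 2: "b\<^sup>2 = 3 / 5 * g3 - a\<^sup>2 * g2 / 12 \<longleftrightarrow> g2 / 12 * a ^ 4 + (- (3 / 5) * g3) * a\<^sup>2 + g2\<^sup>2 / 25 = 0" if b: "b = g2 / (5 * a)"
    proof -
      have "g2 / 12 * a ^ 4 + (- (3 / 5) * g3) * a\<^sup>2 + g2\<^sup>2 / 25 = a\<^sup>2 * (b\<^sup>2 - (3 / 5 * g3 - a\<^sup>2 * g2 / 12))"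
        using False by (simp add: b field_simps power2_eq_square power4_eq_xxxx)
      then show ?thesis using False by simp
    qed
    show ?thesis using 1 2 False by blast
  qed
  have nz: "g2 / 12 * a ^ 4 + (- (3 / 5) * g3) * a\<^sup>2 + g2\<^sup>2 / 25 = 0 \<Longrightarrow> a \<noteq> 0" for a using assms by auto
  show ?thesis unfolding solA_def eq using nz by blast
qed

text \<open>As a quadratic in \<open>a\<^sup>2\<close> the equation has discriminant
  \<open>(27 * g3\<^sup>2 - g2 ^ 3) / 75\<close>, nonzero for every lattice.\<close>

lemma card_solA:
  assumes "g2 \<noteq> 0" shows "card solA = 4"
proof -
  have "card {a. g2 / 12 * a ^ 4 + (- (3 / 5) * g3) * a\<^sup>2 + g2\<^sup>2 / 25 = 0} = 4"
  proof (rule biquadratic_card)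
    have "(- (3 / 5) * g3)\<^sup>2 - 4 * (g2 / 12) * (g2\<^sup>2 / 25) = (27 * g3\<^sup>2 - g2 ^ 3) / 75"
      by (simp add: field_simps power2_eq_square power3_eq_cube)
    then show "(- (3 / 5) * g3)\<^sup>2 \<noteq> 4 * (g2 / 12) * (g2\<^sup>2 / 25)" using discriminant_nonzero by auto
  qed (use assms in auto)
  moreover have "inj_on (\<lambda>a. (a\<^sup>2, 2 * a, 2 * (g2 / (5 * a)))) X" for X by (auto simp: inj_on_def)
  ultimately show ?thesis unfolding solA_eq[OF assms] by (simp add: card_image)
qed

text \<open>What remains for \<open>a\<close> after \<open>b = a\<^sup>2 + e / 5\<close> is inserted
  into the quadratic for \<open>b\<close>; the factor 1 matches
  \<open>biquadratic_card\<close>.\<close>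

definition quartic :: "complex \<Rightarrow> complex set" where
  "quartic e = {a. 1 * a ^ 4 + (- 3 * e / 5) * a\<^sup>2 + (15 * g2 - 36 * e\<^sup>2) / 100 = 0}"

lemma quartic_iff: "a \<in> quartic e \<longleftrightarrow> (a\<^sup>2 + e / 5)\<^sup>2 - (a\<^sup>2 + e / 5) * e + (3 * g2 - 4 * e\<^sup>2) / 20 = 0"
proof -
  have "(a\<^sup>2 + e / 5)\<^sup>2 - (a\<^sup>2 + e / 5) * e + (3 * g2 - 4 * e\<^sup>2) / 20 =
     1 * a ^ 4 + (- 3 * e / 5) * a\<^sup>2 + (15 * g2 - 36 * e\<^sup>2) / 100"
    by (simp add: field_simps power2_eq_square power4_eq_xxxx)
  then show ?thesis by (simp add: quartic_def)
qed

lemma solB_eq: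
  "solB = (\<lambda>(e, a). (4 * (2 * (a\<^sup>2 + e / 5) - e + a\<^sup>2), 4 * a, 4 * (a * (a\<^sup>2 + e / 5)))) `
     Sigma {e. 4 * e ^ 3 - g2 * e - g3 = 0} quartic"
proof -
  have "solB = {(4 * (2 * b - e + a\<^sup>2), 4 * a, 4 * (a * b)) |e a b. 4 * e ^ 3 - g2 * e - g3 = 0 \<and>
      b = a\<^sup>2 + e / 5 \<and> b\<^sup>2 - b * e + (3 * g2 - 4 * e\<^sup>2) / 20 = 0}"
    unfolding solB_def using solB_simplify by blast
  also have "\<dots> = {(4 * (2 * (a\<^sup>2 + e / 5) - e + a\<^sup>2), 4 * a, 4 * (a * (a\<^sup>2 + e / 5))) |e a.
      4 * e ^ 3 - g2 * e - g3 = 0 \<and> a \<in> quartic e}"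
    unfolding quartic_iff by blast
  also have "\<dots> = (\<lambda>(e, a). (4 * (2 * (a\<^sup>2 + e / 5) - e + a\<^sup>2), 4 * a, 4 * (a * (a\<^sup>2 + e / 5)))) `
     Sigma {e. 4 * e ^ 3 - g2 * e - g3 = 0} quartic"
    by (auto simp: image_iff)
  finally show ?thesis .
qed

section \<open>Exceptional moduli and collisions of triple points\<close>

text \<open>In this order the excluded moduli are: the first family has only two members, \<open>a = 0\<close> occurs in
  the second one, and two triple points collide in the first or in the second one.\<close>
definition generic :: bool where
  "generic \<longleftrightarrow> g2 \<noteq> 0 \<and> 5 * g2 ^ 3 \<noteq> 27 * g3\<^sup>2 \<and> 6241 * g2 ^ 3 \<noteq> - 8640 * g3\<^sup>2 \<and>
     449446805 * g2 ^ 3 \<noteq> 525557943 * g3\<^sup>2"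

text \<open>The constant term of the quartic vanishes iff \<open>a = 0\<close> is a solution.
  Together with the equation for \<open>e\<close> this fixes the ratio of \<open>g2 ^ 3\<close> and
  \<open>g3\<^sup>2\<close>, the origin of the constants 5 and 27.\<close>

lemma quartic_nonzero:
  assumes "generic" "4 * e ^ 3 - g2 * e - g3 = 0" shows "15 * g2 - 36 * e\<^sup>2 \<noteq> 0"
proof
  assume "15 * g2 - 36 * e\<^sup>2 = 0"
  then have g2: "g2 = 12 / 5 * e\<^sup>2" by (simp add: field_simps)
  have "g3 = 4 * e ^ 3 - g2 * e" using assms(2) by simp
  then have g3: "g3 = 8 / 5 * e ^ 3" unfolding g2 by (simp add: field_simps power2_eq_square power3_eq_cube)
  have "5 * g2 ^ 3 = 27 * g3\<^sup>2" unfolding g2 g3 by (simp add: field_simps power2_eq_square power3_eq_cube)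
  then show False using assms(1) by (simp add: generic_def)
qed

lemma card_roots: "card {e. 4 * e ^ 3 - g2 * e - g3 = 0} = 3"
proof -
  obtain e1 e2 e3 where e: "e1 \<noteq> e2" "e1 \<noteq> e3" "e2 \<noteq> e3" "e1 + e2 + e3 = 0"
    "g2 = - 4 * (e1 * e2 + e1 * e3 + e2 * e3)" "g3 = 4 * e1 * e2 * e3" by (rule roots_exist)
  have e3: "e3 = - e1 - e2" using e(4) by algebra
  have "4 * x ^ 3 - g2 * x - g3 = 4 * ((x - e1) * (x - e2) * (x - e3))" for x
    unfolding e(5,6) e3 by algebra
  then have "{e. 4 * e ^ 3 - g2 * e - g3 = 0} = {e1, e2, e3}" by auto
  then show ?thesis using e(1-3) by simp
qed

text \<open>Three roots \<open>e\<close> with four values of \<open>a\<close> each: as a quadratic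
  in \<open>a\<^sup>2\<close> the quartic has discriminant
  \<open>3 / 5 * (3 * e\<^sup>2 - g2)\<close>. Nothing is counted twice, as the second entry of the
  triple returns \<open>a\<close> and the first one then \<open>e\<close>.\<close>

lemma card_solB:
  assumes generic shows "card solB = 12" "finite solB"
proof -
  let ?E = "{e. 4 * e ^ 3 - g2 * e - g3 = 0}"
  have q4: "card (quartic e) = 4" if "e \<in> ?E" for e
    unfolding quartic_def
  proof (rule biquadratic_card)
    show "(15 * g2 - 36 * e\<^sup>2) / 100 \<noteq> 0" using quartic_nonzero[OF assms] that by simp
    have "(- 3 * e / 5)\<^sup>2 - 4 * 1 * ((15 * g2 - 36 * e\<^sup>2) / 100) = 3 / 5 * (3 * e\<^sup>2 - g2)"
      by (simp add: field_simps power2_eq_square)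
    moreover have "3 / 5 * (3 * e\<^sup>2 - g2) \<noteq> 0" using root_nondegenerate(2) that by simp
    ultimately show "(- 3 * e / 5)\<^sup>2 \<noteq> 4 * 1 * ((15 * g2 - 36 * e\<^sup>2) / 100)"
      by (metis right_minus_eq)
  qed simp
  have fE: "finite ?E" using card_roots by (metis card.infinite zero_neq_numeral)
  have fq: "finite (quartic e)" if "e \<in> ?E" for e using q4[OF that] by (metis card.infinite zero_neq_numeral)
  have "card (Sigma ?E quartic) = (\<Sum>e\<in>?E. card (quartic e))"
    using fE fq by (intro card_SigmaI) auto
  also have "\<dots> = (\<Sum>e\<in>?E. 4)" using q4 by (intro sum.cong) auto
  also have "\<dots> = 12" using card_roots by simp
  finally have c12: "card (Sigma ?E quartic) = 12" .
  have "inj_on (\<lambda>(e, a). (4 * (2 * (a\<^sup>2 + e / 5) - e + a\<^sup>2), 4 * a, 4 * (a * (a\<^sup>2 + e / 5)))) (Sigma ?E quartic)"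
  proof (rule inj_onI, clarify)
    fix e a e' a' assume *: "4 * e ^ 3 - g2 * e - g3 = 0" "a \<in> quartic e"
      and eq: "4 * (2 * (a\<^sup>2 + e / 5) - e + a\<^sup>2) = 4 * (2 * (a'\<^sup>2 + e' / 5) - e' + a'\<^sup>2)" "4 * a = 4 * a'"
    have "a = a'" using eq by simp
    then show "e = e' \<and> a = a'" using eq(1) by (simp add: field_simps)
  qed
  then show "card solB = 12" unfolding solB_eq using c12 by (simp add: card_image)
  show "finite solB" using \<open>card solB = 12\<close> by (metis card.infinite zero_neq_numeral)
qed

text \<open>A common member has \<open>a = 2 * a'\<close> by the second entries and then
  \<open>e = 2 * b'\<close> by the first; the quadratic for \<open>b'\<close> becomes
  \<open>g2 = 3 * e\<^sup>2\<close>, which makes the curve singular.\<close>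

lemma solA_solB_disjoint:
  assumes generic shows "solA \<inter> solB = {}"
proof -
  have False if A: "a * b = g2 / 5" "b\<^sup>2 = 3 / 5 * g3 - a\<^sup>2 * g2 / 12"
    and B: "4 * e ^ 3 - g2 * e - g3 = 0" "b' = a'\<^sup>2 + e / 5" "b'\<^sup>2 - b' * e + (3 * g2 - 4 * e\<^sup>2) / 20 = 0"
    and eq: "(a\<^sup>2, 2 * a, 2 * b) = (4 * (2 * b' - e + a'\<^sup>2), 4 * a', 4 * (a' * b'))" for a b e a' b'
  proof -
    have a: "a = 2 * a'" and "a\<^sup>2 = 4 * (2 * b' - e + a'\<^sup>2)" using eq by auto
    then have e: "e = 2 * b'" by (simp add: power_mult_distrib)
    have "3 * g2 = 36 * b'\<^sup>2" using B(3) unfolding e by (simp add: field_simps power2_eq_square)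
    then have "g2 = 3 * e\<^sup>2" unfolding e by (simp add: power_mult_distrib)
    then show False using root_nondegenerate(2)[OF B(1)] by simp
  qed
  moreover have "solB = {(4 * (2 * b - e + a\<^sup>2), 4 * a, 4 * (a * b)) |e a b. 4 * e ^ 3 - g2 * e - g3 = 0 \<and>
      b = a\<^sup>2 + e / 5 \<and> b\<^sup>2 - b * e + (3 * g2 - 4 * e\<^sup>2) / 20 = 0}"
    unfolding solB_def using solB_simplify by blast
  ultimately show ?thesis unfolding solA_def by blast
qed

text \<open>In the parameters \<open>A = a\<^sup>2\<close> and \<open>G = g2 / A\<close> both
  \<open>b\<^sup>2\<close> and \<open>g3\<close> are polynomials, and the discriminant of the cubic
  for the triple points factors completely.\<close>

lemma solA_distinct:
  assumes gen: generic and ab: "a * b = g2 / 5" "b\<^sup>2 = 3 / 5 * g3 - a\<^sup>2 * g2 / 12"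
  shows "good (a\<^sup>2, 2 * a, 2 * b)"
proof -
  have g20: "g2 \<noteq> 0" using gen by (simp add: generic_def)
  then have a0: "a \<noteq> 0" using ab(1) by auto
  define A where "A = a\<^sup>2"
  define G where "G = g2 / A"
  have A0: "A \<noteq> 0" using a0 by (simp add: A_def)
  have g2: "g2 = A * G" using A0 by (simp add: G_def)
  have b: "b\<^sup>2 = A * G\<^sup>2 / 25"
  proof -
    have "A * b\<^sup>2 = A * (A * G\<^sup>2 / 25)"
      using arg_cong[OF ab(1), of "\<lambda>x. x\<^sup>2"] unfolding g2 by (simp add: A_def power_mult_distrib field_simps)
    then show ?thesis using A0 by simp
  qed
  have g3: "g3 = A * G\<^sup>2 / 15 + 5 * A\<^sup>2 * G / 36"
    using ab(2) unfolding b A_def[symmetric] g2 by (simp add: field_simps power2_eq_square)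
  \<comment> \<open>The cubic \<open>4 * x ^ 3 - g2 * x - g3 - (a * x + b)\<^sup>2\<close> has
    linear coefficient \<open>- g2 - 2 * a * b\<close>, where \<open>a * b = g2 / 5\<close>, and
    constant coefficient \<open>- g3 - b\<^sup>2\<close>.\<close>
  define q where "q = - (7 / 5) * (A * G)"
  define r where "r = - (A * G\<^sup>2 / 15 + 5 * A\<^sup>2 * G / 36) - A * G\<^sup>2 / 25"
  have "(- A)\<^sup>2 * q\<^sup>2 - 4 * 4 * q ^ 3 - 4 * (- A) ^ 3 * r - 27 * 4\<^sup>2 * r\<^sup>2 + 18 * 4 * (- A) * q * r =
     - (1 / 5625) * (A\<^sup>2 * G * (12 * G - 25 * A)\<^sup>2 * (192 * G + 5 * A))"
    unfolding q_def r_def by (simp add: field_simps power2_eq_square power3_eq_cube)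
  moreover have "G \<noteq> 0" using g20 g2 by auto
  \<comment> \<open>This factor belongs to a singular curve, the next one to a genuine collision;
    inserting \<open>A = - (192 / 5) * G\<close> into \<open>g2\<close> and \<open>g3\<close> yields
    the constants 6241 and 8640.\<close>
  moreover have "12 * G - 25 * A \<noteq> 0"
  proof
    assume "12 * G - 25 * A = 0"
    then have G: "G = 25 / 12 * A" by (simp add: field_simps)
    have "g2 ^ 3 = 27 * g3\<^sup>2" unfolding g2 g3 G by (simp add: field_simps power2_eq_square power3_eq_cube)
    then show False using discriminant_nonzero by simp
  qed
  moreover have "192 * G + 5 * A \<noteq> 0"
  proof
    assume "192 * G + 5 * A = 0"
    then have A: "A = - (192 / 5) * G" by (simp add: field_simps add_eq_0_iff)
    have "6241 * g2 ^ 3 = - 8640 * g3\<^sup>2" unfolding g2 g3 A by (simp add: field_simps power2_eq_square power3_eq_cube)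
    then show False using gen by (simp add: generic_def)
  qed
  ultimately have "(- A)\<^sup>2 * q\<^sup>2 - 4 * 4 * q ^ 3 - 4 * (- A) ^ 3 * r - 27 * 4\<^sup>2 * r\<^sup>2 + 18 * 4 * (- A) * q * r \<noteq> 0"
    using A0 by simp
  then obtain x1 x2 x3 where x: "x1 \<noteq> x2" "x1 \<noteq> x3" "x2 \<noteq> x3"
    "\<And>x. x \<in> {x1, x2, x3} \<Longrightarrow> 4 * x ^ 3 + (- A) * x\<^sup>2 + q * x + r = 0"
    using cubic_distinct_roots[of 4 "- A" q r] by auto
  have conv: "4 * x ^ 3 - g2 * x - g3 - (a * x + b)\<^sup>2 = 4 * x ^ 3 + (- A) * x\<^sup>2 + q * x + r" for x
  proof -
    have "(a * x + b)\<^sup>2 = A * x\<^sup>2 + 2 * (a * b) * x + b\<^sup>2"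
      by (simp add: A_def power2_eq_square algebra_simps)
    then have sq: "(a * x + b)\<^sup>2 = A * x\<^sup>2 + 2 * (g2 / 5) * x + A * G\<^sup>2 / 25" unfolding ab(1) b .
    show ?thesis unfolding sq q_def r_def g3 unfolding g2 by (simp add: field_simps)
  qed
  show ?thesis
  proof (rule solA_good[OF ab x(1-3)])
    fix x assume "x \<in> {x1, x2, x3}"
    then show "4 * x ^ 3 - g2 * x - g3 - (a * x + b)\<^sup>2 = 0" unfolding conv by (rule x(4))
  qed
qed

text \<open>With \<open>g2\<close> and \<open>A\<close> expressed in \<open>b\<close> and
  \<open>e\<close> the discriminant of the cubic splits into four distinct factors. Two belong to
  singular curves, \<open>5 * b - e\<close> is \<open>5 * a\<^sup>2\<close>, and
  \<open>95 * b - 7 * e\<close> is the collision excluded by \<open>generic\<close>.\<close>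

lemma solB_distinct:
  assumes gen: generic and e: "4 * e ^ 3 - g2 * e - g3 = 0"
    and ab: "4 * (b\<^sup>2 - 2 * b * e + a\<^sup>2 * e) = - (3 / 5) * g2"
     "4 * (a\<^sup>2 * (e\<^sup>2 - g2 / 4) - e * b\<^sup>2) = - (2 / 5) * g3 - 4 * (2 * b - e + a\<^sup>2) * g2 / 12"
  shows "good (4 * (2 * b - e + a\<^sup>2), 4 * a, 4 * (a * b))"
proof -
  have s: "b = a\<^sup>2 + e / 5" "b\<^sup>2 - b * e + (3 * g2 - 4 * e\<^sup>2) / 20 = 0"
    using ab solB_simplify[OF e, of b "a\<^sup>2"] by blast+
  define A where "A = a\<^sup>2"
  have A: "A = b - e / 5" using s(1) by (simp add: A_def)
  have g2: "g2 = (4 * e\<^sup>2 - 20 * b * (b - e)) / 3" using s(2) by (simp add: field_simps power2_eq_square)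
  have g3: "g3 = 4 * e ^ 3 - g2 * e" using e by simp
  have a0: "a \<noteq> 0"
  proof
    assume "a = 0"
    then have b: "b = e / 5" using s(1) by simp
    have "15 * g2 - 36 * e\<^sup>2 = 0" unfolding g2 b by (simp add: field_simps power2_eq_square)
    then show False using quartic_nonzero[OF gen e] by simp
  qed
  note nd = root_nondegenerate[OF e]
  define p where "p = 2 * b - e - A"
  define q where "q = b\<^sup>2 - 2 * b * e - A * e"
  define r where "r = - e * b\<^sup>2 - A * (e\<^sup>2 - g2 / 4)"
  have "p\<^sup>2 * q\<^sup>2 - 4 * 1 * q ^ 3 - 4 * p ^ 3 * r - 27 * 1\<^sup>2 * r\<^sup>2 + 18 * 1 * p * q * r =
     - (4 / 375) * ((2 * b - e)\<^sup>2 * (5 * b\<^sup>2 - 5 * b * e + 8 * e\<^sup>2) * (5 * b - e) * (95 * b - 7 * e))"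
    unfolding p_def q_def r_def A g2 by (simp add: field_simps power2_eq_square power3_eq_cube)
  moreover have "2 * b - e \<noteq> 0"
  proof
    assume "2 * b - e = 0"
    then have "e = 2 * b" by simp
    then have "3 * e\<^sup>2 = g2" unfolding g2 by (simp add: field_simps power2_eq_square)
    then show False using nd by simp
  qed
  moreover have "5 * b\<^sup>2 - 5 * b * e + 8 * e\<^sup>2 \<noteq> 0"
  proof
    assume "5 * b\<^sup>2 - 5 * b * e + 8 * e\<^sup>2 = 0"
    moreover have "12 * e\<^sup>2 - g2 = 4 / 3 * (5 * b\<^sup>2 - 5 * b * e + 8 * e\<^sup>2)"
      unfolding g2 by (simp add: field_simps power2_eq_square)
    ultimately show False using nd by simp
  qed
  moreover have "5 * b - e \<noteq> 0"
  proof -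
    have "5 * b - e = 5 * a\<^sup>2" using s(1) by simp
    then show ?thesis using a0 by simp
  qed
  moreover have "95 * b - 7 * e \<noteq> 0"
  proof
    assume *: "95 * b - 7 * e = 0"
    have b: "b = 7 / 95 * e" using * by (simp add: field_simps)
    \<comment> \<open>These values give \<open>g2 ^ 3\<close> and \<open>g3\<^sup>2\<close> the
      ratio \<open>27 * 269 ^ 3 / (5 * 9481\<^sup>2)\<close>, the origin of the two large constants
      in \<open>generic\<close>.\<close>
    have g2': "g2 = 16140 / 9025 * e\<^sup>2" unfolding g2 b by (simp add: field_simps power2_eq_square)
    have g3': "g3 = 1896200 / 857375 * e ^ 3" unfolding g3 g2' by (simp add: field_simps power2_eq_square power3_eq_cube)
    have "449446805 * g2 ^ 3 = 525557943 * g3\<^sup>2"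
      unfolding g2' g3' by (simp add: field_simps power2_eq_square power3_eq_cube)
    then show False using gen by (simp add: generic_def)
  qed
  ultimately have "p\<^sup>2 * q\<^sup>2 - 4 * 1 * q ^ 3 - 4 * p ^ 3 * r - 27 * 1\<^sup>2 * r\<^sup>2 + 18 * 1 * p * q * r \<noteq> 0" by simp
  then obtain x1 x2 x3 where x: "x1 \<noteq> x2" "x1 \<noteq> x3" "x2 \<noteq> x3"
    "\<And>x. x \<in> {x1, x2, x3} \<Longrightarrow> 1 * x ^ 3 + p * x\<^sup>2 + q * x + r = 0"
    using cubic_distinct_roots[of 1 p q r] by auto
  have conv: "(x - e) * (x + b)\<^sup>2 - A * (x\<^sup>2 + e * x + e\<^sup>2 - g2 / 4) = 1 * x ^ 3 + p * x\<^sup>2 + q * x + r" for x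
    unfolding p_def q_def r_def by (simp add: field_simps power2_eq_square power3_eq_cube)
  show ?thesis
  proof (rule solB_good[OF e ab a0 nd(1) x(1-3)])
    fix x assume "x \<in> {x1, x2, x3}"
    then show "(x - e) * (x + b)\<^sup>2 - a\<^sup>2 * (x\<^sup>2 + e * x + e\<^sup>2 - g2 / 4) = 0"
      unfolding A_def[symmetric] conv by (rule x(4))
  qed
qed

theorem N5_generic:
  assumes generic shows "N5 \<tau> = 16"
proof -
  have A: "good q" if q: "q \<in> solA" for q
  proof -
    from q obtain a b where "q = (a\<^sup>2, 2 * a, 2 * b)" "a * b = g2 / 5" "b\<^sup>2 = 3 / 5 * g3 - a\<^sup>2 * g2 / 12"
      unfolding solA_def by blast
    then show ?thesis using solA_distinct[OF assms] by simp
  qed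
  have B: "good q" if q: "q \<in> solB" for q
  proof -
    from q obtain e a b where "q = (4 * (2 * b - e + a\<^sup>2), 4 * a, 4 * (a * b))"
      and eab: "4 * e ^ 3 - g2 * e - g3 = 0" "4 * (b\<^sup>2 - 2 * b * e + a\<^sup>2 * e) = - (3 / 5) * g2"
        "4 * (a\<^sup>2 * (e\<^sup>2 - g2 / 4) - e * b\<^sup>2) = - (2 / 5) * g3 - 4 * (2 * b - e + a\<^sup>2) * g2 / 12"
      unfolding solB_def by blast
    then show ?thesis using solB_distinct[OF assms eab] by simp
  qed
  have "{q. good q} = solA \<union> solB" using A B good_imp_sol by blast
  moreover have cA: "card solA = 4" by (rule card_solA) (use assms in \<open>simp add: generic_def\<close>)
  then have "finite solA" by (metis card.infinite zero_neq_numeral)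
  then have "card (solA \<union> solB) = card solA + card solB"
    by (rule card_Un_disjoint[OF _ card_solB(2)[OF assms] solA_solB_disjoint[OF assms]])
  ultimately show ?thesis unfolding N5_eq_card_good using cA card_solB(1)[OF assms] by simp
qed

end

section \<open>The invariants determine the lattice\<close>

text \<open>The difference of two solutions of the Weierstrass equation with the same principal part would have
  order \<open>-3\<close> at the origin.\<close>
lemma weierstrass_ode_unique:
  fixes \<phi>1 \<phi>2 :: "complex \<Rightarrow> complex"
  assumes r: "r > 0" and hol: "\<phi>1 holomorphic_on ball 0 r" "\<phi>2 holomorphic_on ball 0 r"
    and ode1: "\<And>z. z \<in> ball 0 r \<Longrightarrow> z \<noteq> 0 \<Longrightarrow>
      (- 2 / z ^ 3 + deriv \<phi>1 z)\<^sup>2 = 4 * (1 / z\<^sup>2 + \<phi>1 z) ^ 3 - a * (1 / z\<^sup>2 + \<phi>1 z) - b"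
    and ode2: "\<And>z. z \<in> ball 0 r \<Longrightarrow> z \<noteq> 0 \<Longrightarrow>
      (- 2 / z ^ 3 + deriv \<phi>2 z)\<^sup>2 = 4 * (1 / z\<^sup>2 + \<phi>2 z) ^ 3 - a * (1 / z\<^sup>2 + \<phi>2 z) - b"
    and z: "z \<in> ball 0 r"
  shows "\<phi>1 z = \<phi>2 z"
proof (rule ccontr)
  assume ne: "\<phi>1 z \<noteq> \<phi>2 z"
  define \<delta> where "\<delta> = (\<lambda>z. \<phi>1 z - \<phi>2 z)"
  have dh: "\<delta> holomorphic_on ball 0 r" unfolding \<delta>_def by (intro holomorphic_intros hol)
  have ex: "\<exists>w\<in>ball 0 r. \<delta> w \<noteq> 0" using ne z by (auto simp: \<delta>_def)
  have "0 \<in> ball (0::complex) r" using r by simp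
  define d where "d = zor_poly \<delta> 0"
  define m where "m = nat (zorder \<delta> 0)"
  have "\<exists>s>0. cball (0::complex) s \<subseteq> ball 0 r \<and> d holomorphic_on cball 0 s \<and>
    (\<forall>w\<in>cball 0 s. \<delta> w = d w * (w - 0) ^ m \<and> d w \<noteq> 0)"
    using conjunct2[OF zorder_exist_zero[OF dh open_ball connected_ball _ ex, of 0]] r
    unfolding d_def m_def by simp
  then obtain s where s: "s > 0" "cball (0::complex) s \<subseteq> ball 0 r" "d holomorphic_on cball 0 s"
    and d': "\<forall>w\<in>cball 0 s. \<delta> w = d w * (w - 0) ^ m \<and> d w \<noteq> 0" by (elim exE conjE)
  have d: "\<delta> w = d w * w ^ m \<and> d w \<noteq> 0" if "w \<in> cball 0 s" for w using d' that by simp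
  have d0: "d 0 \<noteq> 0" using d[of 0] s by simp
  have dhol: "d holomorphic_on ball 0 s" using s(3) ball_subset_cball holomorphic_on_subset by blast
  define \<phi>s where "\<phi>s = (\<lambda>z. \<phi>1 z + \<phi>2 z)"
  \<comment> \<open>\<open>P\<close> and \<open>Q\<close> are the pole-free versions of the factors
    that arise from subtracting the equations: \<open>w ^ 3\<close> times the sum of the
    derivatives, and \<open>w ^ 4\<close> times the quadratic factor of the difference of
    cubes.\<close>
  define P where "P = (\<lambda>z. - 4 + z ^ 3 * (deriv \<phi>1 z + deriv \<phi>2 z))"
  define Q where "Q = (\<lambda>z. 3 + 3 * z\<^sup>2 * (\<phi>1 z + \<phi>2 z) + z ^ 4 * ((\<phi>1 z)\<^sup>2 + \<phi>1 z * \<phi>2 z + (\<phi>2 z)\<^sup>2))"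
  have key: "P w * (w * deriv d w + of_nat m * d w) = (4 * Q w - a * w ^ 4) * d w" if w: "w \<in> ball 0 s" "w \<noteq> 0" for w
  proof -
    have "w \<in> cball 0 s" using w(1) by simp
    then have wr: "w \<in> ball 0 r" using s(2) by (rule rev_subsetD)
    define u where "u = 1 / w"
    have wu: "w * u = 1" using w by (simp add: u_def)
    have u: "w ^ 4 * u ^ 4 = 1" "w ^ 4 * u\<^sup>2 = w\<^sup>2"
    proof -
      show "w ^ 4 * u ^ 4 = 1" using wu by (simp flip: power_mult_distrib)
      have "w ^ 4 * u\<^sup>2 = w\<^sup>2 * (w * u)\<^sup>2" by (simp add: power2_eq_square power4_eq_xxxx)
      then show "w ^ 4 * u\<^sup>2 = w\<^sup>2" using wu by simp
    qed
    have "deriv \<phi>1 w - deriv \<phi>2 w = deriv \<delta> w"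
      unfolding \<delta>_def using hol wr by (intro deriv_diff [symmetric]) (auto simp: holomorphic_on_imp_differentiable_at)
    also have "\<dots> = deriv d w * w ^ m + d w * (of_nat m * w ^ (m - 1))"
    proof (rule DERIV_imp_deriv)
      have "((\<lambda>w. d w * w ^ m) has_field_derivative deriv d w * w ^ m + d w * (of_nat m * w ^ (m - 1))) (at w)"
        by (rule derivative_eq_intros holomorphic_derivI[OF dhol open_ball w(1)] refl | simp)+
      then show "(\<delta> has_field_derivative deriv d w * w ^ m + d w * (of_nat m * w ^ (m - 1))) (at w)"
        by (rule has_field_derivative_transform_within_open[OF _ open_ball w(1)]) (use d in auto)
    qed
    finally have "w * (deriv \<phi>1 w - deriv \<phi>2 w) = w * deriv d w * w ^ m + d w * (of_nat m * (w * w ^ (m - 1)))"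
      by (simp add: algebra_simps)
    also have "of_nat m * (w * w ^ (m - 1)) = of_nat m * w ^ m" by (cases m) auto
    finally have D: "w * (deriv \<phi>1 w - deriv \<phi>2 w) = w ^ m * (w * deriv d w + of_nat m * d w)"
      by (simp add: algebra_simps)
    have dd: "\<phi>1 w - \<phi>2 w = w ^ m * d w" using d[of w] w by (simp add: \<delta>_def)
    have o1: "(- 2 * u ^ 3 + deriv \<phi>1 w)\<^sup>2 = 4 * (u\<^sup>2 + \<phi>1 w) ^ 3 - a * (u\<^sup>2 + \<phi>1 w) - b"
      and o2: "(- 2 * u ^ 3 + deriv \<phi>2 w)\<^sup>2 = 4 * (u\<^sup>2 + \<phi>2 w) ^ 3 - a * (u\<^sup>2 + \<phi>2 w) - b"
      using ode1[OF wr w(2)] ode2[OF wr w(2)] by (simp_all add: u_def power_divide)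
    have diff: "(- 4 * u ^ 3 + (deriv \<phi>1 w + deriv \<phi>2 w)) * (deriv \<phi>1 w - deriv \<phi>2 w) =
      (4 * (3 * u ^ 4 + 3 * u\<^sup>2 * (\<phi>1 w + \<phi>2 w) + ((\<phi>1 w)\<^sup>2 + \<phi>1 w * \<phi>2 w + (\<phi>2 w)\<^sup>2)) - a) * (\<phi>1 w - \<phi>2 w)"
    proof -
      have "(- 4 * u ^ 3 + (deriv \<phi>1 w + deriv \<phi>2 w)) * (deriv \<phi>1 w - deriv \<phi>2 w) =
        (- 2 * u ^ 3 + deriv \<phi>1 w)\<^sup>2 - (- 2 * u ^ 3 + deriv \<phi>2 w)\<^sup>2"
        by (simp add: algebra_simps power2_eq_square)
      also have "\<dots> = (4 * (3 * u ^ 4 + 3 * u\<^sup>2 * (\<phi>1 w + \<phi>2 w) + ((\<phi>1 w)\<^sup>2 + \<phi>1 w * \<phi>2 w + (\<phi>2 w)\<^sup>2)) - a) * (\<phi>1 w - \<phi>2 w)"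
        unfolding o1 o2 by (simp add: algebra_simps power2_eq_square power3_eq_cube power4_eq_xxxx)
      finally show ?thesis .
    qed
    have P: "w ^ 3 * (- 4 * u ^ 3 + (deriv \<phi>1 w + deriv \<phi>2 w)) = P w"
    proof -
      have "w ^ 3 * u ^ 3 = 1" using wu by (simp flip: power_mult_distrib)
      moreover have "w ^ 3 * (- 4 * u ^ 3 + D) = - 4 * (w ^ 3 * u ^ 3) + w ^ 3 * D" for D by (simp add: algebra_simps)
      ultimately show ?thesis unfolding P_def by simp
    qed
    have Q: "w ^ 4 * (4 * (3 * u ^ 4 + 3 * u\<^sup>2 * (\<phi>1 w + \<phi>2 w) + ((\<phi>1 w)\<^sup>2 + \<phi>1 w * \<phi>2 w + (\<phi>2 w)\<^sup>2)) - a) = 4 * Q w - a * w ^ 4"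
    proof -
      have "w ^ 4 * (4 * (3 * u ^ 4 + 3 * u\<^sup>2 * S + T) - a) = 4 * (3 * (w ^ 4 * u ^ 4) + 3 * (w ^ 4 * u\<^sup>2) * S + w ^ 4 * T) - a * w ^ 4" for S T
        by (simp add: algebra_simps)
      then show ?thesis unfolding Q_def by (simp only: u mult_1_right)
    qed
    have "P w * (w * (deriv \<phi>1 w - deriv \<phi>2 w)) = (4 * Q w - a * w ^ 4) * (\<phi>1 w - \<phi>2 w)"
    proof -
      have "P w * (w * (deriv \<phi>1 w - deriv \<phi>2 w)) = w ^ 4 * ((- 4 * u ^ 3 + (deriv \<phi>1 w + deriv \<phi>2 w)) * (deriv \<phi>1 w - deriv \<phi>2 w))"
        unfolding P[symmetric] by (simp add: power4_eq_xxxx power3_eq_cube)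
      also have "\<dots> = (4 * Q w - a * w ^ 4) * (\<phi>1 w - \<phi>2 w)" unfolding diff Q[symmetric] by (simp only: mult.assoc)
      finally show ?thesis .
    qed
    then have "w ^ m * (P w * (w * deriv d w + of_nat m * d w)) = w ^ m * ((4 * Q w - a * w ^ 4) * d w)"
      unfolding D dd by (simp only: mult_ac)
    then show ?thesis using w by simp
  qed
  have lim: "(f \<longlongrightarrow> f 0) (at 0)" if "f holomorphic_on ball 0 s" for f :: "complex \<Rightarrow> complex"
  proof -
    have "f analytic_on {0}" using that s(1) analytic_at by (meson centre_in_ball open_ball)
    then show ?thesis by (intro isContD analytic_at_imp_isCont)
  qed
  have sr: "ball (0::complex) s \<subseteq> ball 0 r" using s(2) by auto
  have hs: "\<phi>1 holomorphic_on ball 0 s" "\<phi>2 holomorphic_on ball 0 s" using hol sr holomorphic_on_subset by blast+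
  define lhs rhs where "lhs = (\<lambda>w. P w * (w * deriv d w + of_nat m * d w))" and "rhs = (\<lambda>w. (4 * Q w - a * w ^ 4) * d w)"
  have "P holomorphic_on ball 0 s" "Q holomorphic_on ball 0 s"
    unfolding P_def Q_def by (intro holomorphic_intros hs; simp)+
  then have "lhs holomorphic_on ball 0 s" "rhs holomorphic_on ball 0 s"
    unfolding lhs_def rhs_def by (intro holomorphic_intros dhol; simp)+
  note lims = lim[OF this(1)] lim[OF this(2)]
  have "eventually (\<lambda>w. w \<in> ball 0 s - {0}) (at 0)" using s(1) by (intro eventually_at_in_open) auto
  then have "eventually (\<lambda>w. lhs w = rhs w) (at 0)" by eventually_elim (use key in \<open>auto simp: lhs_def rhs_def\<close>)
  from Lim_transform_eventually[OF lims(1) this] have "lhs 0 = rhs 0"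
    using tendsto_unique[OF at_neq_bot _ lims(2)] by blast
  \<comment> \<open>\<open>P 0 = - 4\<close> and \<open>Q 0 = 3\<close>, so the identity at 0 asks
    for \<open>m = - 3\<close>, impossible for a natural number.\<close>
  then have "- 4 * of_nat m * d 0 = 12 * d 0" by (simp add: lhs_def rhs_def P_def Q_def)
  then have "- 4 * of_nat m = (12 :: complex)" using d0 by (simp only: mult_cancel_right) simp
  from arg_cong[OF this, of Re] show False by simp
qed

lemma (in period_lattice) wp0_ode: "eventually (\<lambda>z. (- 2 / z ^ 3 + deriv wp0 z)\<^sup>2 = 4 * (1 / z\<^sup>2 + wp0 z) ^ 3 - g2 * (1 / z\<^sup>2 + wp0 z) - g3) (at 0)"
  using eventually_notin_L[of 0] by eventually_elim (use wp'_squared wp_eq wp'_eq in metis)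

lemma (in period_lattice) wp_pole: "z \<in> L \<Longrightarrow> is_pole wp z"
  using LL_is_pole[OF LL_wp] by simp

text \<open>By homogeneity \<open>l\<^sup>2 * wp (l * z)\<close>, formed for \<sigma>, satisfies the
  equation of \<open>wp\<close> for \<tau>. Uniqueness makes them equal near 0, continuation makes
  them equal off both lattices, and the lattices are recovered as the sets of poles.\<close>

lemma proportional_invariants_imp_same_lattice:
  assumes "Im \<tau> > 0" "Im \<sigma> > 0" "l \<noteq> 0"
    and g: "period_lattice.g2 \<tau> = l ^ 4 * period_lattice.g2 \<sigma>" "period_lattice.g3 \<tau> = l ^ 6 * period_lattice.g3 \<sigma>"
  shows "z \<in> period_lattice.L \<tau> \<longleftrightarrow> l * z \<in> period_lattice.L \<sigma>"
proof -
  interpret A: period_lattice \<tau> by unfold_locales (fact assms(1))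
  interpret B: period_lattice \<sigma> by unfold_locales (fact assms(2))
  define \<phi> where "\<phi> = (\<lambda>z. l\<^sup>2 * B.wp0 (l * z))"
  obtain r1 where r1: "r1 > 0" "A.wp0 holomorphic_on ball 0 r1"
    using A.wp0_analytic unfolding analytic_on_def by auto
  obtain r2 where r2: "r2 > 0" "B.wp0 holomorphic_on ball 0 r2"
    using B.wp0_analytic unfolding analytic_on_def by auto
  obtain r3 where r3: "r3 > 0" "\<And>z. z \<noteq> 0 \<Longrightarrow> dist z 0 < r3 \<Longrightarrow>
    (- 2 / z ^ 3 + deriv A.wp0 z)\<^sup>2 = 4 * (1 / z\<^sup>2 + A.wp0 z) ^ 3 - A.g2 * (1 / z\<^sup>2 + A.wp0 z) - A.g3"
    using A.wp0_ode unfolding eventually_at by auto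
  obtain r4 where r4: "r4 > 0" "\<And>z. z \<noteq> 0 \<Longrightarrow> dist z 0 < r4 \<Longrightarrow>
    (- 2 / z ^ 3 + deriv B.wp0 z)\<^sup>2 = 4 * (1 / z\<^sup>2 + B.wp0 z) ^ 3 - B.g2 * (1 / z\<^sup>2 + B.wp0 z) - B.g3"
    using B.wp0_ode unfolding eventually_at by auto
  define r where "r = min (min r1 r3) (min (r2 / norm l) (r4 / norm l))"
  have r: "r > 0" using r1 r2 r3 r4 assms(3) by (simp add: r_def)
  have lz: "norm (l * z) < r2" "norm (l * z) < r4" if "z \<in> ball 0 r" for z
    using that assms(3) by (auto simp: r_def norm_mult pos_less_divide_eq mult.commute)
  have \<phi>hol: "\<phi> holomorphic_on ball 0 r"
    unfolding \<phi>_def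
    by (intro holomorphic_intros holomorphic_on_compose_gen[OF _ r2(2), unfolded o_def]) (use lz in auto)
  have \<phi>d: "deriv \<phi> z = l ^ 3 * deriv B.wp0 (l * z)" if "z \<in> ball 0 r" for z
  proof (rule DERIV_imp_deriv)
    have "(B.wp0 has_field_derivative deriv B.wp0 (l * z)) (at (l * z))"
      using holomorphic_derivI[OF r2(2) open_ball] lz[OF that] by simp
    then have "((\<lambda>z. B.wp0 (l * z)) has_field_derivative deriv B.wp0 (l * z) * l) (at z)"
      by (rule DERIV_chain2) (auto intro!: derivative_eq_intros)
    from DERIV_cmult[OF this, of "l\<^sup>2"] show "(\<phi> has_field_derivative l ^ 3 * deriv B.wp0 (l * z)) (at z)"
      unfolding \<phi>_def by (simp add: power2_eq_square power3_eq_cube mult_ac)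
  qed
  have eq: "A.wp0 z = \<phi> z" if "z \<in> ball 0 r" for z
  proof (rule weierstrass_ode_unique[OF r _ \<phi>hol _ _ that, of _ A.g2 A.g3])
    show "A.wp0 holomorphic_on ball 0 r" using r1(2) by (rule holomorphic_on_subset) (auto simp: r_def)
    show "(- 2 / z ^ 3 + deriv A.wp0 z)\<^sup>2 = 4 * (1 / z\<^sup>2 + A.wp0 z) ^ 3 - A.g2 * (1 / z\<^sup>2 + A.wp0 z) - A.g3"
      if "z \<in> ball 0 r" "z \<noteq> 0" for z using that by (intro r3(2)) (auto simp: r_def)
    show "(- 2 / z ^ 3 + deriv \<phi> z)\<^sup>2 = 4 * (1 / z\<^sup>2 + \<phi> z) ^ 3 - A.g2 * (1 / z\<^sup>2 + \<phi> z) - A.g3"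
      if z: "z \<in> ball 0 r" "z \<noteq> 0" for z
    proof -
      have o: "(- 2 / (l * z) ^ 3 + deriv B.wp0 (l * z))\<^sup>2 = 4 * (1 / (l * z)\<^sup>2 + B.wp0 (l * z)) ^ 3
          - B.g2 * (1 / (l * z)\<^sup>2 + B.wp0 (l * z)) - B.g3"
        using z lz[OF z(1)] assms(3) by (intro r4(2)) auto
      have e1: "- 2 / z ^ 3 + deriv \<phi> z = l ^ 3 * (- 2 / (l * z) ^ 3 + deriv B.wp0 (l * z))"
        unfolding \<phi>d[OF z(1)] using assms(3) by (simp add: power_mult_distrib right_diff_distrib)
      have e2: "1 / z\<^sup>2 + \<phi> z = l\<^sup>2 * (1 / (l * z)\<^sup>2 + B.wp0 (l * z))"
        unfolding \<phi>_def using assms(3) by (simp add: power_mult_distrib distrib_left)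
      have s1: "(l ^ 3 * Y)\<^sup>2 = l ^ 6 * Y\<^sup>2" for Y by (simp add: power_mult_distrib flip: power_mult)
      have s2: "4 * (l\<^sup>2 * X) ^ 3 - A.g2 * (l\<^sup>2 * X) - A.g3 = l ^ 6 * (4 * X ^ 3 - B.g2 * X - B.g3)" for X
      proof -
        have "l ^ 4 * l\<^sup>2 = l ^ 6" by (simp flip: power_add)
        then have "A.g2 * (l\<^sup>2 * X) = l ^ 6 * (B.g2 * X)" unfolding g by (metis mult.assoc mult.commute)
        moreover have "(l\<^sup>2 * X) ^ 3 = l ^ 6 * X ^ 3" by (simp add: power_mult_distrib flip: power_mult)
        ultimately have "4 * (l\<^sup>2 * X) ^ 3 - A.g2 * (l\<^sup>2 * X) - A.g3 = 4 * (l ^ 6 * X ^ 3) - l ^ 6 * (B.g2 * X) - l ^ 6 * B.g3"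
          using g(2) by (simp only:)
        then show ?thesis by (simp add: right_diff_distrib mult_ac)
      qed
      show ?thesis unfolding e1 e2 s1 s2 o ..
    qed
  qed
  define M where "M = {z. l * z \<in> B.L}"
  have Mc: "closed M"
  proof -
    have "closed ((\<lambda>z. l * z) -` B.L)" by (intro closed_vimage B.L_closed continuous_intros)
    moreover have "(\<lambda>z. l * z) -` B.L = M" by (auto simp: M_def)
    ultimately show ?thesis by simp
  qed
  have Mcnt: "countable M"
  proof -
    have "M = (\<lambda>w. w / l) ` B.L" using assms(3) by (auto simp: M_def image_iff field_simps)
    then show ?thesis using B.L_countable by simp
  qed
  \<comment> \<open>Both sets are closed and countable, so their common complement is open and
    connected, as the continuation requires.\<close>
  define D where "D = - (A.L \<union> M)"
  have Dopen: "open D" unfolding D_def using A.L_closed Mc by (intro open_Compl closed_Un)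
  have Dconn: "connected D"
    unfolding D_def using A.L_countable Mcnt by (intro path_connected_imp_connected path_connected_complement_countable) auto
  define X where "X = (\<lambda>z. l\<^sup>2 * B.wp (l * z))"
  have Xhol: "X holomorphic_on - M" unfolding X_def
    by (intro holomorphic_intros holomorphic_on_compose_gen[OF _ B.wp_holo, unfolded o_def]) (auto simp: M_def)
  have evD: "eventually (\<lambda>w. w \<in> D) (at z)" for z
  proof -
    have "eventually (\<lambda>w. l * w \<notin> B.L) (at z)"
    proof -
      have "filterlim (\<lambda>w. l * w) (at (l * z)) (at z)"
        using assms(3) by (auto intro!: filterlim_atI tendsto_eq_intros simp: eventually_at_filter)
      from eventually_compose_filterlim[OF B.eventually_notin_L this] show ?thesis .
    qed
    with A.eventually_notin_L[of z] show ?thesis by eventually_elim (auto simp: D_def M_def)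
  qed
  have near0: "A.wp z = X z" if "z \<in> D" "z \<in> ball 0 r" for z
  proof -
    have "z \<notin> A.L" "l * z \<notin> B.L" using that by (auto simp: D_def M_def)
    then have "A.wp z = 1 / z\<^sup>2 + A.wp0 z" "B.wp (l * z) = 1 / (l * z)\<^sup>2 + B.wp0 (l * z)"
      using A.wp_eq B.wp_eq by auto
    then show ?thesis using eq[OF that(2)] assms(3) by (simp add: X_def \<phi>_def power_mult_distrib distrib_left)
  qed
  obtain z0 where z0: "z0 \<in> D" "z0 \<in> ball 0 r"
  proof -
    have "eventually (\<lambda>w. w \<in> ball 0 r) (at (0::complex))" using r by (intro eventually_at_in_open') auto
    with evD[of 0] have "eventually (\<lambda>w. w \<in> D \<and> w \<in> ball 0 r) (at (0::complex))" by (rule eventually_conj)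
    then show ?thesis using eventually_happens'[OF at_neq_bot] that by blast
  qed
  have eqD: "A.wp z = X z" if "z \<in> D" for z
  proof -
    have "A.wp z - X z = 0"
    proof (rule analytic_continuation_open[of "D \<inter> ball 0 r" D "\<lambda>z. A.wp z - X z" "\<lambda>_. 0"])
      show "(\<lambda>z. A.wp z - X z) holomorphic_on D"
        by (intro holomorphic_intros holomorphic_on_subset[OF A.wp_holo] holomorphic_on_subset[OF Xhol]) (auto simp: D_def)
    qed (use Dopen Dconn z0 near0 that in auto)
    then show ?thesis by simp
  qed
  have pole_iff: "is_pole A.wp w \<longleftrightarrow> is_pole X w" for w
    by (rule is_pole_cong[OF _ refl]) (use evD[of w] eqD in \<open>auto elim: eventually_mono\<close>)
  have Ap: "is_pole A.wp w \<longleftrightarrow> w \<in> A.L" for w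
  proof
    assume "is_pole A.wp w"
    then show "w \<in> A.L" using A.holo_imp_analytic[OF A.wp_holo] analytic_at_imp_no_pole by blast
  qed (rule A.wp_pole)
  have Xp: "is_pole X w \<longleftrightarrow> w \<in> M" for w
  proof
    assume p: "is_pole X w"
    show "w \<in> M"
    proof (rule ccontr)
      assume "w \<notin> M"
      then have "X analytic_on {w}" using Xhol Mc analytic_at[of X w] by (metis ComplI open_Compl)
      then show False using p analytic_at_imp_no_pole by blast
    qed
  next
    assume "w \<in> M"
    then have "is_pole B.wp (l * w)" using B.wp_pole by (simp add: M_def)
    then have "is_pole (\<lambda>z. B.wp (l * z)) w"
      by (rule is_pole_compose) (use assms(3) in \<open>auto intro!: tendsto_eq_intros simp: eventually_at_filter\<close>)
    moreover have "is_pole (\<lambda>z. l\<^sup>2 * B.wp (l * z)) w \<longleftrightarrow> is_pole (\<lambda>z. B.wp (l * z)) w"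
      using assms(3) by (intro is_pole_cmult_iff) auto
    ultimately show "is_pole X w" by (simp add: X_def)
  qed
  show ?thesis using pole_iff[of z] Ap[of z] Xp[of z] by (simp add: M_def)
qed

text \<open>Up to the factor \<open>l\<close> each basis is an integer combination of the other, so
  the two integer matrices are inverse to each other and have determinant 1 or -1; the half-plane
  conditions select 1.\<close>

lemma same_lattice_imp_SL2Z_equiv:
  assumes "Im \<tau> > 0" "Im \<sigma> > 0" "l \<noteq> 0" and L: "\<And>z. z \<in> period_lattice.L \<tau> \<longleftrightarrow> l * z \<in> period_lattice.L \<sigma>"
  shows "SL2Z_equiv \<tau> \<sigma>"
proof -
  interpret A: period_lattice \<tau> by unfold_locales (fact assms(1))
  interpret B: period_lattice \<sigma> by unfold_locales (fact assms(2))
  have "l * 1 \<in> B.L" "l * \<tau> \<in> B.L" using L A.L_1 A.L_tau by blast+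
  then obtain p q m n :: int where pq: "l = of_int p + of_int q * \<sigma>" and mn: "l * \<tau> = of_int m + of_int n * \<sigma>"
    unfolding B.L_def by auto
  have "1 / l \<in> A.L" "\<sigma> / l \<in> A.L" using L[of "1 / l"] L[of "\<sigma> / l"] assms(3) by simp_all
  then obtain s t u v :: int where "1 / l = of_int s + of_int t * \<tau>" "\<sigma> / l = of_int u + of_int v * \<tau>"
    unfolding A.L_def by auto
  then have st: "1 = of_int s * l + of_int t * (l * \<tau>)" and uv: "\<sigma> = of_int u * l + of_int v * (l * \<tau>)"
    using assms(3) by (simp_all add: field_simps)
  have indep: "i = 0 \<and> j = 0" if "of_int i + of_int j * \<sigma> = 0" for i j :: int
  proof -
    have "j = 0" using arg_cong[OF that, of Im] assms(2) by simp
    then show ?thesis using that by simp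
  qed
  have "of_int (s * p + t * m - 1) + of_int (s * q + t * n) * \<sigma> = 0"
    using st unfolding mn unfolding pq by (simp add: algebra_simps)
  then have 1: "s * p + t * m = 1" "s * q + t * n = 0" using indep by fastforce+
  have "of_int (u * p + v * m) + of_int (u * q + v * n - 1) * \<sigma> = 0"
    using uv unfolding mn unfolding pq by (simp add: algebra_simps)
  then have 2: "u * p + v * m = 0" "u * q + v * n = 1" using indep by fastforce+
  have "(n * p - m * q) * (v * s - u * t) = (s * p + t * m) * (u * q + v * n) - (s * q + t * n) * (u * p + v * m)"
    by (simp add: algebra_simps)
  then have "(n * p - m * q) * (v * s - u * t) = 1" using 1 2 by simp
  then have pm: "n * p - m * q = 1 \<or> n * p - m * q = - 1" using zmult_eq_1_iff by auto
  \<comment> \<open>Multiplying by \<open>cnj l\<close> isolates the determinant: it has the sign of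
    \<open>Im \<tau> / Im \<sigma>\<close>.\<close>
  have "Im (l * \<tau> * cnj l) = of_int (n * p - m * q) * Im \<sigma>"
    unfolding mn unfolding pq by (simp add: algebra_simps)
  moreover have "Im (l * \<tau> * cnj l) = (norm l)\<^sup>2 * Im \<tau>"
    unfolding cmod_power2 by (simp add: algebra_simps power2_eq_square)
  moreover have "(norm l)\<^sup>2 * Im \<tau> > 0" using assms by simp
  ultimately have "of_int (n * p - m * q) * Im \<sigma> > 0" by simp
  then have "n * p - m * q \<noteq> - 1" using assms(2) by (metis mult_minus_left mult_1_left neg_0_less_iff_less of_int_1 of_int_minus order_less_asym)
  then have "n * p - m * q = 1" using pm by blast
  moreover have "\<tau> = (of_int n * \<sigma> + of_int m) / (of_int q * \<sigma> + of_int p)"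
    using mn assms(3) unfolding pq by (simp add: field_simps)
  ultimately show ?thesis unfolding SL2Z_equiv_def by blast
qed

lemma complex_root_exists:
  assumes "n > 0" obtains z :: complex where "z ^ n = w"
proof (cases "w = 0")
  case True then show ?thesis using that[of 0] assms by (simp add: zero_power)
next
  case False
  have "exp (Ln w / of_nat n) ^ n = exp (of_nat n * (Ln w / of_nat n))" by (simp only: exp_of_nat_mult)
  also have "\<dots> = w" using assms False by simp
  finally show ?thesis by (rule that)
qed

text \<open>Nonvanishing of \<open>k\<close> and of the discriminant makes both \<open>g3\<close>
  nonzero, so a scaling factor between the lattices can be found from quotients of
  invariants.\<close>

lemma SL2Z_equiv_if_proportional:
  assumes "Im \<tau> > 0" "Im \<sigma> > 0" "k \<noteq> 0"
    "k * period_lattice.g2 \<tau> ^ 3 = c * (period_lattice.g3 \<tau>)\<^sup>2" "k * period_lattice.g2 \<sigma> ^ 3 = c * (period_lattice.g3 \<sigma>)\<^sup>2"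
  shows "SL2Z_equiv \<tau> \<sigma>"
proof -
  interpret A: period_lattice \<tau> by unfold_locales (fact assms(1))
  interpret B: period_lattice \<sigma> by unfold_locales (fact assms(2))
  note k = assms(4,5)
  have a3: "A.g3 \<noteq> 0" using k(1) assms(3) A.discriminant_nonzero by auto
  have b3: "B.g3 \<noteq> 0" using k(2) assms(3) B.discriminant_nonzero by auto
  have "\<exists>l. A.g2 = l ^ 4 * B.g2 \<and> A.g3 = l ^ 6 * B.g3"
  proof (cases "c = 0")
    case True
    then have "A.g2 = 0" "B.g2 = 0" using k assms(3) by auto
    moreover obtain l where "l ^ 6 = A.g3 / B.g3" using complex_root_exists[of 6] by auto
    ultimately show ?thesis using b3 by (intro exI[of _ l]) simp
  next
    case False
    have a2: "A.g2 \<noteq> 0" "B.g2 \<noteq> 0" using k a3 b3 False by auto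
    \<comment> \<open>\<open>l ^ 4\<close> and \<open>l ^ 6\<close> must be the quotients of the two
      \<open>g2\<close> and of the two \<open>g3\<close>, so \<open>l\<^sup>2\<close> has to be the
      quotient of these quotients.\<close>
    define \<mu> where "\<mu> = A.g3 * B.g2 / (A.g2 * B.g3)"
    obtain l where l: "l ^ 2 = \<mu>" using complex_root_exists[of 2] by auto
    have ka: "A.g2 ^ 3 = c / k * A.g3\<^sup>2" "B.g2 ^ 3 = c / k * B.g3\<^sup>2" using k assms(3) by (simp_all add: field_simps)
    have cross: "A.g3\<^sup>2 * B.g2 ^ 3 = B.g3\<^sup>2 * A.g2 ^ 3" unfolding ka by (simp add: mult_ac)
    have "l ^ 4 = \<mu>\<^sup>2" "l ^ 6 = \<mu> ^ 3" unfolding l[symmetric] by (simp_all flip: power_mult)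
    moreover have "\<mu>\<^sup>2 * B.g2 = A.g2"
    proof -
      have "\<mu>\<^sup>2 * B.g2 = A.g3\<^sup>2 * B.g2 ^ 3 / (A.g2\<^sup>2 * B.g3\<^sup>2)"
        by (simp add: \<mu>_def power_divide power_mult_distrib power2_eq_square power3_eq_cube mult_ac)
      also have "\<dots> = A.g2" unfolding cross using a2 b3 by (simp add: power2_eq_square power3_eq_cube)
      finally show ?thesis .
    qed
    moreover have "\<mu> ^ 3 * B.g3 = A.g3"
    proof -
      have "\<mu> ^ 3 * B.g3 = A.g3 * (A.g3\<^sup>2 * B.g2 ^ 3) / (A.g2 ^ 3 * B.g3\<^sup>2)" using b3
        by (simp add: \<mu>_def power_divide power_mult_distrib power2_eq_square power3_eq_cube mult_ac)
      also have "\<dots> = A.g3" unfolding cross using a2 b3 by simp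
      finally show ?thesis .
    qed
    ultimately show ?thesis by (intro exI[of _ l]) simp
  qed
  then obtain l where l: "A.g2 = l ^ 4 * B.g2" "A.g3 = l ^ 6 * B.g3" by blast
  then have l0: "l \<noteq> 0" using a3 by auto
  show ?thesis
    by (rule same_lattice_imp_SL2Z_equiv[OF assms(1,2) l0 proportional_invariants_imp_same_lattice[OF assms(1,2) l0 l]])
qed

theorem theorem4p8:
  "\<exists>F :: complex set. finite F \<and>
     (\<forall>\<tau>. Im \<tau> > 0 \<and> (\<forall>\<sigma>\<in>F. \<not> SL2Z_equiv \<tau> \<sigma>) \<longrightarrow> N5 \<tau> = 16)"
proof -
  \<comment> \<open>A pair \<open>(k, c)\<close> stands for the excluded condition
    \<open>k * g2 ^ 3 = c * g3\<^sup>2\<close>; \<open>(1, 0)\<close> encodes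
    \<open>g2 = 0\<close>.\<close>
  define K :: "(complex \<times> complex) set" where
    "K = {(1, 0), (5, 27), (6241, - 8640), (449446805, 525557943)}"
  define bad where "bad = (\<lambda>(k, c) \<tau>. Im \<tau> > 0 \<and> k * period_lattice.g2 \<tau> ^ 3 = c * (period_lattice.g3 \<tau>)\<^sup>2)"
  \<comment> \<open>One lattice per condition represents all that satisfy it. If none exists, the
    choice is arbitrary and merely excludes a further value.\<close>
  define F where "F = (\<lambda>q. SOME \<tau>. bad q \<tau>) ` K"
  have "N5 \<tau> = 16" if \<tau>: "Im \<tau> > 0" "\<forall>\<sigma>\<in>F. \<not> SL2Z_equiv \<tau> \<sigma>" for \<tau>
  proof -
    interpret period_lattice \<tau> by unfold_locales (fact \<tau>(1))
    have good: "k * g2 ^ 3 \<noteq> c * g3\<^sup>2" if kc: "(k, c) \<in> K" for k c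
    proof
      assume eq: "k * g2 ^ 3 = c * g3\<^sup>2"
      define \<sigma> where "\<sigma> = (SOME \<tau>. bad (k, c) \<tau>)"
      have "bad (k, c) \<tau>" using eq \<tau>(1) by (simp add: bad_def)
      then have "bad (k, c) \<sigma>" unfolding \<sigma>_def by (rule someI)
      then have s: "Im \<sigma> > 0" "k * period_lattice.g2 \<sigma> ^ 3 = c * (period_lattice.g3 \<sigma>)\<^sup>2" by (simp_all add: bad_def)
      have "k \<noteq> 0" using kc by (auto simp: K_def)
      then have "SL2Z_equiv \<tau> \<sigma>" by (rule SL2Z_equiv_if_proportional[OF \<tau>(1) s(1) _ eq s(2)])
      moreover have "\<sigma> \<in> F" unfolding F_def \<sigma>_def using kc by (rule imageI)
      ultimately show False using \<tau>(2) by blast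
    qed
    have generic
      unfolding generic_def using good[of 1 0] good[of 5 27] good[of 6241 "- 8640"] good[of 449446805 525557943]
      by (simp add: K_def)
    then show ?thesis by (rule N5_generic)
  qed
  moreover have "finite F" by (simp add: F_def K_def)
  ultimately show ?thesis by blast
qed

end
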